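(* Let $(\mathbb{K},\mathcal{D})$ be a paradise. For all objects $\mathcal{B},\mathcal{C}\in\mathbb{K}$ there is an isomorphism of 2-categories $$\mathbf{fSpan}^{\Rightarrow}(\mathcal{B},\mathcal{C})\;\cong\;\mathrm{Alg}\bigl(\mathcal{B}^{\downarrow}\ast -,\ \mathrm{Kl}(-\ast\mathcal{C}^{\downarrow},\ \mathbf{dSpan}(\mathcal{B},\mathcal{C}))\bigr).$$
   Context: **Paradises.** A display map 2-category $(\mathbb{K},\mathcal{D})$ is a 2-category $\mathbb{K}$ with a class $\mathcal{D}$ of 1-cells (display maps) such that for each $d:\mathcal{A}\to\mathcal{B}$ in $\mathcal{D}$ and each $f:\mathcal{X}\to\mathcal{B}$ the strict 2-pullback of $d$ along $f$ exists and the pulled-back map $f^*d$ is in $\mathcal{D}$. An arrow object of $\mathcal{C}$ is an object $\mathcal{C}^{\downarrow}$ with 1-cells $\partial_0,\partial_1:\mathcal{C}^{\downarrow}\to\mathcal{C}$ and a 2-cell $\chi:\partial_0\Rightarrow\partial_1$ such that whiskering with $\chi$ gives isomorphisms of categories $\mathbb{K}(\mathcal{X},\mathcal{C}^{\downarrow})\cong\mathbb{K}(\mathcal{X},\mathcal{C})^{\downarrow}$ (category of arrows). A paradise is a display map 2-category such that $\mathcal{D}$ is closed under composition and contains all isomorphisms, $\mathbb{K}$ has all arrow objects, and every $\partial_0:\mathcal{C}^{\downarrow}\to\mathcal{C}$ is in $\mathcal{D}$. **Spans.** A left-displayed span from $\mathcal{B}$ to $\mathcal{C}$ is $\mathcal{B}\xleftarrow{p}\mathcal{E}\xrightarrow{f}\mathcal{C}$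 with $p\in\mathcal{D}$. The 2-category $\mathbf{dSpan}^{\Rightarrow}(\mathcal{B},\mathcal{C})$ has these as objects; 1-cells $(p,\mathcal{E},f)\to(p',\mathcal{E}',f')$ are pairs $(k,\varphi)$ with $k:\mathcal{E}\to\mathcal{E}'$, $p'k=p$, and $\varphi:f'k\Rightarrow f$; 2-cells $(h,\psi)\Rightarrow(k,\varphi)$ are 2-cells $\alpha:h\Rightarrow k$ with $p'\alpha$ an identity and $\varphi\circ f'\alpha=\psi$. $\mathbf{dSpan}(\mathcal{B},\mathcal{C})$ is the sub-2-category with the same objects, the 1-cells with $\varphi$ an identity, and all 2-cells between these. Spans compose by strict pullback, written in diagrammatic order: for $\mathcal{E}$ from $\mathcal{A}$ to $\mathcal{B}$ and $\mathcal{F}$ from $\mathcal{B}$ to $\mathcal{C}$, $\mathcal{E}\ast\mathcal{F}$ is the pullback over $\mathcal{B}$, a span from $\mathcal{A}$ to $\mathcal{C}$. Spans are denoted by their apex. **Fibrations.** For a display map $p:\mathcal{E}\to\mathcal{B}$, the comma object $\mathcal{B}\downarrow p$ is the pullback of $\partial_1:\mathcal{B}^{\downarrow}\to\mathcal{B}$ and $p$ (so $\mathcal{B}\downarrow p=\mathcal{B}^{\downarrow}\ast\mathcal{E}$), with projections $\partial_0:\mathcal{B}\downarrow p\to\mathcal{B}$ and $\partial_1:\mathcal{B}\downarrow p\to\mathcal{E}$. Let $\ulcorner \mathrm{id}_p\urcorner:\mathcal{E}\to\mathcal{B}\downarrow p$ be induced by the identity 2-cell of $p$. A (cloven, displayed)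 fibration is a display map $p$ equipped with a right adjoint $\mathsf{pull}:\mathcal{B}\downarrow p\to\mathcal{E}$ of $\ulcorner\mathrm{id}_p\urcorner$ in the slice over $\mathcal{B}$ (so $p\,\mathsf{pull}=\partial_0$ and the unit and counit are vertical over $\mathcal{B}$). A cartesian functor between fibrations $p_1,p_2$ over $\mathcal{B}$ is $k:\mathcal{E}_1\to\mathcal{E}_2$ with $p_2k=p_1$ such that the mate $k\,\mathsf{pull}_1\Rightarrow\mathsf{pull}_2\,(\mathcal{B}\downarrow k)$ is invertible. $\mathbf{fSpan}^{\Rightarrow}(\mathcal{B},\mathcal{C})$ has as objects the left-displayed spans whose left leg is a fibration, as 1-cells the 1-cells $(k,\varphi)$ of $\mathbf{dSpan}^{\Rightarrow}(\mathcal{B},\mathcal{C})$ with $k$ cartesian, and as 2-cells all 2-cells of $\mathbf{dSpan}^{\Rightarrow}(\mathcal{B},\mathcal{C})$ between them. **Arrow monads, Kleisli, algebras.** The span $\mathcal{C}\xleftarrow{\partial_0}\mathcal{C}^{\downarrow}\xrightarrow{\partial_1}\mathcal{C}$ carries a colax idempotent 2-monad structure (the arrow monad), with unit $\mathcal{C}\to\mathcal{C}^{\downarrow}$ picking identity arrows and multiplication $\mathcal{C}^{\downarrow}\ast\mathcal{C}^{\downarrow}\to\mathcal{C}^{\downarrow}$ composing arrows. Hence $-\ast\mathcal{C}^{\downarrow}$ and $\mathcal{B}^{\downarrow}\ast-$ are (pseudo)monads on $\mathbf{dSpan}(\mathcal{B},\mathcal{C})$, commuting up to associativity of $\ast$.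 $\mathrm{Kl}(-\ast\mathcal{C}^{\downarrow},\mathbf{dSpan}(\mathcal{B},\mathcal{C}))$ is the Kleisli 2-category: same objects; 1-cells $\mathcal{E}\to\mathcal{E}'$ are 1-cells $\mathcal{E}\to\mathcal{E}'\ast\mathcal{C}^{\downarrow}$ of $\mathbf{dSpan}(\mathcal{B},\mathcal{C})$; 2-cells are the 2-cells between these; identities are units and composition is Kleisli composition. On it $\mathcal{B}^{\downarrow}\ast-$ denotes the lift of the monad $\mathcal{B}^{\downarrow}\ast -$ to the Kleisli 2-category. For a colax idempotent 2-monad $S$ on a 2-category $\mathbb{X}$ with unit $\upsilon$, $\mathrm{Alg}(S,\mathbb{X})$ has as objects the objects $a$ of $\mathbb{X}$ equipped with a right adjoint $\alpha:Sa\to a$ to $\upsilon_a:a\to Sa$ with invertible unit; as 1-cells the $\varphi:a\to b$ in $\mathbb{X}$ for which the mate $\varphi\alpha\Rightarrow\beta\,S\varphi$ of the naturality square of $\upsilon$ is invertible; as 2-cells all 2-cells of $\mathbb{X}$. *)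

theory Defs
  imports Main
begin

section \<open>Strict 2-categories\<close>

text \<open>All operations are total functions of the logic; they are only meaningful on the carriers
  \<open>Ob\<close> (objects), \<open>Ar\<close> (1-cells) and \<open>Ce\<close> (2-cells).  All three compositions are written in
  applicative order: the right argument comes first.\<close>

record ('o, 'm, 'c) two_cat =
  Ob :: "'o set"
  Ar :: "'m set"
  Ce :: "'c set"
  Dom :: "'m \<Rightarrow> 'o"
  Cod :: "'m \<Rightarrow> 'o"
  Src :: "'c \<Rightarrow> 'm"
  Tgt :: "'c \<Rightarrow> 'm"
  id1 :: "'o \<Rightarrow> 'm"
  cmp1 :: "'m \<Rightarrow> 'm \<Rightarrow> 'm"  (infixl "\<odot>\<index>" 75)
  id2 :: "'m \<Rightarrow> 'c"
  vcmp :: "'c \<Rightarrow> 'c \<Rightarrow> 'c"  (infixl "\<bullet>\<index>" 65)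
  hcmp :: "'c \<Rightarrow> 'c \<Rightarrow> 'c"  (infixl "\<star>\<index>" 70)

definition hom1 :: "('o, 'm, 'c) two_cat \<Rightarrow> 'o \<Rightarrow> 'o \<Rightarrow> 'm set" where
  "hom1 X a b = {f \<in> Ar X. Dom X f = a \<and> Cod X f = b}"

definition hom2 :: "('o, 'm, 'c) two_cat \<Rightarrow> 'm \<Rightarrow> 'm \<Rightarrow> 'c set" where
  "hom2 X f g = {\<alpha> \<in> Ce X. Src X \<alpha> = f \<and> Tgt X \<alpha> = g}"

definition cells :: "('o, 'm, 'c) two_cat \<Rightarrow> 'o \<Rightarrow> 'o \<Rightarrow> 'c set" where
  "cells X a b = {\<alpha> \<in> Ce X. Src X \<alpha> \<in> hom1 X a b \<and> Tgt X \<alpha> \<in> hom1 X a b}"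

definition lwhisker :: "('o, 'm, 'c) two_cat \<Rightarrow> 'm \<Rightarrow> 'c \<Rightarrow> 'c"  (infixl "\<triangleleft>\<index>" 70) where
  "f \<triangleleft>\<^bsub>X\<^esub> \<alpha> = id2 X f \<star>\<^bsub>X\<^esub> \<alpha>"

definition rwhisker :: "('o, 'm, 'c) two_cat \<Rightarrow> 'c \<Rightarrow> 'm \<Rightarrow> 'c"  (infixl "\<triangleright>\<index>" 70) where
  "\<alpha> \<triangleright>\<^bsub>X\<^esub> f = \<alpha> \<star>\<^bsub>X\<^esub> id2 X f"

locale two_category =
  fixes X :: "('o, 'm, 'c) two_cat" (structure)
  assumes Dom_closed: "f \<in> Ar X \<Longrightarrow> Dom X f \<in> Ob X"
    and Cod_closed: "f \<in> Ar X \<Longrightarrow> Cod X f \<in> Ob X"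
    and Src_closed: "\<alpha> \<in> Ce X \<Longrightarrow> Src X \<alpha> \<in> Ar X"
    and Tgt_closed: "\<alpha> \<in> Ce X \<Longrightarrow> Tgt X \<alpha> \<in> Ar X"
    and Dom_Tgt: "\<alpha> \<in> Ce X \<Longrightarrow> Dom X (Tgt X \<alpha>) = Dom X (Src X \<alpha>)"
    and Cod_Tgt: "\<alpha> \<in> Ce X \<Longrightarrow> Cod X (Tgt X \<alpha>) = Cod X (Src X \<alpha>)"
    and id1_closed: "a \<in> Ob X \<Longrightarrow> id1 X a \<in> hom1 X a a"
    and cmp1_closed: "\<lbrakk>f \<in> hom1 X a b; g \<in> hom1 X b c\<rbrakk> \<Longrightarrow> g \<odot> f \<in> hom1 X a c"
    and cmp1_id1_right: "f \<in> hom1 X a b \<Longrightarrow> f \<odot> id1 X a = f"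
    and cmp1_id1_left: "f \<in> hom1 X a b \<Longrightarrow> id1 X b \<odot> f = f"
    and cmp1_assoc: "\<lbrakk>f \<in> hom1 X a b; g \<in> hom1 X b c; h \<in> hom1 X c d\<rbrakk>
          \<Longrightarrow> (h \<odot> g) \<odot> f = h \<odot> (g \<odot> f)"
    and id2_closed: "f \<in> Ar X \<Longrightarrow> id2 X f \<in> hom2 X f f"
    and vcmp_closed: "\<lbrakk>\<alpha> \<in> hom2 X f g; \<beta> \<in> hom2 X g h\<rbrakk> \<Longrightarrow> \<beta> \<bullet> \<alpha> \<in> hom2 X f h"
    and vcmp_id2_right: "\<alpha> \<in> hom2 X f g \<Longrightarrow> \<alpha> \<bullet> id2 X f = \<alpha>"
    and vcmp_id2_left: "\<alpha> \<in> hom2 X f g \<Longrightarrow> id2 X g \<bullet> \<alpha> = \<alpha>"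
    and vcmp_assoc: "\<lbrakk>\<alpha> \<in> hom2 X f g; \<beta> \<in> hom2 X g h; \<gamma> \<in> hom2 X h k\<rbrakk>
          \<Longrightarrow> (\<gamma> \<bullet> \<beta>) \<bullet> \<alpha> = \<gamma> \<bullet> (\<beta> \<bullet> \<alpha>)"
    and hcmp_closed: "\<lbrakk>\<alpha> \<in> cells X a b; \<beta> \<in> cells X b c\<rbrakk>
          \<Longrightarrow> \<beta> \<star> \<alpha> \<in> hom2 X (Src X \<beta> \<odot> Src X \<alpha>) (Tgt X \<beta> \<odot> Tgt X \<alpha>)"
    and hcmp_id_right: "\<alpha> \<in> cells X a b \<Longrightarrow> \<alpha> \<star> id2 X (id1 X a) = \<alpha>"
    and hcmp_id_left: "\<alpha> \<in> cells X a b \<Longrightarrow> id2 X (id1 X b) \<star> \<alpha> = \<alpha>"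
    and hcmp_assoc: "\<lbrakk>\<alpha> \<in> cells X a b; \<beta> \<in> cells X b c; \<gamma> \<in> cells X c d\<rbrakk>
          \<Longrightarrow> (\<gamma> \<star> \<beta>) \<star> \<alpha> = \<gamma> \<star> (\<beta> \<star> \<alpha>)"
    and hcmp_id2: "\<lbrakk>f \<in> hom1 X a b; g \<in> hom1 X b c\<rbrakk>
          \<Longrightarrow> id2 X g \<star> id2 X f = id2 X (g \<odot> f)"
    and interchange: "\<lbrakk>\<alpha> \<in> cells X a b; \<alpha>' \<in> cells X a b; Tgt X \<alpha> = Src X \<alpha>';
            \<beta> \<in> cells X b c; \<beta>' \<in> cells X b c; Tgt X \<beta> = Src X \<beta>'\<rbrakk>
          \<Longrightarrow> (\<beta>' \<bullet> \<beta>) \<star> (\<alpha>' \<bullet> \<alpha>) = (\<beta>' \<star> \<alpha>') \<bullet> (\<beta> \<star> \<alpha>)"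

definition iso1 :: "('o, 'm, 'c) two_cat \<Rightarrow> 'm \<Rightarrow> bool" where
  "iso1 X f \<longleftrightarrow> f \<in> Ar X \<and>
     (\<exists>g \<in> hom1 X (Cod X f) (Dom X f).
        g \<odot>\<^bsub>X\<^esub> f = id1 X (Dom X f) \<and> f \<odot>\<^bsub>X\<^esub> g = id1 X (Cod X f))"

definition iso2 :: "('o, 'm, 'c) two_cat \<Rightarrow> 'c \<Rightarrow> bool" where
  "iso2 X \<alpha> \<longleftrightarrow> \<alpha> \<in> Ce X \<and>
     (\<exists>\<beta> \<in> hom2 X (Tgt X \<alpha>) (Src X \<alpha>).
        \<beta> \<bullet>\<^bsub>X\<^esub> \<alpha> = id2 X (Src X \<alpha>) \<and> \<alpha> \<bullet>\<^bsub>X\<^esub> \<beta> = id2 X (Tgt X \<alpha>))"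

definition adjunction :: "('o, 'm, 'c) two_cat \<Rightarrow> 'm \<Rightarrow> 'm \<Rightarrow> 'c \<Rightarrow> 'c \<Rightarrow> bool" where
  "adjunction X l r \<eta> \<epsilon> \<longleftrightarrow>
     l \<in> Ar X \<and> r \<in> hom1 X (Cod X l) (Dom X l) \<and>
     \<eta> \<in> hom2 X (id1 X (Dom X l)) (r \<odot>\<^bsub>X\<^esub> l) \<and>
     \<epsilon> \<in> hom2 X (l \<odot>\<^bsub>X\<^esub> r) (id1 X (Cod X l)) \<and>
     (\<epsilon> \<triangleright>\<^bsub>X\<^esub> l) \<bullet>\<^bsub>X\<^esub> (l \<triangleleft>\<^bsub>X\<^esub> \<eta>) = id2 X l \<and>
     (r \<triangleleft>\<^bsub>X\<^esub> \<epsilon>) \<bullet>\<^bsub>X\<^esub> (\<eta> \<triangleright>\<^bsub>X\<^esub> r) = id2 X r"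

text \<open>The mate \<open>u r\<^sub>1 \<Rightarrow> r\<^sub>2 v\<close> of a commutative square \<open>l\<^sub>2 u = v l\<^sub>1\<close>, where \<open>l\<^sub>1\<close> is left adjoint to
  \<open>r\<^sub>1\<close> with counit \<open>\<epsilon>\<^sub>1\<close> and \<open>l\<^sub>2\<close> is left adjoint to \<open>r\<^sub>2\<close> with unit \<open>\<eta>\<^sub>2\<close>:
  the composite \<open>u r\<^sub>1 \<Rightarrow> r\<^sub>2 l\<^sub>2 u r\<^sub>1 = r\<^sub>2 v l\<^sub>1 r\<^sub>1 \<Rightarrow> r\<^sub>2 v\<close>.\<close>

definition mate :: "('o, 'm, 'c) two_cat \<Rightarrow> 'm \<Rightarrow> 'c \<Rightarrow> 'm \<Rightarrow> 'c \<Rightarrow> 'm \<Rightarrow> 'm \<Rightarrow> 'c" where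
  "mate X r\<^sub>1 \<epsilon>\<^sub>1 r\<^sub>2 \<eta>\<^sub>2 u v =
     ((r\<^sub>2 \<odot>\<^bsub>X\<^esub> v) \<triangleleft>\<^bsub>X\<^esub> \<epsilon>\<^sub>1) \<bullet>\<^bsub>X\<^esub> (\<eta>\<^sub>2 \<triangleright>\<^bsub>X\<^esub> (u \<odot>\<^bsub>X\<^esub> r\<^sub>1))"

definition two_functor :: "('o, 'm, 'c) two_cat \<Rightarrow> ('p, 'n, 'd) two_cat \<Rightarrow>
    ('o \<Rightarrow> 'p) \<Rightarrow> ('m \<Rightarrow> 'n) \<Rightarrow> ('c \<Rightarrow> 'd) \<Rightarrow> bool" where
  "two_functor X Y F\<^sub>0 F\<^sub>1 F\<^sub>2 \<longleftrightarrow>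
     (\<forall>a \<in> Ob X. F\<^sub>0 a \<in> Ob Y) \<and>
     (\<forall>f \<in> Ar X. F\<^sub>1 f \<in> hom1 Y (F\<^sub>0 (Dom X f)) (F\<^sub>0 (Cod X f))) \<and>
     (\<forall>\<alpha> \<in> Ce X. F\<^sub>2 \<alpha> \<in> hom2 Y (F\<^sub>1 (Src X \<alpha>)) (F\<^sub>1 (Tgt X \<alpha>))) \<and>
     (\<forall>a \<in> Ob X. F\<^sub>1 (id1 X a) = id1 Y (F\<^sub>0 a)) \<and>
     (\<forall>f \<in> Ar X. \<forall>g \<in> Ar X. Cod X f = Dom X g \<longrightarrow> F\<^sub>1 (g \<odot>\<^bsub>X\<^esub> f) = F\<^sub>1 g \<odot>\<^bsub>Y\<^esub> F\<^sub>1 f) \<and>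
     (\<forall>f \<in> Ar X. F\<^sub>2 (id2 X f) = id2 Y (F\<^sub>1 f)) \<and>
     (\<forall>\<alpha> \<in> Ce X. \<forall>\<beta> \<in> Ce X. Tgt X \<alpha> = Src X \<beta> \<longrightarrow> F\<^sub>2 (\<beta> \<bullet>\<^bsub>X\<^esub> \<alpha>) = F\<^sub>2 \<beta> \<bullet>\<^bsub>Y\<^esub> F\<^sub>2 \<alpha>) \<and>
     (\<forall>\<alpha> \<in> Ce X. \<forall>\<beta> \<in> Ce X. Cod X (Src X \<alpha>) = Dom X (Src X \<beta>)
        \<longrightarrow> F\<^sub>2 (\<beta> \<star>\<^bsub>X\<^esub> \<alpha>) = F\<^sub>2 \<beta> \<star>\<^bsub>Y\<^esub> F\<^sub>2 \<alpha>)"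

definition isomorphic_two_categories :: "('o, 'm, 'c) two_cat \<Rightarrow> ('p, 'n, 'd) two_cat \<Rightarrow> bool" where
  "isomorphic_two_categories X Y \<longleftrightarrow>
     two_category X \<and> two_category Y \<and>
     (\<exists>F\<^sub>0 F\<^sub>1 F\<^sub>2 G\<^sub>0 G\<^sub>1 G\<^sub>2.
        two_functor X Y F\<^sub>0 F\<^sub>1 F\<^sub>2 \<and> two_functor Y X G\<^sub>0 G\<^sub>1 G\<^sub>2 \<and>
        (\<forall>a \<in> Ob X. G\<^sub>0 (F\<^sub>0 a) = a) \<and> (\<forall>b \<in> Ob Y. F\<^sub>0 (G\<^sub>0 b) = b) \<and>
        (\<forall>f \<in> Ar X. G\<^sub>1 (F\<^sub>1 f) = f) \<and> (\<forall>g \<in> Ar Y. F\<^sub>1 (G\<^sub>1 g) = g) \<and>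
        (\<forall>\<alpha> \<in> Ce X. G\<^sub>2 (F\<^sub>2 \<alpha>) = \<alpha>) \<and> (\<forall>\<beta> \<in> Ce Y. F\<^sub>2 (G\<^sub>2 \<beta>) = \<beta>))"


section \<open>Strict 2-pullbacks, arrow objects and paradises\<close>

text \<open>\<open>is_pullback K f d u v\<close>: the square \<open>f u = d v\<close> is a strict 2-pullback of \<open>d\<close> along \<open>f\<close>
  (so \<open>u\<close> is the pulled-back map \<open>f\<^sup>*d\<close>), i.e. composition with \<open>u\<close> and \<open>v\<close> is an isomorphism from the
  category \<open>K(Z, Dom u)\<close> to the pullback of the categories \<open>K(Z, Dom f)\<close> and \<open>K(Z, Dom d)\<close>, for all \<open>Z\<close>;
  the two bijections are on objects and on morphisms.\<close>

definition is_pullback :: "('o, 'm, 'c) two_cat \<Rightarrow> 'm \<Rightarrow> 'm \<Rightarrow> 'm \<Rightarrow> 'm \<Rightarrow> bool" where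
  "is_pullback K f d u v \<longleftrightarrow>
     f \<in> Ar K \<and> d \<in> Ar K \<and> Cod K f = Cod K d \<and>
     u \<in> hom1 K (Dom K u) (Dom K f) \<and> v \<in> hom1 K (Dom K u) (Dom K d) \<and>
     f \<odot>\<^bsub>K\<^esub> u = d \<odot>\<^bsub>K\<^esub> v \<and>
     (\<forall>Z \<in> Ob K.
        bij_betw (\<lambda>h. (u \<odot>\<^bsub>K\<^esub> h, v \<odot>\<^bsub>K\<^esub> h)) (hom1 K Z (Dom K u))
          {(x, y). x \<in> hom1 K Z (Dom K f) \<and> y \<in> hom1 K Z (Dom K d) \<and> f \<odot>\<^bsub>K\<^esub> x = d \<odot>\<^bsub>K\<^esub> y} \<and>
        bij_betw (\<lambda>\<gamma>. (u \<triangleleft>\<^bsub>K\<^esub> \<gamma>, v \<triangleleft>\<^bsub>K\<^esub> \<gamma>)) (cells K Z (Dom K u))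
          {(\<xi>, \<zeta>). \<xi> \<in> cells K Z (Dom K f) \<and> \<zeta> \<in> cells K Z (Dom K d) \<and>
             f \<triangleleft>\<^bsub>K\<^esub> \<xi> = d \<triangleleft>\<^bsub>K\<^esub> \<zeta>})"

text \<open>An arrow object \<open>(\<partial>\<^sub>0, \<partial>\<^sub>1, \<chi>)\<close> of \<open>C\<close>; the object itself is \<open>Dom \<partial>\<^sub>0\<close>.  The two bijections say that
  whiskering with \<open>\<chi>\<close> is bijective on objects and on morphisms, as a functor from \<open>K(Z, Dom \<partial>\<^sub>0)\<close> to the
  category of arrows of \<open>K(Z, C)\<close>, whose morphisms \<open>\<theta> \<rightarrow> \<theta>'\<close> are commutative squares
  \<open>\<theta>' \<bullet> \<xi> = \<zeta> \<bullet> \<theta>\<close>.\<close>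

definition is_arrow_object :: "('o, 'm, 'c) two_cat \<Rightarrow> 'o \<Rightarrow> 'm \<times> 'm \<times> 'c \<Rightarrow> bool" where
  "is_arrow_object K C = (\<lambda>(d\<^sub>0, d\<^sub>1, \<chi>).
     d\<^sub>0 \<in> hom1 K (Dom K d\<^sub>0) C \<and> d\<^sub>1 \<in> hom1 K (Dom K d\<^sub>0) C \<and> \<chi> \<in> hom2 K d\<^sub>0 d\<^sub>1 \<and>
     (\<forall>Z \<in> Ob K.
        bij_betw (\<lambda>h. \<chi> \<triangleright>\<^bsub>K\<^esub> h) (hom1 K Z (Dom K d\<^sub>0)) (cells K Z C) \<and>
        bij_betw (\<lambda>\<gamma>. (\<chi> \<triangleright>\<^bsub>K\<^esub> Src K \<gamma>, d\<^sub>0 \<triangleleft>\<^bsub>K\<^esub> \<gamma>, d\<^sub>1 \<triangleleft>\<^bsub>K\<^esub> \<gamma>, \<chi> \<triangleright>\<^bsub>K\<^esub> Tgt K \<gamma>))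
          (cells K Z (Dom K d\<^sub>0))
          {(\<theta>, \<xi>, \<zeta>, \<theta>'). \<theta> \<in> cells K Z C \<and> \<theta>' \<in> cells K Z C \<and>
             \<xi> \<in> hom2 K (Src K \<theta>) (Src K \<theta>') \<and> \<zeta> \<in> hom2 K (Tgt K \<theta>) (Tgt K \<theta>') \<and>
             \<theta>' \<bullet>\<^bsub>K\<^esub> \<xi> = \<zeta> \<bullet>\<^bsub>K\<^esub> \<theta>}))"

definition display_map_two_category :: "('o, 'm, 'c) two_cat \<Rightarrow> 'm set \<Rightarrow> bool" where
  "display_map_two_category K D \<longleftrightarrow>
     two_category K \<and> D \<subseteq> Ar K \<and>
     (\<forall>d \<in> D. \<forall>f \<in> Ar K. Cod K f = Cod K d \<longrightarrow> (\<exists>u v. is_pullback K f d u v \<and> u \<in> D))"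

definition paradise :: "('o, 'm, 'c) two_cat \<Rightarrow> 'm set \<Rightarrow> bool" where
  "paradise K D \<longleftrightarrow>
     display_map_two_category K D \<and>
     (\<forall>d \<in> D. \<forall>e \<in> D. Cod K d = Dom K e \<longrightarrow> e \<odot>\<^bsub>K\<^esub> d \<in> D) \<and>
     (\<forall>f. iso1 K f \<longrightarrow> f \<in> D) \<and>
     (\<forall>C \<in> Ob K. \<exists>A. is_arrow_object K C A) \<and>
     (\<forall>C \<in> Ob K. \<forall>d\<^sub>0 d\<^sub>1 \<chi>. is_arrow_object K C (d\<^sub>0, d\<^sub>1, \<chi>) \<longrightarrow> d\<^sub>0 \<in> D)"

text \<open>Pullbacks and arrow objects exist in a paradise but are only unique up to isomorphism.  The
  composite of spans and the span \<open>\<C>\<^sup>\<down>\<close> refer to particular ones, given by functions \<open>pb\<close> and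
  \<open>ar\<close>: \<open>pb f d\<close> is a pair \<open>(u, v)\<close> as in \<open>is_pullback K f d u v\<close>, and \<open>ar C\<close> is a triple
  \<open>(\<partial>\<^sub>0, \<partial>\<^sub>1, \<chi>)\<close>.\<close>

definition chosen_pullbacks :: "('o, 'm, 'c) two_cat \<Rightarrow> 'm set \<Rightarrow> ('m \<Rightarrow> 'm \<Rightarrow> 'm \<times> 'm) \<Rightarrow> bool" where
  "chosen_pullbacks K D pb \<longleftrightarrow>
     (\<forall>d \<in> D. \<forall>f \<in> Ar K. Cod K f = Cod K d
        \<longrightarrow> is_pullback K f d (fst (pb f d)) (snd (pb f d)))"

definition chosen_arrow_objects :: "('o, 'm, 'c) two_cat \<Rightarrow> ('o \<Rightarrow> 'm \<times> 'm \<times> 'c) \<Rightarrow> bool" where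
  "chosen_arrow_objects K ar \<longleftrightarrow> (\<forall>C \<in> Ob K. is_arrow_object K C (ar C))"

text \<open>The 1-cell into a pullback with projections \<open>(u, v)\<close> that is induced by a commutative square,
  the analogous 2-cell, and the 1-cell into an arrow object induced by a 2-cell.\<close>

definition tup1 :: "('o, 'm, 'c) two_cat \<Rightarrow> 'm \<times> 'm \<Rightarrow> 'm \<Rightarrow> 'm \<Rightarrow> 'm" where
  "tup1 K = (\<lambda>(u, v) x y.
     THE h. h \<in> hom1 K (Dom K x) (Dom K u) \<and> u \<odot>\<^bsub>K\<^esub> h = x \<and> v \<odot>\<^bsub>K\<^esub> h = y)"

definition tup2 :: "('o, 'm, 'c) two_cat \<Rightarrow> 'm \<times> 'm \<Rightarrow> 'c \<Rightarrow> 'c \<Rightarrow> 'c" where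
  "tup2 K = (\<lambda>(u, v) \<xi> \<zeta>.
     THE \<gamma>. \<gamma> \<in> cells K (Dom K (Src K \<xi>)) (Dom K u) \<and> u \<triangleleft>\<^bsub>K\<^esub> \<gamma> = \<xi> \<and> v \<triangleleft>\<^bsub>K\<^esub> \<gamma> = \<zeta>)"

definition arrow_name :: "('o, 'm, 'c) two_cat \<Rightarrow> 'm \<times> 'm \<times> 'c \<Rightarrow> 'c \<Rightarrow> 'm" where
  "arrow_name K = (\<lambda>(d\<^sub>0, d\<^sub>1, \<chi>) \<theta>.
     THE h. h \<in> hom1 K (Dom K (Src K \<theta>)) (Dom K d\<^sub>0) \<and> \<chi> \<triangleright>\<^bsub>K\<^esub> h = \<theta>)"


section \<open>Left-displayed spans\<close>

datatype ('o, 'm) span = Span (lleg: 'm) (apex: 'o) (rleg: 'm)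

datatype ('o, 'm, 'c) span_map =
  SpanMap (mdom: "('o, 'm) span") (und: 'm) (phi: 'c) (mcod: "('o, 'm) span")

datatype ('o, 'm, 'c) span_cell =
  SpanCell (csrc: "('o, 'm, 'c) span_map") (cund: 'c) (ctgt: "('o, 'm, 'c) span_map")

definition span_maps_id :: "('o, 'm, 'c) two_cat \<Rightarrow> ('o, 'm) span \<Rightarrow> ('o, 'm, 'c) span_map" where
  "span_maps_id K S = SpanMap S (id1 K (apex S)) (id2 K (rleg S)) S"

definition span_maps_comp :: "('o, 'm, 'c) two_cat \<Rightarrow>
    ('o, 'm, 'c) span_map \<Rightarrow> ('o, 'm, 'c) span_map \<Rightarrow> ('o, 'm, 'c) span_map" where
  "span_maps_comp K t s =
     SpanMap (mdom s) (und t \<odot>\<^bsub>K\<^esub> und s) (phi s \<bullet>\<^bsub>K\<^esub> (phi t \<triangleright>\<^bsub>K\<^esub> und s)) (mcod t)"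

definition left_displayed_spans ::
    "('o, 'm, 'c) two_cat \<Rightarrow> 'm set \<Rightarrow> 'o \<Rightarrow> 'o \<Rightarrow> ('o, 'm) span set" where
  "left_displayed_spans K D B C =
     {S. lleg S \<in> D \<and> lleg S \<in> hom1 K (apex S) B \<and> rleg S \<in> hom1 K (apex S) C}"

definition lax_span_maps ::
    "('o, 'm, 'c) two_cat \<Rightarrow> 'm set \<Rightarrow> 'o \<Rightarrow> 'o \<Rightarrow> ('o, 'm, 'c) span_map set" where
  "lax_span_maps K D B C =
     {s. mdom s \<in> left_displayed_spans K D B C \<and> mcod s \<in> left_displayed_spans K D B C \<and>
         und s \<in> hom1 K (apex (mdom s)) (apex (mcod s)) \<and>
         lleg (mcod s) \<odot>\<^bsub>K\<^esub> und s = lleg (mdom s) \<and>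
         phi s \<in> hom2 K (rleg (mcod s) \<odot>\<^bsub>K\<^esub> und s) (rleg (mdom s))}"

definition span_cells ::
    "('o, 'm, 'c) two_cat \<Rightarrow> 'm set \<Rightarrow> 'o \<Rightarrow> 'o \<Rightarrow> ('o, 'm, 'c) span_cell set" where
  "span_cells K D B C =
     {c. csrc c \<in> lax_span_maps K D B C \<and> ctgt c \<in> lax_span_maps K D B C \<and>
         mdom (csrc c) = mdom (ctgt c) \<and> mcod (csrc c) = mcod (ctgt c) \<and>
         cund c \<in> hom2 K (und (csrc c)) (und (ctgt c)) \<and>
         lleg (mcod (ctgt c)) \<triangleleft>\<^bsub>K\<^esub> cund c = id2 K (lleg (mdom (ctgt c))) \<and>
         phi (ctgt c) \<bullet>\<^bsub>K\<^esub> (rleg (mcod (ctgt c)) \<triangleleft>\<^bsub>K\<^esub> cund c) = phi (csrc c)}"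

text \<open>The 2-categories \<open>dSpan\<^sup>\<Rightarrow>(B, C)\<close> and \<open>dSpan(B, C)\<close>.\<close>

definition dSpan_lax :: "('o, 'm, 'c) two_cat \<Rightarrow> 'm set \<Rightarrow> 'o \<Rightarrow> 'o \<Rightarrow>
    (('o, 'm) span, ('o, 'm, 'c) span_map, ('o, 'm, 'c) span_cell) two_cat" where
  "dSpan_lax K D B C = \<lparr>
     Ob = left_displayed_spans K D B C,
     Ar = lax_span_maps K D B C,
     Ce = span_cells K D B C,
     Dom = mdom,
     Cod = mcod,
     Src = csrc,
     Tgt = ctgt,
     id1 = span_maps_id K,
     cmp1 = span_maps_comp K,
     id2 = (\<lambda>s. SpanCell s (id2 K (und s)) s),
     vcmp = (\<lambda>b a. SpanCell (csrc a) (cund b \<bullet>\<^bsub>K\<^esub> cund a) (ctgt b)),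
     hcmp = (\<lambda>b a. SpanCell (span_maps_comp K (csrc b) (csrc a)) (cund b \<star>\<^bsub>K\<^esub> cund a)
                            (span_maps_comp K (ctgt b) (ctgt a))) \<rparr>"

definition strict_span_maps ::
    "('o, 'm, 'c) two_cat \<Rightarrow> 'm set \<Rightarrow> 'o \<Rightarrow> 'o \<Rightarrow> ('o, 'm, 'c) span_map set" where
  "strict_span_maps K D B C = {s \<in> lax_span_maps K D B C. phi s = id2 K (rleg (mdom s))}"

definition dSpan :: "('o, 'm, 'c) two_cat \<Rightarrow> 'm set \<Rightarrow> 'o \<Rightarrow> 'o \<Rightarrow>
    (('o, 'm) span, ('o, 'm, 'c) span_map, ('o, 'm, 'c) span_cell) two_cat" where
  "dSpan K D B C = (dSpan_lax K D B C) \<lparr>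
     Ar := strict_span_maps K D B C,
     Ce := {c \<in> span_cells K D B C.
              csrc c \<in> strict_span_maps K D B C \<and> ctgt c \<in> strict_span_maps K D B C} \<rparr>"


subsection \<open>Composition of spans\<close>

text \<open>\<open>span_pb pb S R\<close> is the pair of projections of the pullback defining the composite \<open>S * R\<close>
  (diagrammatic order) to the apexes of \<open>S\<close> and of \<open>R\<close>.  All the 1-cells below have an identity as
  their 2-cell component.\<close>

definition span_pb :: "('m \<Rightarrow> 'm \<Rightarrow> 'm \<times> 'm) \<Rightarrow> ('o, 'm) span \<Rightarrow> ('o, 'm) span \<Rightarrow> 'm \<times> 'm" where
  "span_pb pb S R = pb (rleg S) (lleg R)"

definition span_comp :: "('o, 'm, 'c) two_cat \<Rightarrow> ('m \<Rightarrow> 'm \<Rightarrow> 'm \<times> 'm) \<Rightarrow>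
    ('o, 'm) span \<Rightarrow> ('o, 'm) span \<Rightarrow> ('o, 'm) span" where
  "span_comp K pb S R =
     (let (u, v) = span_pb pb S R
      in Span (lleg S \<odot>\<^bsub>K\<^esub> u) (Dom K u) (rleg R \<odot>\<^bsub>K\<^esub> v))"

definition span_comp1 :: "('o, 'm, 'c) two_cat \<Rightarrow> ('m \<Rightarrow> 'm \<Rightarrow> 'm \<times> 'm) \<Rightarrow>
    ('o, 'm, 'c) span_map \<Rightarrow> ('o, 'm, 'c) span_map \<Rightarrow> ('o, 'm, 'c) span_map" where
  "span_comp1 K pb s r =
     (let (u, v) = span_pb pb (mdom s) (mdom r); SR = span_comp K pb (mdom s) (mdom r)
      in SpanMap SR
           (tup1 K (span_pb pb (mcod s) (mcod r)) (und s \<odot>\<^bsub>K\<^esub> u) (und r \<odot>\<^bsub>K\<^esub> v))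
           (id2 K (rleg SR)) (span_comp K pb (mcod s) (mcod r)))"

definition span_comp2 :: "('o, 'm, 'c) two_cat \<Rightarrow> ('m \<Rightarrow> 'm \<Rightarrow> 'm \<times> 'm) \<Rightarrow>
    ('o, 'm, 'c) span_cell \<Rightarrow> ('o, 'm, 'c) span_cell \<Rightarrow> ('o, 'm, 'c) span_cell" where
  "span_comp2 K pb a b =
     (let (u, v) = span_pb pb (mdom (csrc a)) (mdom (csrc b))
      in SpanCell (span_comp1 K pb (csrc a) (csrc b))
           (tup2 K (span_pb pb (mcod (csrc a)) (mcod (csrc b)))
              (cund a \<triangleright>\<^bsub>K\<^esub> u) (cund b \<triangleright>\<^bsub>K\<^esub> v))
           (span_comp1 K pb (ctgt a) (ctgt b)))"

definition span_unit :: "('o, 'm, 'c) two_cat \<Rightarrow> 'o \<Rightarrow> ('o, 'm) span" where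
  "span_unit K C = Span (id1 K C) C (id1 K C)"

text \<open>The coherence isomorphisms \<open>S \<rightarrow> S * 1\<close>, \<open>S \<rightarrow> 1 * S\<close>, \<open>(S * R) * Q \<rightarrow> S * (R * Q)\<close> and the inverse
  of the last one.\<close>

definition right_unitor :: "('o, 'm, 'c) two_cat \<Rightarrow> ('m \<Rightarrow> 'm \<Rightarrow> 'm \<times> 'm) \<Rightarrow>
    ('o, 'm) span \<Rightarrow> ('o, 'm, 'c) span_map" where
  "right_unitor K pb S =
     (let I = span_unit K (Cod K (rleg S))
      in SpanMap S (tup1 K (span_pb pb S I) (id1 K (apex S)) (rleg S)) (id2 K (rleg S))
           (span_comp K pb S I))"

definition left_unitor :: "('o, 'm, 'c) two_cat \<Rightarrow> ('m \<Rightarrow> 'm \<Rightarrow> 'm \<times> 'm) \<Rightarrow>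
    ('o, 'm) span \<Rightarrow> ('o, 'm, 'c) span_map" where
  "left_unitor K pb S =
     (let I = span_unit K (Cod K (lleg S))
      in SpanMap S (tup1 K (span_pb pb I S) (lleg S) (id1 K (apex S))) (id2 K (rleg S))
           (span_comp K pb I S))"

definition associator :: "('o, 'm, 'c) two_cat \<Rightarrow> ('m \<Rightarrow> 'm \<Rightarrow> 'm \<times> 'm) \<Rightarrow>
    ('o, 'm) span \<Rightarrow> ('o, 'm) span \<Rightarrow> ('o, 'm) span \<Rightarrow> ('o, 'm, 'c) span_map" where
  "associator K pb S R Q =
     (let SR = span_comp K pb S R; RQ = span_comp K pb R Q;
          (u\<^sub>1, v\<^sub>1) = span_pb pb S R; (u\<^sub>2, v\<^sub>2) = span_pb pb SR Q
      in SpanMap (span_comp K pb SR Q)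
           (tup1 K (span_pb pb S RQ) (u\<^sub>1 \<odot>\<^bsub>K\<^esub> u\<^sub>2)
              (tup1 K (span_pb pb R Q) (v\<^sub>1 \<odot>\<^bsub>K\<^esub> u\<^sub>2) v\<^sub>2))
           (id2 K (rleg (span_comp K pb SR Q))) (span_comp K pb S RQ))"

definition associator_inv :: "('o, 'm, 'c) two_cat \<Rightarrow> ('m \<Rightarrow> 'm \<Rightarrow> 'm \<times> 'm) \<Rightarrow>
    ('o, 'm) span \<Rightarrow> ('o, 'm) span \<Rightarrow> ('o, 'm) span \<Rightarrow> ('o, 'm, 'c) span_map" where
  "associator_inv K pb S R Q =
     (let SR = span_comp K pb S R; RQ = span_comp K pb R Q;
          (u\<^sub>3, v\<^sub>3) = span_pb pb R Q; (u\<^sub>4, v\<^sub>4) = span_pb pb S RQ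
      in SpanMap (span_comp K pb S RQ)
           (tup1 K (span_pb pb SR Q)
              (tup1 K (span_pb pb S R) u\<^sub>4 (u\<^sub>3 \<odot>\<^bsub>K\<^esub> v\<^sub>4)) (v\<^sub>3 \<odot>\<^bsub>K\<^esub> v\<^sub>4))
           (id2 K (rleg (span_comp K pb S RQ))) (span_comp K pb SR Q))"


subsection \<open>The arrow monad\<close>

definition arrow_span :: "('o, 'm, 'c) two_cat \<Rightarrow> ('o \<Rightarrow> 'm \<times> 'm \<times> 'c) \<Rightarrow> 'o \<Rightarrow> ('o, 'm) span" where
  "arrow_span K ar C = (let (d\<^sub>0, d\<^sub>1, \<chi>) = ar C in Span d\<^sub>0 (Dom K d\<^sub>0) d\<^sub>1)"

definition arrow_unit :: "('o, 'm, 'c) two_cat \<Rightarrow> ('o \<Rightarrow> 'm \<times> 'm \<times> 'c) \<Rightarrow> 'o \<Rightarrow>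
    ('o, 'm, 'c) span_map" where
  "arrow_unit K ar C =
     SpanMap (span_unit K C) (arrow_name K (ar C) (id2 K (id1 K C)))
       (id2 K (id1 K C)) (arrow_span K ar C)"

definition arrow_mult :: "('o, 'm, 'c) two_cat \<Rightarrow> ('m \<Rightarrow> 'm \<Rightarrow> 'm \<times> 'm) \<Rightarrow>
    ('o \<Rightarrow> 'm \<times> 'm \<times> 'c) \<Rightarrow> 'o \<Rightarrow> ('o, 'm, 'c) span_map" where
  "arrow_mult K pb ar C =
     (let A = arrow_span K ar C; AA = span_comp K pb A A; (u, v) = span_pb pb A A;
          (d\<^sub>0, d\<^sub>1, \<chi>) = ar C
      in SpanMap AA (arrow_name K (ar C) ((\<chi> \<triangleright>\<^bsub>K\<^esub> v) \<bullet>\<^bsub>K\<^esub> (\<chi> \<triangleright>\<^bsub>K\<^esub> u)))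
           (id2 K (rleg AA)) A)"


section \<open>2-monads, Kleisli 2-categories and algebras\<close>

record ('o, 'm, 'c) two_monad =
  fob :: "'o \<Rightarrow> 'o"
  far :: "'m \<Rightarrow> 'm"
  fce :: "'c \<Rightarrow> 'c"
  unt :: "'o \<Rightarrow> 'm"
  mlt :: "'o \<Rightarrow> 'm"

text \<open>In the 2-categories built from another one below, a cell with underlying cell \<open>f\<close> is recorded
  together with its source and target objects.\<close>

datatype ('a, 'f) over = Over (odom: 'a) (ocell: 'f) (ocod: 'a)

definition Kl :: "('o, 'm, 'c) two_monad \<Rightarrow> ('o, 'm, 'c) two_cat \<Rightarrow>
    ('o, ('o, 'm) over, ('o, 'c) over) two_cat" where
  "Kl T X = \<lparr>
     Ob = Ob X,
     Ar = {Over a k b | a k b. a \<in> Ob X \<and> b \<in> Ob X \<and> k \<in> hom1 X a (fob T b)},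
     Ce = {Over a \<gamma> b | a \<gamma> b. a \<in> Ob X \<and> b \<in> Ob X \<and> \<gamma> \<in> cells X a (fob T b)},
     Dom = odom,
     Cod = ocod,
     Src = (\<lambda>c. Over (odom c) (Src X (ocell c)) (ocod c)),
     Tgt = (\<lambda>c. Over (odom c) (Tgt X (ocell c)) (ocod c)),
     id1 = (\<lambda>a. Over a (unt T a) a),
     cmp1 = (\<lambda>l k. Over (odom k)
               (mlt T (ocod l) \<odot>\<^bsub>X\<^esub> (far T (ocell l) \<odot>\<^bsub>X\<^esub> ocell k)) (ocod l)),
     id2 = (\<lambda>k. Over (odom k) (id2 X (ocell k)) (ocod k)),
     vcmp = (\<lambda>d c. Over (odom c) (ocell d \<bullet>\<^bsub>X\<^esub> ocell c) (ocod d)),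
     hcmp = (\<lambda>d c. Over (odom c)
               (mlt T (ocod d) \<triangleleft>\<^bsub>X\<^esub> (fce T (ocell d) \<star>\<^bsub>X\<^esub> ocell c)) (ocod d)) \<rparr>"

text \<open>The lift of \<open>S\<close> to \<open>Kl T X\<close> along a distributive law with components \<open>dist a : S T a \<rightarrow> T S a\<close>.\<close>

definition Kl_lift :: "('o, 'm, 'c) two_cat \<Rightarrow> ('o, 'm, 'c) two_monad \<Rightarrow> ('o, 'm, 'c) two_monad \<Rightarrow>
    ('o \<Rightarrow> 'm) \<Rightarrow> ('o, ('o, 'm) over, ('o, 'c) over) two_monad" where
  "Kl_lift X T S dist = \<lparr>
     fob = fob S,
     far = (\<lambda>k. Over (fob S (odom k)) (dist (ocod k) \<odot>\<^bsub>X\<^esub> far S (ocell k)) (fob S (ocod k))),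
     fce = (\<lambda>c. Over (fob S (odom c)) (dist (ocod c) \<triangleleft>\<^bsub>X\<^esub> fce S (ocell c)) (fob S (ocod c))),
     unt = (\<lambda>a. Over a (unt T (fob S a) \<odot>\<^bsub>X\<^esub> unt S a) (fob S a)),
     mlt = (\<lambda>a. Over (fob S (fob S a)) (unt T (fob S a) \<odot>\<^bsub>X\<^esub> mlt S a) (fob S a)) \<rparr>"

text \<open>Objects of \<open>X\<close> with extra structure (elements of \<open>O'\<close>), the 1-cells of \<open>X\<close> between them that
  satisfy \<open>M\<close>, and all 2-cells of \<open>X\<close> between those.\<close>

definition structured :: "('o, 'm, 'c) two_cat \<Rightarrow> ('o \<times> 's) set \<Rightarrow>
    ('o \<times> 's \<Rightarrow> 'm \<Rightarrow> 'o \<times> 's \<Rightarrow> bool) \<Rightarrow>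
    ('o \<times> 's, ('o \<times> 's, 'm) over, ('o \<times> 's, 'c) over) two_cat" where
  "structured X O' M = \<lparr>
     Ob = O',
     Ar = {Over a f b | a f b. a \<in> O' \<and> b \<in> O' \<and> f \<in> hom1 X (fst a) (fst b) \<and> M a f b},
     Ce = {Over a \<gamma> b | a \<gamma> b. a \<in> O' \<and> b \<in> O' \<and> \<gamma> \<in> cells X (fst a) (fst b) \<and>
             M a (Src X \<gamma>) b \<and> M a (Tgt X \<gamma>) b},
     Dom = odom,
     Cod = ocod,
     Src = (\<lambda>c. Over (odom c) (Src X (ocell c)) (ocod c)),
     Tgt = (\<lambda>c. Over (odom c) (Tgt X (ocell c)) (ocod c)),
     id1 = (\<lambda>a. Over a (id1 X (fst a)) a),
     cmp1 = (\<lambda>g f. Over (odom f) (ocell g \<odot>\<^bsub>X\<^esub> ocell f) (ocod g)),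
     id2 = (\<lambda>f. Over (odom f) (id2 X (ocell f)) (ocod f)),
     vcmp = (\<lambda>d c. Over (odom c) (ocell d \<bullet>\<^bsub>X\<^esub> ocell c) (ocod d)),
     hcmp = (\<lambda>d c. Over (odom c) (ocell d \<star>\<^bsub>X\<^esub> ocell c) (ocod d)) \<rparr>"

text \<open>The structure on an object \<open>a\<close> consists of the right adjoint \<open>\<alpha>\<close> of the unit together with the
  unit and the counit of the adjunction.\<close>

definition Alg :: "('o, 'm, 'c) two_monad \<Rightarrow> ('o, 'm, 'c) two_cat \<Rightarrow>
    ('o \<times> 'm \<times> 'c \<times> 'c, ('o \<times> 'm \<times> 'c \<times> 'c, 'm) over, ('o \<times> 'm \<times> 'c \<times> 'c, 'c) over) two_cat" where
  "Alg S X = structured X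
     {(a, \<alpha>, \<eta>, \<epsilon>). a \<in> Ob X \<and> \<alpha> \<in> hom1 X (fob S a) a \<and> adjunction X (unt S a) \<alpha> \<eta> \<epsilon> \<and> iso2 X \<eta>}
     (\<lambda>(a, \<alpha>, \<eta>, \<epsilon>) \<phi> (b, \<beta>, \<eta>', \<epsilon>'). iso2 X (mate X \<alpha> \<epsilon> \<beta> \<eta>' \<phi> (far S \<phi>)))"


subsection \<open>The monads on \<open>dSpan(B, C)\<close>\<close>

definition post_arrow :: "('o, 'm, 'c) two_cat \<Rightarrow> ('m \<Rightarrow> 'm \<Rightarrow> 'm \<times> 'm) \<Rightarrow> ('o \<Rightarrow> 'm \<times> 'm \<times> 'c) \<Rightarrow> 'o \<Rightarrow>
    (('o, 'm) span, ('o, 'm, 'c) span_map, ('o, 'm, 'c) span_cell) two_monad" where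
  "post_arrow K pb ar C =
     (let A = arrow_span K ar C; I = span_maps_id K A
      in \<lparr> fob = (\<lambda>S. span_comp K pb S A),
           far = (\<lambda>s. span_comp1 K pb s I),
           fce = (\<lambda>c. span_comp2 K pb c (SpanCell I (id2 K (und I)) I)),
           unt = (\<lambda>S. span_maps_comp K (span_comp1 K pb (span_maps_id K S) (arrow_unit K ar C))
                        (right_unitor K pb S)),
           mlt = (\<lambda>S. span_maps_comp K (span_comp1 K pb (span_maps_id K S) (arrow_mult K pb ar C))
                        (associator K pb S A A)) \<rparr>)"

definition pre_arrow :: "('o, 'm, 'c) two_cat \<Rightarrow> ('m \<Rightarrow> 'm \<Rightarrow> 'm \<times> 'm) \<Rightarrow> ('o \<Rightarrow> 'm \<times> 'm \<times> 'c) \<Rightarrow> 'o \<Rightarrow>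
    (('o, 'm) span, ('o, 'm, 'c) span_map, ('o, 'm, 'c) span_cell) two_monad" where
  "pre_arrow K pb ar B =
     (let A = arrow_span K ar B; I = span_maps_id K A
      in \<lparr> fob = (\<lambda>S. span_comp K pb A S),
           far = (\<lambda>s. span_comp1 K pb I s),
           fce = (\<lambda>c. span_comp2 K pb (SpanCell I (id2 K (und I)) I) c),
           unt = (\<lambda>S. span_maps_comp K (span_comp1 K pb (arrow_unit K ar B) (span_maps_id K S))
                        (left_unitor K pb S)),
           mlt = (\<lambda>S. span_maps_comp K (span_comp1 K pb (arrow_mult K pb ar B) (span_maps_id K S))
                        (associator_inv K pb A A S)) \<rparr>)"

text \<open>The lift of \<open>B\<^sup>\<down> * -\<close> to the Kleisli 2-category of \<open>- * C\<^sup>\<down>\<close>; the distributive law is the associativity isomorphism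
  \<open>B\<^sup>\<down> * (S * C\<^sup>\<down>) \<rightarrow> (B\<^sup>\<down> * S) * C\<^sup>\<down>\<close>.\<close>

definition pre_arrow_Kl :: "('o, 'm, 'c) two_cat \<Rightarrow> 'm set \<Rightarrow> ('m \<Rightarrow> 'm \<Rightarrow> 'm \<times> 'm) \<Rightarrow>
    ('o \<Rightarrow> 'm \<times> 'm \<times> 'c) \<Rightarrow> 'o \<Rightarrow> 'o \<Rightarrow>
    (('o, 'm) span, (('o, 'm) span, ('o, 'm, 'c) span_map) over,
     (('o, 'm) span, ('o, 'm, 'c) span_cell) over) two_monad" where
  "pre_arrow_Kl K D pb ar B C =
     Kl_lift (dSpan K D B C) (post_arrow K pb ar C) (pre_arrow K pb ar B)
       (\<lambda>S. associator_inv K pb (arrow_span K ar B) S (arrow_span K ar C))"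


section \<open>Fibrations\<close>

text \<open>The pair of projections from the comma object of \<open>p : E \<rightarrow> B\<close> to \<open>B\<^sup>\<down>\<close> and to \<open>E\<close>, the projection
  \<open>\<partial>\<^sub>0\<close> to \<open>B\<close>, the 1-cell from \<open>E\<close> induced by the identity 2-cell of \<open>p\<close>, and the action on a 1-cell
  from \<open>p\<^sub>1\<close> to \<open>p\<^sub>2\<close> over \<open>B\<close>.\<close>

definition comma_pb :: "('o, 'm, 'c) two_cat \<Rightarrow> ('m \<Rightarrow> 'm \<Rightarrow> 'm \<times> 'm) \<Rightarrow> ('o \<Rightarrow> 'm \<times> 'm \<times> 'c) \<Rightarrow>
    'm \<Rightarrow> 'm \<times> 'm" where
  "comma_pb K pb ar p = (let (d\<^sub>0, d\<^sub>1, \<chi>) = ar (Cod K p) in pb d\<^sub>1 p)"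

definition comma_d0 :: "('o, 'm, 'c) two_cat \<Rightarrow> ('m \<Rightarrow> 'm \<Rightarrow> 'm \<times> 'm) \<Rightarrow> ('o \<Rightarrow> 'm \<times> 'm \<times> 'c) \<Rightarrow>
    'm \<Rightarrow> 'm" where
  "comma_d0 K pb ar p = (let (d\<^sub>0, d\<^sub>1, \<chi>) = ar (Cod K p) in d\<^sub>0 \<odot>\<^bsub>K\<^esub> fst (comma_pb K pb ar p))"

definition id_name :: "('o, 'm, 'c) two_cat \<Rightarrow> ('m \<Rightarrow> 'm \<Rightarrow> 'm \<times> 'm) \<Rightarrow> ('o \<Rightarrow> 'm \<times> 'm \<times> 'c) \<Rightarrow>
    'm \<Rightarrow> 'm" where
  "id_name K pb ar p =
     tup1 K (comma_pb K pb ar p) (arrow_name K (ar (Cod K p)) (id2 K p)) (id1 K (Dom K p))"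

definition comma_map :: "('o, 'm, 'c) two_cat \<Rightarrow> ('m \<Rightarrow> 'm \<Rightarrow> 'm \<times> 'm) \<Rightarrow> ('o \<Rightarrow> 'm \<times> 'm \<times> 'c) \<Rightarrow>
    'm \<Rightarrow> 'm \<Rightarrow> 'm \<Rightarrow> 'm" where
  "comma_map K pb ar p\<^sub>1 p\<^sub>2 k =
     (let (u, v) = comma_pb K pb ar p\<^sub>1 in tup1 K (comma_pb K pb ar p\<^sub>2) u (k \<odot>\<^bsub>K\<^esub> v))"

definition fibration :: "('o, 'm, 'c) two_cat \<Rightarrow> 'm set \<Rightarrow> ('m \<Rightarrow> 'm \<Rightarrow> 'm \<times> 'm) \<Rightarrow>
    ('o \<Rightarrow> 'm \<times> 'm \<times> 'c) \<Rightarrow> 'm \<Rightarrow> 'm \<times> 'c \<times> 'c \<Rightarrow> bool" where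
  "fibration K D pb ar p = (\<lambda>(pull, \<eta>, \<epsilon>).
     p \<in> D \<and>
     adjunction K (id_name K pb ar p) pull \<eta> \<epsilon> \<and>
     p \<odot>\<^bsub>K\<^esub> pull = comma_d0 K pb ar p \<and>
     p \<triangleleft>\<^bsub>K\<^esub> \<eta> = id2 K p \<and>
     comma_d0 K pb ar p \<triangleleft>\<^bsub>K\<^esub> \<epsilon> = id2 K (comma_d0 K pb ar p))"

definition cartesian :: "('o, 'm, 'c) two_cat \<Rightarrow> ('m \<Rightarrow> 'm \<Rightarrow> 'm \<times> 'm) \<Rightarrow>
    ('o \<Rightarrow> 'm \<times> 'm \<times> 'c) \<Rightarrow> 'm \<Rightarrow> 'm \<times> 'c \<times> 'c \<Rightarrow> 'm \<Rightarrow> 'm \<times> 'c \<times> 'c \<Rightarrow> 'm \<Rightarrow> bool" where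
  "cartesian K pb ar p\<^sub>1 = (\<lambda>(pull\<^sub>1, \<eta>\<^sub>1, \<epsilon>\<^sub>1) p\<^sub>2 (pull\<^sub>2, \<eta>\<^sub>2, \<epsilon>\<^sub>2) k.
     k \<in> hom1 K (Dom K p\<^sub>1) (Dom K p\<^sub>2) \<and> p\<^sub>2 \<odot>\<^bsub>K\<^esub> k = p\<^sub>1 \<and>
     iso2 K (mate K pull\<^sub>1 \<epsilon>\<^sub>1 pull\<^sub>2 \<eta>\<^sub>2 k (comma_map K pb ar p\<^sub>1 p\<^sub>2 k)))"

text \<open>The 2-category \<open>fSpan\<^sup>\<Rightarrow>(B, C)\<close>.\<close>

definition fSpan_lax :: "('o, 'm, 'c) two_cat \<Rightarrow> 'm set \<Rightarrow> ('m \<Rightarrow> 'm \<Rightarrow> 'm \<times> 'm) \<Rightarrow>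
    ('o \<Rightarrow> 'm \<times> 'm \<times> 'c) \<Rightarrow> 'o \<Rightarrow> 'o \<Rightarrow>
    (('o, 'm) span \<times> 'm \<times> 'c \<times> 'c,
     (('o, 'm) span \<times> 'm \<times> 'c \<times> 'c, ('o, 'm, 'c) span_map) over,
     (('o, 'm) span \<times> 'm \<times> 'c \<times> 'c, ('o, 'm, 'c) span_cell) over) two_cat" where
  "fSpan_lax K D pb ar B C = structured (dSpan_lax K D B C)
     {(S, st). S \<in> left_displayed_spans K D B C \<and> fibration K D pb ar (lleg S) st}
     (\<lambda>(S, st) s (S', st'). cartesian K pb ar (lleg S) st (lleg S') st' (und s))"

end

theory Submission
  imports Defs
begin

text \<open>A lax map of spans \<open>(k, \<phi>) : E \<rightarrow> E'\<close> is the same thing as a strict map \<open>E \<rightarrow> E' * C\<^sup>\<down>\<close>: a 2-cell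
\<open>\<phi> : f' k \<Rightarrow> f\<close> is a 1-cell \<open>E \<rightarrow> C\<^sup>\<down>\<close> lying over \<open>f' k\<close> and \<open>f\<close>, and together with \<open>k\<close> it gives a 1-cell
into the pullback \<open>E' * C\<^sup>\<down>\<close> whose right leg is \<open>f\<close>.  The same happens one dimension up.  The multiplication
of the arrow monad composes arrows, so Kleisli composition is composition of lax maps, and
\<open>Kl(- * C\<^sup>\<down>)\<close> is isomorphic to \<open>dSpan\<^sup>\<Rightarrow>\<close> by an isomorphism that fixes the objects (\<open>kleisli_iso\<close>).
Since cells into \<open>E' * C\<^sup>\<down>\<close> are determined by their components (\<open>composite_eqI1\<close>, \<open>composite_eqI2\<close>), every coherence
isomorphism that occurs in the definition of the monads is dealt with by projecting it away.

It remains to read algebras through this isomorphism.  The unit of the lift of \<open>B\<^sup>\<down> * -\<close> at a span with left leg \<open>p\<close>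
corresponds to the 1-cell \<open>E \<rightarrow> B \<down> p\<close> named by the identity of \<open>p\<close>, with an identity 2-cell (\<open>M_unt\<close>), and
the lift sends \<open>(k, \<phi>)\<close> to \<open>B \<down> k\<close> (\<open>M_far\<close>).  A right adjoint of that unit in \<open>dSpan\<^sup>\<Rightarrow>\<close> consists of a 1-cell \<open>pull\<close>,
vertical cells \<open>\<eta>\<close> and \<open>\<epsilon>\<close>, and a 2-cell \<open>\<phi> : f pull \<Rightarrow> f \<partial>\<^sub>1\<close>.  The condition that
\<open>\<epsilon>\<close> is a 2-cell of spans says \<open>\<phi> = f \<partial>\<^sub>1 \<epsilon>\<close>, and with this value the condition on \<open>\<eta>\<close> is a consequence of a triangle
identity.  So the right adjoints are exactly the fibration structures on \<open>p\<close> (\<open>fibration_adjunction\<close>,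
\<open>adjunction_fibration\<close>).  An algebra also has an invertible unit; for a fibration this is automatic
(\<open>fibration_unit_iso\<close>), because the name of the identity is fully faithful on vertical 2-cells.
Finally a 2-cell of spans is invertible iff its underlying 2-cell is (\<open>span_iso2_iff\<close>), and the mate in the Kleisli
2-category lies over the mate of fibrations, so the algebra maps are the cartesian functors
(\<open>cartesian_iff_algebra_map\<close>).

Bijections that preserve the operations transport the axioms of a 2-category (\<open>two_category_iso\<close>), so neither the Kleisli
2-category nor the 2-category of algebras needs a separate verification.  For \<open>fSpan\<^sup>\<Rightarrow>\<close> the only point is that cartesian
functors compose, which is the pasting of mates (\<open>mate_paste\<close>).\<close>


section \<open>Calculus in a 2-category\<close>

context two_category
begin

lemma hom1_iff: "f \<in> hom1 X a b \<longleftrightarrow> f \<in> Ar X \<and> Dom X f = a \<and> Cod X f = b"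
  by (simp add: hom1_def)

lemma hom2_iff: "\<alpha> \<in> hom2 X f g \<longleftrightarrow> \<alpha> \<in> Ce X \<and> Src X \<alpha> = f \<and> Tgt X \<alpha> = g"
  by (simp add: hom2_def)

lemma cells_iff:
  "\<alpha> \<in> cells X a b \<longleftrightarrow> \<alpha> \<in> Ce X \<and> Dom X (Src X \<alpha>) = a \<and> Cod X (Src X \<alpha>) = b"
  by (auto simp: cells_def hom1_def Src_closed Tgt_closed Dom_Tgt Cod_Tgt)

text \<open>Typing is expressed by equations between domains and codomains instead of membership in hom-sets: in this form
the simplifier computes types, whereas the intermediate objects of the hom-set form would have to be guessed.\<close>

lemmas closed [simp] = Dom_closed Cod_closed Src_closed Tgt_closed Dom_Tgt Cod_Tgt

lemma id1_simps [simp]: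
  assumes "a \<in> Ob X"
  shows "id1 X a \<in> Ar X" "Dom X (id1 X a) = a" "Cod X (id1 X a) = a"
  using id1_closed[OF assms] by (auto simp: hom1_iff)

lemma cmp1_simps [simp]:
  assumes "f \<in> Ar X" "g \<in> Ar X" "Cod X f = Dom X g"
  shows "g \<odot> f \<in> Ar X" "Dom X (g \<odot> f) = Dom X f" "Cod X (g \<odot> f) = Cod X g"
  using cmp1_closed[of f "Dom X f" "Cod X f" g "Cod X g"] assms by (auto simp: hom1_iff)

lemma cmp1_id1 [simp]:
  "f \<in> Ar X \<Longrightarrow> Dom X f = a \<Longrightarrow> f \<odot> id1 X a = f"
  "f \<in> Ar X \<Longrightarrow> Cod X f = a \<Longrightarrow> id1 X a \<odot> f = f"
  by (auto intro: cmp1_id1_right cmp1_id1_left simp: hom1_iff)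

lemma cmp1_assoc' [simp]:
  "\<lbrakk>f \<in> Ar X; g \<in> Ar X; h \<in> Ar X; Cod X f = Dom X g; Cod X g = Dom X h\<rbrakk>
   \<Longrightarrow> (h \<odot> g) \<odot> f = h \<odot> (g \<odot> f)"
  by (rule cmp1_assoc) (auto simp: hom1_iff)

lemma id2_simps [simp]:
  assumes "f \<in> Ar X"
  shows "id2 X f \<in> Ce X" "Src X (id2 X f) = f" "Tgt X (id2 X f) = f"
  using id2_closed[OF assms] by (auto simp: hom2_iff)

lemma vcmp_simps [simp]:
  assumes "\<alpha> \<in> Ce X" "\<beta> \<in> Ce X" "Tgt X \<alpha> = Src X \<beta>"
  shows "\<beta> \<bullet> \<alpha> \<in> Ce X" "Src X (\<beta> \<bullet> \<alpha>) = Src X \<alpha>" "Tgt X (\<beta> \<bullet> \<alpha>) = Tgt X \<beta>"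
  using vcmp_closed[of \<alpha> "Src X \<alpha>" "Tgt X \<alpha>" \<beta> "Tgt X \<beta>"] assms by (auto simp: hom2_iff)

lemma vcmp_id2 [simp]:
  "\<alpha> \<in> Ce X \<Longrightarrow> Src X \<alpha> = f \<Longrightarrow> \<alpha> \<bullet> id2 X f = \<alpha>"
  "\<alpha> \<in> Ce X \<Longrightarrow> Tgt X \<alpha> = f \<Longrightarrow> id2 X f \<bullet> \<alpha> = \<alpha>"
  by (auto intro: vcmp_id2_right vcmp_id2_left simp: hom2_iff)

lemma vcmp_assoc' [simp]:
  "\<lbrakk>\<alpha> \<in> Ce X; \<beta> \<in> Ce X; \<gamma> \<in> Ce X; Tgt X \<alpha> = Src X \<beta>; Tgt X \<beta> = Src X \<gamma>\<rbrakk>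
   \<Longrightarrow> (\<gamma> \<bullet> \<beta>) \<bullet> \<alpha> = \<gamma> \<bullet> (\<beta> \<bullet> \<alpha>)"
  by (rule vcmp_assoc) (auto simp: hom2_iff)

lemma hcmp_simps [simp]:
  assumes "\<alpha> \<in> Ce X" "\<beta> \<in> Ce X" "Cod X (Src X \<alpha>) = Dom X (Src X \<beta>)"
  shows "\<beta> \<star> \<alpha> \<in> Ce X" "Src X (\<beta> \<star> \<alpha>) = Src X \<beta> \<odot> Src X \<alpha>"
    "Tgt X (\<beta> \<star> \<alpha>) = Tgt X \<beta> \<odot> Tgt X \<alpha>"
  using hcmp_closed[of \<alpha> "Dom X (Src X \<alpha>)" "Cod X (Src X \<alpha>)" \<beta> "Cod X (Src X \<beta>)"] assms
  by (auto simp: hom2_iff cells_iff)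

lemma hcmp_assoc':
  "\<lbrakk>\<alpha> \<in> Ce X; \<beta> \<in> Ce X; \<gamma> \<in> Ce X; Cod X (Src X \<alpha>) = Dom X (Src X \<beta>);
    Cod X (Src X \<beta>) = Dom X (Src X \<gamma>)\<rbrakk> \<Longrightarrow> (\<gamma> \<star> \<beta>) \<star> \<alpha> = \<gamma> \<star> (\<beta> \<star> \<alpha>)"
  by (rule hcmp_assoc) (auto simp: cells_iff)

lemma interchange':
  "\<lbrakk>\<alpha> \<in> Ce X; \<alpha>' \<in> Ce X; Tgt X \<alpha> = Src X \<alpha>'; \<beta> \<in> Ce X; \<beta>' \<in> Ce X; Tgt X \<beta> = Src X \<beta>';
    Cod X (Src X \<alpha>) = Dom X (Src X \<beta>)\<rbrakk>
   \<Longrightarrow> (\<beta>' \<bullet> \<beta>) \<star> (\<alpha>' \<bullet> \<alpha>) = (\<beta>' \<star> \<alpha>') \<bullet> (\<beta> \<star> \<alpha>)"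
  using interchange[of \<alpha> "Dom X (Src X \<alpha>)" "Cod X (Src X \<alpha>)" \<alpha>' \<beta> "Cod X (Src X \<beta>)" \<beta>']
  by (metis Cod_Tgt Dom_Tgt cells_iff)

lemma hcmp_id2' [simp]:
  "\<lbrakk>f \<in> Ar X; g \<in> Ar X; Cod X f = Dom X g\<rbrakk> \<Longrightarrow> id2 X g \<star> id2 X f = id2 X (g \<odot> f)"
  by (rule hcmp_id2) (auto simp: hom1_iff)

lemma lwhisker_simps [simp]:
  assumes "\<alpha> \<in> Ce X" "f \<in> Ar X" "Cod X (Src X \<alpha>) = Dom X f"
  shows "f \<triangleleft> \<alpha> \<in> Ce X" "Src X (f \<triangleleft> \<alpha>) = f \<odot> Src X \<alpha>" "Tgt X (f \<triangleleft> \<alpha>) = f \<odot> Tgt X \<alpha>"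
  using assms by (auto simp: lwhisker_def)

lemma rwhisker_simps [simp]:
  assumes "\<alpha> \<in> Ce X" "f \<in> Ar X" "Cod X f = Dom X (Src X \<alpha>)"
  shows "\<alpha> \<triangleright> f \<in> Ce X" "Src X (\<alpha> \<triangleright> f) = Src X \<alpha> \<odot> f" "Tgt X (\<alpha> \<triangleright> f) = Tgt X \<alpha> \<odot> f"
  using assms by (auto simp: rwhisker_def)

lemma whisker_id2 [simp]:
  assumes "f \<in> Ar X" "g \<in> Ar X" "Cod X f = Dom X g"
  shows "g \<triangleleft> id2 X f = id2 X (g \<odot> f)" "id2 X g \<triangleright> f = id2 X (g \<odot> f)"
  using assms by (auto simp: lwhisker_def rwhisker_def)

lemma whisker_id1 [simp]:
  "\<alpha> \<in> Ce X \<Longrightarrow> Cod X (Src X \<alpha>) = a \<Longrightarrow> id1 X a \<triangleleft> \<alpha> = \<alpha>"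
  "\<alpha> \<in> Ce X \<Longrightarrow> Dom X (Src X \<alpha>) = a \<Longrightarrow> \<alpha> \<triangleright> id1 X a = \<alpha>"
  by (auto simp: lwhisker_def rwhisker_def cells_iff intro: hcmp_id_left hcmp_id_right)

lemma lwhisker_vcmp:
  "\<lbrakk>\<alpha> \<in> Ce X; \<beta> \<in> Ce X; Tgt X \<alpha> = Src X \<beta>; f \<in> Ar X; Cod X (Src X \<alpha>) = Dom X f\<rbrakk>
   \<Longrightarrow> f \<triangleleft> (\<beta> \<bullet> \<alpha>) = (f \<triangleleft> \<beta>) \<bullet> (f \<triangleleft> \<alpha>)"
  using interchange'[of \<alpha> \<beta> "id2 X f" "id2 X f"] by (simp add: lwhisker_def)

lemma rwhisker_vcmp:
  "\<lbrakk>\<alpha> \<in> Ce X; \<beta> \<in> Ce X; Tgt X \<alpha> = Src X \<beta>; f \<in> Ar X; Cod X f = Dom X (Src X \<alpha>)\<rbrakk>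
   \<Longrightarrow> (\<beta> \<bullet> \<alpha>) \<triangleright> f = (\<beta> \<triangleright> f) \<bullet> (\<alpha> \<triangleright> f)"
  using interchange'[of "id2 X f" "id2 X f" \<alpha> \<beta>] by (simp add: rwhisker_def)

lemma lwhisker_lwhisker:
  "\<lbrakk>\<alpha> \<in> Ce X; f \<in> Ar X; g \<in> Ar X; Cod X (Src X \<alpha>) = Dom X f; Cod X f = Dom X g\<rbrakk>
   \<Longrightarrow> g \<triangleleft> (f \<triangleleft> \<alpha>) = (g \<odot> f) \<triangleleft> \<alpha>"
  using hcmp_assoc'[of \<alpha> "id2 X f" "id2 X g"] by (simp add: lwhisker_def)

lemma rwhisker_rwhisker:
  "\<lbrakk>\<alpha> \<in> Ce X; f \<in> Ar X; g \<in> Ar X; Cod X f = Dom X (Src X \<alpha>); Cod X g = Dom X f\<rbrakk>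
   \<Longrightarrow> (\<alpha> \<triangleright> f) \<triangleright> g = \<alpha> \<triangleright> (f \<odot> g)"
  using hcmp_assoc'[of "id2 X g" "id2 X f" \<alpha>] by (simp add: rwhisker_def)

lemma whisker_whisker:
  "\<lbrakk>\<alpha> \<in> Ce X; f \<in> Ar X; g \<in> Ar X; Cod X f = Dom X (Src X \<alpha>); Cod X (Src X \<alpha>) = Dom X g\<rbrakk>
   \<Longrightarrow> (g \<triangleleft> \<alpha>) \<triangleright> f = g \<triangleleft> (\<alpha> \<triangleright> f)"
  using hcmp_assoc'[of "id2 X f" \<alpha> "id2 X g"] by (simp add: lwhisker_def rwhisker_def)

text \<open>These rewrite a pasting diagram to its normal form, a vertical composite of cells \<open>g \<triangleleft> (\<alpha> \<triangleright> f)\<close>.\<close>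

lemmas collect_whiskers = lwhisker_vcmp rwhisker_vcmp lwhisker_lwhisker rwhisker_rwhisker
  whisker_whisker

lemma hcmp_whisker:
  assumes "\<alpha> \<in> Ce X" "\<beta> \<in> Ce X" "Cod X (Src X \<alpha>) = Dom X (Src X \<beta>)"
  shows "\<beta> \<star> \<alpha> = (\<beta> \<triangleright> Tgt X \<alpha>) \<bullet> (Src X \<beta> \<triangleleft> \<alpha>)"
    "\<beta> \<star> \<alpha> = (Tgt X \<beta> \<triangleleft> \<alpha>) \<bullet> (\<beta> \<triangleright> Src X \<alpha>)"
  using assms interchange'[of \<alpha> "id2 X (Tgt X \<alpha>)" "id2 X (Src X \<beta>)" \<beta>]
    interchange'[of "id2 X (Src X \<alpha>)" \<alpha> \<beta> "id2 X (Tgt X \<beta>)"]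
  by (auto simp: lwhisker_def rwhisker_def)

lemma lwhisker_hcmp:
  "\<lbrakk>\<alpha> \<in> Ce X; \<beta> \<in> Ce X; g \<in> Ar X; Cod X (Src X \<alpha>) = Dom X (Src X \<beta>); Cod X (Src X \<beta>) = Dom X g\<rbrakk>
   \<Longrightarrow> g \<triangleleft> (\<beta> \<star> \<alpha>) = (g \<triangleleft> \<beta>) \<star> \<alpha>"
  by (simp add: lwhisker_def hcmp_assoc')

lemma rwhisker_hcmp:
  "\<lbrakk>\<alpha> \<in> Ce X; \<beta> \<in> Ce X; f \<in> Ar X; Cod X (Src X \<alpha>) = Dom X f; Cod X f = Dom X (Src X \<beta>)\<rbrakk>
   \<Longrightarrow> (\<beta> \<triangleright> f) \<star> \<alpha> = \<beta> \<star> (f \<triangleleft> \<alpha>)"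
  by (simp add: lwhisker_def rwhisker_def hcmp_assoc')

text \<open>The two sides are the two ways to decompose \<open>\<beta> \<star> \<alpha>\<close>.\<close>

lemma slide:
  assumes "\<alpha> \<in> Ce X" "\<beta> \<in> Ce X" "Cod X (Src X \<alpha>) = Dom X (Src X \<beta>)"
  shows "(\<beta> \<triangleright> Tgt X \<alpha>) \<bullet> (Src X \<beta> \<triangleleft> \<alpha>) = (Tgt X \<beta> \<triangleleft> \<alpha>) \<bullet> (\<beta> \<triangleright> Src X \<alpha>)"
  using hcmp_whisker assms by metis

text \<open>Composites are kept bracketed to the right, which hides \<open>g \<odot> f\<close> inside \<open>g \<odot> (f \<odot> x)\<close>; these rules make
an equation about \<open>g \<odot> f\<close> applicable there.\<close>

lemma cmp1_fuse:
  "\<lbrakk>g \<odot> f = h; f \<in> Ar X; g \<in> Ar X; x \<in> Ar X; Cod X f = Dom X g; Cod X x = Dom X f\<rbrakk>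
   \<Longrightarrow> g \<odot> (f \<odot> x) = h \<odot> x"
  using cmp1_assoc'[of x f g] by metis

lemma vcmp_fuse:
  "\<lbrakk>\<gamma> \<bullet> \<beta> = \<delta>; \<alpha> \<in> Ce X; \<beta> \<in> Ce X; \<gamma> \<in> Ce X; Tgt X \<alpha> = Src X \<beta>; Tgt X \<beta> = Src X \<gamma>\<rbrakk>
   \<Longrightarrow> \<gamma> \<bullet> (\<beta> \<bullet> \<alpha>) = \<delta> \<bullet> \<alpha>"
  using vcmp_assoc'[of \<alpha> \<beta> \<gamma>] by metis

lemma vcmp_swap:
  "\<lbrakk>\<gamma> \<bullet> \<beta> = \<delta> \<bullet> \<beta>'; \<alpha> \<in> Ce X; \<beta> \<in> Ce X; \<gamma> \<in> Ce X; \<delta> \<in> Ce X; \<beta>' \<in> Ce X; Tgt X \<alpha> = Src X \<beta>;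
    Tgt X \<beta> = Src X \<gamma>; Src X \<beta>' = Src X \<beta>; Tgt X \<beta>' = Src X \<delta>\<rbrakk>
   \<Longrightarrow> \<gamma> \<bullet> (\<beta> \<bullet> \<alpha>) = \<delta> \<bullet> (\<beta>' \<bullet> \<alpha>)"
  using vcmp_assoc'[of \<alpha> \<beta> \<gamma>] vcmp_assoc'[of \<alpha> \<beta>' \<delta>] by metis

lemma iso2I:
  assumes "\<alpha> \<in> Ce X" "\<beta> \<in> Ce X" "Src X \<beta> = Tgt X \<alpha>" "Tgt X \<beta> = Src X \<alpha>"
    "\<beta> \<bullet> \<alpha> = id2 X (Src X \<alpha>)" "\<alpha> \<bullet> \<beta> = id2 X (Tgt X \<alpha>)"
  shows "iso2 X \<alpha>"
  using assms unfolding iso2_def by (auto simp: hom2_iff)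

lemma iso2E:
  assumes "iso2 X \<alpha>"
  obtains \<beta> where "\<alpha> \<in> Ce X" "\<beta> \<in> Ce X" "Src X \<beta> = Tgt X \<alpha>" "Tgt X \<beta> = Src X \<alpha>"
    "\<beta> \<bullet> \<alpha> = id2 X (Src X \<alpha>)" "\<alpha> \<bullet> \<beta> = id2 X (Tgt X \<alpha>)"
  using assms unfolding iso2_def by (auto simp: hom2_iff)

lemma iso2_id2: "f \<in> Ar X \<Longrightarrow> iso2 X (id2 X f)"
  by (rule iso2I[of _ "id2 X f"]) auto

lemma iso2_vcmp:
  assumes "iso2 X \<alpha>" "iso2 X \<beta>" "Tgt X \<alpha> = Src X \<beta>"
  shows "iso2 X (\<beta> \<bullet> \<alpha>)"
proof -
  obtain \<alpha>' where a: "\<alpha> \<in> Ce X" "\<alpha>' \<in> Ce X" "Src X \<alpha>' = Tgt X \<alpha>" "Tgt X \<alpha>' = Src X \<alpha>"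
    "\<alpha>' \<bullet> \<alpha> = id2 X (Src X \<alpha>)" "\<alpha> \<bullet> \<alpha>' = id2 X (Tgt X \<alpha>)" by (rule iso2E[OF assms(1)])
  obtain \<beta>' where b: "\<beta> \<in> Ce X" "\<beta>' \<in> Ce X" "Src X \<beta>' = Tgt X \<beta>" "Tgt X \<beta>' = Src X \<beta>"
    "\<beta>' \<bullet> \<beta> = id2 X (Src X \<beta>)" "\<beta> \<bullet> \<beta>' = id2 X (Tgt X \<beta>)" by (rule iso2E[OF assms(2)])
  show ?thesis
    by (rule iso2I[of _ "\<alpha>' \<bullet> \<beta>'"])
      (use a b assms(3) vcmp_fuse[OF a(6), of \<beta>'] vcmp_fuse[OF b(5), of \<alpha>] in auto)
qed

lemma iso2_lwhisker:
  assumes "iso2 X \<alpha>" "f \<in> Ar X" "Cod X (Src X \<alpha>) = Dom X f"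
  shows "iso2 X (f \<triangleleft> \<alpha>)"
proof -
  obtain \<alpha>' where a: "\<alpha> \<in> Ce X" "\<alpha>' \<in> Ce X" "Src X \<alpha>' = Tgt X \<alpha>" "Tgt X \<alpha>' = Src X \<alpha>"
    "\<alpha>' \<bullet> \<alpha> = id2 X (Src X \<alpha>)" "\<alpha> \<bullet> \<alpha>' = id2 X (Tgt X \<alpha>)" by (rule iso2E[OF assms(1)])
  show ?thesis
    by (rule iso2I[of _ "f \<triangleleft> \<alpha>'"]) (use a assms(2,3) in \<open>auto simp: lwhisker_vcmp[symmetric]\<close>)
qed

lemma iso2_rwhisker:
  assumes "iso2 X \<alpha>" "f \<in> Ar X" "Cod X f = Dom X (Src X \<alpha>)"
  shows "iso2 X (\<alpha> \<triangleright> f)"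
proof -
  obtain \<alpha>' where a: "\<alpha> \<in> Ce X" "\<alpha>' \<in> Ce X" "Src X \<alpha>' = Tgt X \<alpha>" "Tgt X \<alpha>' = Src X \<alpha>"
    "\<alpha>' \<bullet> \<alpha> = id2 X (Src X \<alpha>)" "\<alpha> \<bullet> \<alpha>' = id2 X (Tgt X \<alpha>)" by (rule iso2E[OF assms(1)])
  show ?thesis
    by (rule iso2I[of _ "\<alpha>' \<triangleright> f"]) (use a assms(2,3) in \<open>auto simp: rwhisker_vcmp[symmetric]\<close>)
qed

lemma adjunction_iff:
  assumes "l \<in> Ar X"
  shows "adjunction X l r \<eta> \<epsilon> \<longleftrightarrow> r \<in> Ar X \<and> Dom X r = Cod X l \<and> Cod X r = Dom X l \<and>
    \<eta> \<in> Ce X \<and> Src X \<eta> = id1 X (Dom X l) \<and> Tgt X \<eta> = r \<odot> l \<and>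
    \<epsilon> \<in> Ce X \<and> Src X \<epsilon> = l \<odot> r \<and> Tgt X \<epsilon> = id1 X (Cod X l) \<and>
    (\<epsilon> \<triangleright> l) \<bullet> (l \<triangleleft> \<eta>) = id2 X l \<and> (r \<triangleleft> \<epsilon>) \<bullet> (\<eta> \<triangleright> r) = id2 X r"
  using assms by (auto simp: adjunction_def hom1_iff hom2_iff)

lemma mate_identity:
  assumes "l \<in> Ar X" "adjunction X l r \<eta> \<epsilon>"
  shows "mate X r \<epsilon> r \<eta> (id1 X (Dom X l)) (id1 X (Cod X l)) = id2 X r"
  using assms by (auto simp: mate_def adjunction_iff)

lemma mate_cell:
  assumes l: "l\<^sub>1 \<in> Ar X" "l\<^sub>2 \<in> Ar X"
    and adj: "adjunction X l\<^sub>1 r\<^sub>1 \<eta>\<^sub>1 \<epsilon>\<^sub>1" "adjunction X l\<^sub>2 r\<^sub>2 \<eta>\<^sub>2 \<epsilon>\<^sub>2"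
    and u: "u \<in> Ar X" "Dom X u = Dom X l\<^sub>1" "Cod X u = Dom X l\<^sub>2"
    and v: "v \<in> Ar X" "Dom X v = Cod X l\<^sub>1" "Cod X v = Cod X l\<^sub>2"
    and sq: "l\<^sub>2 \<odot> u = v \<odot> l\<^sub>1"
  shows "mate X r\<^sub>1 \<epsilon>\<^sub>1 r\<^sub>2 \<eta>\<^sub>2 u v \<in> Ce X" "Src X (mate X r\<^sub>1 \<epsilon>\<^sub>1 r\<^sub>2 \<eta>\<^sub>2 u v) = u \<odot> r\<^sub>1"
    "Tgt X (mate X r\<^sub>1 \<epsilon>\<^sub>1 r\<^sub>2 \<eta>\<^sub>2 u v) = r\<^sub>2 \<odot> v"
  using assms cmp1_fuse[OF sq, of r\<^sub>1] by (auto simp: mate_def adjunction_iff)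

text \<open>Interchange brings the counit of the first and the unit of the last adjunction to the outside; in the middle the unit
and the counit of the second adjunction meet and cancel by a triangle identity.\<close>

lemma mate_paste:
  assumes l: "l\<^sub>1 \<in> Ar X" "l\<^sub>2 \<in> Ar X" "l\<^sub>3 \<in> Ar X"
    and adj: "adjunction X l\<^sub>1 r\<^sub>1 \<eta>\<^sub>1 \<epsilon>\<^sub>1" "adjunction X l\<^sub>2 r\<^sub>2 \<eta>\<^sub>2 \<epsilon>\<^sub>2" "adjunction X l\<^sub>3 r\<^sub>3 \<eta>\<^sub>3 \<epsilon>\<^sub>3"
    and u: "u \<in> Ar X" "Dom X u = Dom X l\<^sub>1" "Cod X u = Dom X l\<^sub>2"
    and v: "v \<in> Ar X" "Dom X v = Cod X l\<^sub>1" "Cod X v = Cod X l\<^sub>2"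
    and u': "u' \<in> Ar X" "Dom X u' = Dom X l\<^sub>2" "Cod X u' = Dom X l\<^sub>3"
    and v': "v' \<in> Ar X" "Dom X v' = Cod X l\<^sub>2" "Cod X v' = Cod X l\<^sub>3"
    and sq: "l\<^sub>2 \<odot> u = v \<odot> l\<^sub>1" "l\<^sub>3 \<odot> u' = v' \<odot> l\<^sub>2"
  shows "mate X r\<^sub>1 \<epsilon>\<^sub>1 r\<^sub>3 \<eta>\<^sub>3 (u' \<odot> u) (v' \<odot> v) =
    (mate X r\<^sub>2 \<epsilon>\<^sub>2 r\<^sub>3 \<eta>\<^sub>3 u' v' \<triangleright> v) \<bullet> (u' \<triangleleft> mate X r\<^sub>1 \<epsilon>\<^sub>1 r\<^sub>2 \<eta>\<^sub>2 u v)"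
proof -
  note A1 = adj(1)[unfolded adjunction_iff[OF l(1)]]
  note A2 = adj(2)[unfolded adjunction_iff[OF l(2)]]
  note A3 = adj(3)[unfolded adjunction_iff[OF l(3)]]
  have A2': "r\<^sub>2 \<in> Ar X" "Dom X r\<^sub>2 = Cod X l\<^sub>2" "Cod X r\<^sub>2 = Dom X l\<^sub>2" "\<eta>\<^sub>2 \<in> Ce X"
    "Src X \<eta>\<^sub>2 = id1 X (Dom X l\<^sub>2)" "Tgt X \<eta>\<^sub>2 = r\<^sub>2 \<odot> l\<^sub>2" "\<epsilon>\<^sub>2 \<in> Ce X"
    "Src X \<epsilon>\<^sub>2 = l\<^sub>2 \<odot> r\<^sub>2" "Tgt X \<epsilon>\<^sub>2 = id1 X (Cod X l\<^sub>2)"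
    using A2 by auto
  note T = l A1 A2' A3 u v u' v'
  have s1: "\<And>x. x \<in> Ar X \<Longrightarrow> Cod X x = Dom X u \<Longrightarrow> l\<^sub>2 \<odot> (u \<odot> x) = v \<odot> (l\<^sub>1 \<odot> x)"
    using sq T cmp1_fuse[OF sq(1)] by simp
  have s2: "\<And>x. x \<in> Ar X \<Longrightarrow> Cod X x = Dom X u' \<Longrightarrow> l\<^sub>3 \<odot> (u' \<odot> x) = v' \<odot> (l\<^sub>2 \<odot> x)"
    using sq T cmp1_fuse[OF sq(2)] by simp
  define a where "a = (r\<^sub>3 \<odot> (v' \<odot> v)) \<triangleleft> \<epsilon>\<^sub>1"
  define b where "b = (r\<^sub>3 \<odot> v') \<triangleleft> (\<epsilon>\<^sub>2 \<triangleright> v)"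
  define c where "c = \<eta>\<^sub>3 \<triangleright> (u' \<odot> (r\<^sub>2 \<odot> v))"
  define d where "d = (u' \<odot> (r\<^sub>2 \<odot> v)) \<triangleleft> \<epsilon>\<^sub>1"
  define e where "e = u' \<triangleleft> (\<eta>\<^sub>2 \<triangleright> (u \<odot> r\<^sub>1))"
  define f where "f = \<eta>\<^sub>3 \<triangleright> (u' \<odot> (u \<odot> r\<^sub>1))"
  define d' where "d' = (r\<^sub>3 \<odot> (v' \<odot> (l\<^sub>2 \<odot> (r\<^sub>2 \<odot> v)))) \<triangleleft> \<epsilon>\<^sub>1"
  define c' where "c' = \<eta>\<^sub>3 \<triangleright> (u' \<odot> (r\<^sub>2 \<odot> (v \<odot> (l\<^sub>1 \<odot> r\<^sub>1))))"
  define b' where "b' = (r\<^sub>3 \<odot> v') \<triangleleft> (\<epsilon>\<^sub>2 \<triangleright> (v \<odot> (l\<^sub>1 \<odot> r\<^sub>1)))"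
  define e' where "e' = (r\<^sub>3 \<odot> (v' \<odot> l\<^sub>2)) \<triangleleft> (\<eta>\<^sub>2 \<triangleright> (u \<odot> r\<^sub>1))"
  note defs = a_def b_def c_def d_def e_def f_def d'_def c'_def b'_def e'_def
  \<comment> \<open>the three instances of interchange; primed cells are the ones that have slid past another\<close>
  have x1: "c \<bullet> d = d' \<bullet> c'"
    using slide[of "(u' \<odot> (r\<^sub>2 \<odot> v)) \<triangleleft> \<epsilon>\<^sub>1" \<eta>\<^sub>3] T s1 s2 sq
    by (simp add: defs collect_whiskers)
  have x2: "b \<bullet> d' = a \<bullet> b'"
    using slide[of "v \<triangleleft> \<epsilon>\<^sub>1" "(r\<^sub>3 \<odot> v') \<triangleleft> \<epsilon>\<^sub>2"] T s1 s2 sq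
    by (simp add: defs collect_whiskers)
  have x3: "c' \<bullet> e = e' \<bullet> f"
    using slide[of "u' \<triangleleft> (\<eta>\<^sub>2 \<triangleright> (u \<odot> r\<^sub>1))" "\<eta>\<^sub>3"] T s1 s2 sq
    by (simp add: defs collect_whiskers)
  \<comment> \<open>the triangle identity of the second adjunction, whiskered into place\<close>
  have "(r\<^sub>3 \<odot> v') \<triangleleft> (((\<epsilon>\<^sub>2 \<triangleright> l\<^sub>2) \<bullet> (l\<^sub>2 \<triangleleft> \<eta>\<^sub>2)) \<triangleright> (u \<odot> r\<^sub>1))
      = (r\<^sub>3 \<odot> v') \<triangleleft> (id2 X l\<^sub>2 \<triangleright> (u \<odot> r\<^sub>1))"
    using A2 by simp
  then have x4: "b' \<bullet> e' = id2 X (r\<^sub>3 \<odot> (v' \<odot> (v \<odot> (l\<^sub>1 \<odot> r\<^sub>1))))"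
    using T s1 s2 sq by (simp add: defs collect_whiskers)
  have "(mate X r\<^sub>2 \<epsilon>\<^sub>2 r\<^sub>3 \<eta>\<^sub>3 u' v' \<triangleright> v) \<bullet> (u' \<triangleleft> mate X r\<^sub>1 \<epsilon>\<^sub>1 r\<^sub>2 \<eta>\<^sub>2 u v)
     = b \<bullet> (c \<bullet> (d \<bullet> e))"
    using T s1 s2 sq by (simp add: mate_def defs collect_whiskers)
  also have "c \<bullet> (d \<bullet> e) = d' \<bullet> (c' \<bullet> e)"
    by (rule vcmp_swap[OF x1]) (use T s1 s2 sq in \<open>simp_all add: defs\<close>)
  also have "b \<bullet> (d' \<bullet> (c' \<bullet> e)) = a \<bullet> (b' \<bullet> (c' \<bullet> e))"
    by (rule vcmp_swap[OF x2]) (use T s1 s2 sq in \<open>simp_all add: defs\<close>)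
  also have "c' \<bullet> e = e' \<bullet> f" by (rule x3)
  also have "b' \<bullet> (e' \<bullet> f) = id2 X (r\<^sub>3 \<odot> (v' \<odot> (v \<odot> (l\<^sub>1 \<odot> r\<^sub>1)))) \<bullet> f"
    by (rule vcmp_fuse[OF x4]) (use T s1 s2 sq in \<open>simp_all add: defs\<close>)
  also have "\<dots> = f"
    by (rule vcmp_id2) (use T s1 s2 sq in \<open>simp_all add: defs\<close>)
  also have "a \<bullet> f = mate X r\<^sub>1 \<epsilon>\<^sub>1 r\<^sub>3 \<eta>\<^sub>3 (u' \<odot> u) (v' \<odot> v)"
    using T s1 s2 sq by (simp add: mate_def defs collect_whiskers)
  finally show ?thesis by simp
qed

end


section \<open>Universal properties\<close>

context two_category
begin

lemma pullbackD:
  assumes "is_pullback X f d u v"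
  shows "f \<in> Ar X" "d \<in> Ar X" "Cod X d = Cod X f" "u \<in> Ar X" "Cod X u = Dom X f"
    "v \<in> Ar X" "Dom X v = Dom X u" "Cod X v = Dom X d" "f \<odot> u = d \<odot> v"
  using assms unfolding is_pullback_def by (auto simp: hom1_iff)

lemma pullback_tup1_ex1:
  assumes pb: "is_pullback X f d u v"
    and "x \<in> Ar X" "y \<in> Ar X" "Dom X y = Dom X x" "Cod X x = Dom X f" "Cod X y = Dom X d"
    "f \<odot> x = d \<odot> y"
  shows "\<exists>!h. h \<in> hom1 X (Dom X x) (Dom X u) \<and> u \<odot> h = x \<and> v \<odot> h = y"
proof -
  have "bij_betw (\<lambda>h. (u \<odot> h, v \<odot> h)) (hom1 X (Dom X x) (Dom X u))
          {(x', y). x' \<in> hom1 X (Dom X x) (Dom X f) \<and> y \<in> hom1 X (Dom X x) (Dom X d) \<and> f \<odot> x' = d \<odot> y}"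
    (is "bij_betw ?F ?A ?B")
    using pb assms(2) unfolding is_pullback_def by simp
  moreover have "(x, y) \<in> ?B" using assms by (simp add: hom1_iff)
  ultimately have "\<exists>!h. h \<in> ?A \<and> ?F h = (x, y)"
    unfolding bij_betw_def inj_on_def by (smt (verit) imageE)
  then show ?thesis by simp
qed

lemma pullback_tup1:
  assumes "is_pullback X f d u v"
    "x \<in> Ar X" "y \<in> Ar X" "Dom X y = Dom X x" "Cod X x = Dom X f" "Cod X y = Dom X d"
    "f \<odot> x = d \<odot> y"
  shows "tup1 X (u, v) x y \<in> Ar X" "Dom X (tup1 X (u, v) x y) = Dom X x"
    "Cod X (tup1 X (u, v) x y) = Dom X u" "u \<odot> tup1 X (u, v) x y = x" "v \<odot> tup1 X (u, v) x y = y"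
  using theI'[OF pullback_tup1_ex1[OF assms]] by (auto simp: tup1_def hom1_iff)

lemma pullback_eqI1:
  assumes pb: "is_pullback X f d u v"
    and h: "h \<in> Ar X" "h' \<in> Ar X" "Dom X h' = Dom X h" "Cod X h = Dom X u" "Cod X h' = Dom X u"
    and eq: "u \<odot> h = u \<odot> h'" "v \<odot> h = v \<odot> h'"
  shows "h = h'"
  using pullback_tup1_ex1[OF pb, of "u \<odot> h" "v \<odot> h"] pullbackD[OF pb] h eq
    cmp1_assoc'[of h u f] cmp1_assoc'[of h v d]
  by (auto simp: hom1_iff)

lemma pullback_tup2_ex1:
  assumes pb: "is_pullback X f d u v"
    and "\<xi> \<in> Ce X" "\<zeta> \<in> Ce X" "Dom X (Src X \<zeta>) = Dom X (Src X \<xi>)"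
    "Cod X (Src X \<xi>) = Dom X f" "Cod X (Src X \<zeta>) = Dom X d" "f \<triangleleft> \<xi> = d \<triangleleft> \<zeta>"
  shows "\<exists>!\<gamma>. \<gamma> \<in> cells X (Dom X (Src X \<xi>)) (Dom X u) \<and> u \<triangleleft> \<gamma> = \<xi> \<and> v \<triangleleft> \<gamma> = \<zeta>"
proof -
  let ?Z = "Dom X (Src X \<xi>)"
  have "bij_betw (\<lambda>\<gamma>. (u \<triangleleft> \<gamma>, v \<triangleleft> \<gamma>)) (cells X ?Z (Dom X u))
          {(\<xi>, \<zeta>). \<xi> \<in> cells X ?Z (Dom X f) \<and> \<zeta> \<in> cells X ?Z (Dom X d) \<and> f \<triangleleft> \<xi> = d \<triangleleft> \<zeta>}"
    (is "bij_betw ?F ?A ?B")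
    using pb assms(2) unfolding is_pullback_def by simp
  moreover have "(\<xi>, \<zeta>) \<in> ?B" using assms by (simp add: cells_iff)
  ultimately have "\<exists>!h. h \<in> ?A \<and> ?F h = (\<xi>, \<zeta>)"
    unfolding bij_betw_def inj_on_def by (smt (verit) imageE)
  then show ?thesis by simp
qed

lemma pullback_eqI2:
  assumes pb: "is_pullback X f d u v"
    and h: "\<gamma> \<in> Ce X" "\<gamma>' \<in> Ce X" "Dom X (Src X \<gamma>') = Dom X (Src X \<gamma>)"
      "Cod X (Src X \<gamma>) = Dom X u" "Cod X (Src X \<gamma>') = Dom X u"
    and eq: "u \<triangleleft> \<gamma> = u \<triangleleft> \<gamma>'" "v \<triangleleft> \<gamma> = v \<triangleleft> \<gamma>'"
  shows "\<gamma> = \<gamma>'"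
  using pullback_tup2_ex1[OF pb, of "u \<triangleleft> \<gamma>" "v \<triangleleft> \<gamma>"] pullbackD[OF pb] h eq
  by (auto simp: cells_iff lwhisker_lwhisker)

text \<open>The source and the target of the induced 2-cell are not part of its specification; they are found by projecting.\<close>

lemma pullback_tup2:
  assumes pb: "is_pullback X f d u v"
    and c: "\<xi> \<in> Ce X" "\<zeta> \<in> Ce X" "Dom X (Src X \<zeta>) = Dom X (Src X \<xi>)"
      "Cod X (Src X \<xi>) = Dom X f" "Cod X (Src X \<zeta>) = Dom X d" "f \<triangleleft> \<xi> = d \<triangleleft> \<zeta>"
  shows "tup2 X (u, v) \<xi> \<zeta> \<in> Ce X" "Dom X (Src X (tup2 X (u, v) \<xi> \<zeta>)) = Dom X (Src X \<xi>)"
    "Cod X (Src X (tup2 X (u, v) \<xi> \<zeta>)) = Dom X u"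
    "u \<triangleleft> tup2 X (u, v) \<xi> \<zeta> = \<xi>" "v \<triangleleft> tup2 X (u, v) \<xi> \<zeta> = \<zeta>"
    "Src X (tup2 X (u, v) \<xi> \<zeta>) = tup1 X (u, v) (Src X \<xi>) (Src X \<zeta>)"
    "Tgt X (tup2 X (u, v) \<xi> \<zeta>) = tup1 X (u, v) (Tgt X \<xi>) (Tgt X \<zeta>)"
proof -
  let ?\<gamma> = "tup2 X (u, v) \<xi> \<zeta>"
  note P = pullbackD[OF pb]
  show *: "?\<gamma> \<in> Ce X" "Dom X (Src X ?\<gamma>) = Dom X (Src X \<xi>)" "Cod X (Src X ?\<gamma>) = Dom X u"
    "u \<triangleleft> ?\<gamma> = \<xi>" "v \<triangleleft> ?\<gamma> = \<zeta>"
    using theI'[OF pullback_tup2_ex1[OF assms]] by (auto simp: tup2_def cells_iff)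
  have S: "Src X \<xi> = u \<odot> Src X ?\<gamma>" "Src X \<zeta> = v \<odot> Src X ?\<gamma>"
    using lwhisker_simps(2)[of ?\<gamma> u] lwhisker_simps(2)[of ?\<gamma> v] * P by simp_all
  have T: "Tgt X \<xi> = u \<odot> Tgt X ?\<gamma>" "Tgt X \<zeta> = v \<odot> Tgt X ?\<gamma>"
    using lwhisker_simps(3)[of ?\<gamma> u] lwhisker_simps(3)[of ?\<gamma> v] * P by simp_all
  have s: "f \<odot> Src X \<xi> = d \<odot> Src X \<zeta>"
    using c P by (metis lwhisker_simps(2))
  have t: "f \<odot> Tgt X \<xi> = d \<odot> Tgt X \<zeta>"
    using c P by (metis lwhisker_simps(3))
  have ts: "tup1 X (u, v) (Src X \<xi>) (Src X \<zeta>) \<in> Ar X"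
    "Dom X (tup1 X (u, v) (Src X \<xi>) (Src X \<zeta>)) = Dom X (Src X \<xi>)"
    "Cod X (tup1 X (u, v) (Src X \<xi>) (Src X \<zeta>)) = Dom X u"
    "u \<odot> tup1 X (u, v) (Src X \<xi>) (Src X \<zeta>) = Src X \<xi>"
    "v \<odot> tup1 X (u, v) (Src X \<xi>) (Src X \<zeta>) = Src X \<zeta>"
    by (rule pullback_tup1[OF pb]; use c s in simp)+
  have tt: "tup1 X (u, v) (Tgt X \<xi>) (Tgt X \<zeta>) \<in> Ar X"
    "Dom X (tup1 X (u, v) (Tgt X \<xi>) (Tgt X \<zeta>)) = Dom X (Tgt X \<xi>)"
    "Cod X (tup1 X (u, v) (Tgt X \<xi>) (Tgt X \<zeta>)) = Dom X u"
    "u \<odot> tup1 X (u, v) (Tgt X \<xi>) (Tgt X \<zeta>) = Tgt X \<xi>"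
    "v \<odot> tup1 X (u, v) (Tgt X \<xi>) (Tgt X \<zeta>) = Tgt X \<zeta>"
    by (rule pullback_tup1[OF pb]; use c t in simp)+
  show "Src X ?\<gamma> = tup1 X (u, v) (Src X \<xi>) (Src X \<zeta>)"
    by (rule pullback_eqI1[OF pb]) (use * ts S in simp_all)
  show "Tgt X ?\<gamma> = tup1 X (u, v) (Tgt X \<xi>) (Tgt X \<zeta>)"
    by (rule pullback_eqI1[OF pb]) (use * tt T P in simp_all)
qed

text \<open>A class of maps that contains the isomorphisms and is closed under composition contains every pullback of a map as
soon as it contains one.\<close>

lemma pullback_iso1:
  assumes pb: "is_pullback X f d u v" and pb': "is_pullback X f d u' v'"
  obtains i where "iso1 X i" "Dom X i = Dom X u" "Cod X i = Dom X u'" "u' \<odot> i = u"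
proof
  note P = pullbackD[OF pb] and P' = pullbackD[OF pb']
  let ?i = "tup1 X (u', v') u v" and ?j = "tup1 X (u, v) u' v'"
  have i: "?i \<in> Ar X" "Dom X ?i = Dom X u" "Cod X ?i = Dom X u'" "u' \<odot> ?i = u" "v' \<odot> ?i = v"
    by (rule pullback_tup1[OF pb']; use P P' in simp)+
  have j: "?j \<in> Ar X" "Dom X ?j = Dom X u'" "Cod X ?j = Dom X u" "u \<odot> ?j = u'" "v \<odot> ?j = v'"
    by (rule pullback_tup1[OF pb]; use P P' in simp)+
  have "?j \<odot> ?i = id1 X (Dom X u)"
    by (rule pullback_eqI1[OF pb]) (use P P' i j in \<open>simp_all add: cmp1_fuse[OF j(4)] cmp1_fuse[OF j(5)]\<close>)
  moreover have "?i \<odot> ?j = id1 X (Dom X u')"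
    by (rule pullback_eqI1[OF pb']) (use P P' i j in \<open>simp_all add: cmp1_fuse[OF i(4)] cmp1_fuse[OF i(5)]\<close>)
  ultimately show "iso1 X ?i"
    unfolding iso1_def using i j by (auto simp: hom1_iff intro!: bexI[of _ ?j])
qed (use pullback_tup1[OF pb', of u v] pullbackD[OF pb] pullbackD[OF pb'] in simp_all)

lemma arrow_objectD:
  assumes "is_arrow_object X C (d\<^sub>0, d\<^sub>1, \<chi>)"
  shows "d\<^sub>0 \<in> Ar X" "Cod X d\<^sub>0 = C" "d\<^sub>1 \<in> Ar X" "Dom X d\<^sub>1 = Dom X d\<^sub>0" "Cod X d\<^sub>1 = C"
    "\<chi> \<in> Ce X" "Src X \<chi> = d\<^sub>0" "Tgt X \<chi> = d\<^sub>1"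
  using assms unfolding is_arrow_object_def by (auto simp: hom1_iff hom2_iff)

lemma arrow_name_ex1:
  assumes ao: "is_arrow_object X C (d\<^sub>0, d\<^sub>1, \<chi>)"
    and \<theta>: "\<theta> \<in> Ce X" "Cod X (Src X \<theta>) = C"
  shows "\<exists>!h. h \<in> hom1 X (Dom X (Src X \<theta>)) (Dom X d\<^sub>0) \<and> \<chi> \<triangleright> h = \<theta>"
proof -
  let ?Z = "Dom X (Src X \<theta>)"
  have "bij_betw (\<lambda>h. \<chi> \<triangleright> h) (hom1 X ?Z (Dom X d\<^sub>0)) (cells X ?Z C)"
    using ao \<theta> unfolding is_arrow_object_def by simp
  moreover have "\<theta> \<in> cells X ?Z C" using \<theta> by (simp add: cells_iff)
  ultimately show ?thesis
    unfolding bij_betw_def inj_on_def by (smt (verit) imageE)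
qed

lemma arrow_name:
  assumes "is_arrow_object X C (d\<^sub>0, d\<^sub>1, \<chi>)" "\<theta> \<in> Ce X" "Cod X (Src X \<theta>) = C"
  shows "arrow_name X (d\<^sub>0, d\<^sub>1, \<chi>) \<theta> \<in> Ar X"
    "Dom X (arrow_name X (d\<^sub>0, d\<^sub>1, \<chi>) \<theta>) = Dom X (Src X \<theta>)"
    "Cod X (arrow_name X (d\<^sub>0, d\<^sub>1, \<chi>) \<theta>) = Dom X d\<^sub>0"
    "\<chi> \<triangleright> arrow_name X (d\<^sub>0, d\<^sub>1, \<chi>) \<theta> = \<theta>"
    "d\<^sub>0 \<odot> arrow_name X (d\<^sub>0, d\<^sub>1, \<chi>) \<theta> = Src X \<theta>"
    "d\<^sub>1 \<odot> arrow_name X (d\<^sub>0, d\<^sub>1, \<chi>) \<theta> = Tgt X \<theta>"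
proof -
  let ?h = "arrow_name X (d\<^sub>0, d\<^sub>1, \<chi>) \<theta>"
  note A = arrow_objectD[OF assms(1)]
  show *: "?h \<in> Ar X" "Dom X ?h = Dom X (Src X \<theta>)" "Cod X ?h = Dom X d\<^sub>0" "\<chi> \<triangleright> ?h = \<theta>"
    using theI'[OF arrow_name_ex1[OF assms]] by (auto simp: arrow_name_def hom1_iff)
  show "d\<^sub>0 \<odot> ?h = Src X \<theta>" "d\<^sub>1 \<odot> ?h = Tgt X \<theta>"
    using rwhisker_simps(2,3)[of \<chi> ?h] * A by simp_all
qed

lemma arrow_eqI1:
  assumes ao: "is_arrow_object X C (d\<^sub>0, d\<^sub>1, \<chi>)"
    and "h \<in> Ar X" "h' \<in> Ar X" "Dom X h' = Dom X h" "Cod X h = Dom X d\<^sub>0" "Cod X h' = Dom X d\<^sub>0"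
    and "\<chi> \<triangleright> h = \<chi> \<triangleright> h'"
  shows "h = h'"
  using arrow_name_ex1[OF ao, of "\<chi> \<triangleright> h"] arrow_objectD[OF ao] assms by (auto simp: hom1_iff)

text \<open>A 2-cell into the arrow object is a commutative square whose vertical sides are the arrows named by its source and
target, so only its horizontal sides have to be compared.\<close>

lemma arrow_eqI2:
  assumes ao: "is_arrow_object X C (d\<^sub>0, d\<^sub>1, \<chi>)"
    and "\<gamma> \<in> Ce X" "\<gamma>' \<in> Ce X" "Cod X (Src X \<gamma>) = Dom X d\<^sub>0" "Src X \<gamma>' = Src X \<gamma>"
      "Tgt X \<gamma>' = Tgt X \<gamma>" "d\<^sub>0 \<triangleleft> \<gamma> = d\<^sub>0 \<triangleleft> \<gamma>'" "d\<^sub>1 \<triangleleft> \<gamma> = d\<^sub>1 \<triangleleft> \<gamma>'"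
  shows "\<gamma> = \<gamma>'"
proof -
  have "inj_on (\<lambda>\<gamma>. (\<chi> \<triangleright> Src X \<gamma>, d\<^sub>0 \<triangleleft> \<gamma>, d\<^sub>1 \<triangleleft> \<gamma>, \<chi> \<triangleright> Tgt X \<gamma>))
      (cells X (Dom X (Src X \<gamma>)) (Dom X d\<^sub>0))"
    using ao assms(2) unfolding is_arrow_object_def by (auto dest: bij_betw_imp_inj_on)
  then show ?thesis
    using assms by (auto simp: cells_iff inj_on_def)
qed

lemma arrow_cell_exists:
  assumes ao: "is_arrow_object X C (d\<^sub>0, d\<^sub>1, \<chi>)"
    and h: "h \<in> Ar X" "h' \<in> Ar X" "Dom X h' = Dom X h" "Cod X h = Dom X d\<^sub>0" "Cod X h' = Dom X d\<^sub>0"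
    and \<xi>: "\<xi> \<in> Ce X" "Src X \<xi> = d\<^sub>0 \<odot> h" "Tgt X \<xi> = d\<^sub>0 \<odot> h'"
    and \<zeta>: "\<zeta> \<in> Ce X" "Src X \<zeta> = d\<^sub>1 \<odot> h" "Tgt X \<zeta> = d\<^sub>1 \<odot> h'"
    and sq: "(\<chi> \<triangleright> h') \<bullet> \<xi> = \<zeta> \<bullet> (\<chi> \<triangleright> h)"
  obtains \<gamma> where "\<gamma> \<in> Ce X" "Src X \<gamma> = h" "Tgt X \<gamma> = h'" "d\<^sub>0 \<triangleleft> \<gamma> = \<xi>" "d\<^sub>1 \<triangleleft> \<gamma> = \<zeta>"
proof -
  note A = arrow_objectD[OF ao]
  have "bij_betw (\<lambda>\<gamma>. (\<chi> \<triangleright> Src X \<gamma>, d\<^sub>0 \<triangleleft> \<gamma>, d\<^sub>1 \<triangleleft> \<gamma>, \<chi> \<triangleright> Tgt X \<gamma>))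
          (cells X (Dom X h) (Dom X d\<^sub>0))
          {(\<theta>, \<xi>, \<zeta>, \<theta>'). \<theta> \<in> cells X (Dom X h) C \<and> \<theta>' \<in> cells X (Dom X h) C \<and>
             \<xi> \<in> hom2 X (Src X \<theta>) (Src X \<theta>') \<and> \<zeta> \<in> hom2 X (Tgt X \<theta>) (Tgt X \<theta>') \<and>
             \<theta>' \<bullet> \<xi> = \<zeta> \<bullet> \<theta>}" (is "bij_betw ?F ?A ?B")
    using ao h unfolding is_arrow_object_def by simp
  moreover have "(\<chi> \<triangleright> h, \<xi>, \<zeta>, \<chi> \<triangleright> h') \<in> ?B"
    using A assms by (simp add: cells_iff hom2_iff)
  ultimately obtain \<gamma> where \<gamma>: "\<gamma> \<in> ?A" "?F \<gamma> = (\<chi> \<triangleright> h, \<xi>, \<zeta>, \<chi> \<triangleright> h')"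
    unfolding bij_betw_def by (metis (no_types, lifting) imageE)
  have c: "\<gamma> \<in> Ce X" "Dom X (Src X \<gamma>) = Dom X h" "Cod X (Src X \<gamma>) = Dom X d\<^sub>0"
    using \<gamma>(1) by (auto simp: cells_iff)
  have "Src X \<gamma> = h" "Tgt X \<gamma> = h'"
    by (rule arrow_eqI1[OF ao]; use c \<gamma>(2) h in simp)+
  with c \<gamma>(2) that show thesis by auto
qed

end


section \<open>Isomorphisms of 2-categories\<close>

text \<open>Every axiom of a 2-category is an equation or a typing statement about the operations, so the bijections carry it from
\<open>X\<close> to \<open>Y\<close>.\<close>

locale two_category_iso = X: two_category X
  for X :: "('o, 'm, 'c) two_cat" and Y :: "('p, 'n, 'd) two_cat"
    and G\<^sub>0 :: "'o \<Rightarrow> 'p" and G\<^sub>1 :: "'m \<Rightarrow> 'n" and G\<^sub>2 :: "'c \<Rightarrow> 'd" +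
  assumes G0: "bij_betw G\<^sub>0 (Ob X) (Ob Y)"
    and G1: "bij_betw G\<^sub>1 (Ar X) (Ar Y)"
    and G2: "bij_betw G\<^sub>2 (Ce X) (Ce Y)"
    and G_Dom [simp]: "f \<in> Ar X \<Longrightarrow> Dom Y (G\<^sub>1 f) = G\<^sub>0 (Dom X f)"
    and G_Cod [simp]: "f \<in> Ar X \<Longrightarrow> Cod Y (G\<^sub>1 f) = G\<^sub>0 (Cod X f)"
    and G_Src [simp]: "\<alpha> \<in> Ce X \<Longrightarrow> Src Y (G\<^sub>2 \<alpha>) = G\<^sub>1 (Src X \<alpha>)"
    and G_Tgt [simp]: "\<alpha> \<in> Ce X \<Longrightarrow> Tgt Y (G\<^sub>2 \<alpha>) = G\<^sub>1 (Tgt X \<alpha>)"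
    and G_id1 [simp]: "a \<in> Ob X \<Longrightarrow> id1 Y (G\<^sub>0 a) = G\<^sub>1 (id1 X a)"
    and G_cmp1 [simp]: "\<lbrakk>f \<in> Ar X; g \<in> Ar X; Cod X f = Dom X g\<rbrakk>
          \<Longrightarrow> G\<^sub>1 g \<odot>\<^bsub>Y\<^esub> G\<^sub>1 f = G\<^sub>1 (g \<odot>\<^bsub>X\<^esub> f)"
    and G_id2 [simp]: "f \<in> Ar X \<Longrightarrow> id2 Y (G\<^sub>1 f) = G\<^sub>2 (id2 X f)"
    and G_vcmp [simp]: "\<lbrakk>\<alpha> \<in> Ce X; \<beta> \<in> Ce X; Tgt X \<alpha> = Src X \<beta>\<rbrakk>
          \<Longrightarrow> G\<^sub>2 \<beta> \<bullet>\<^bsub>Y\<^esub> G\<^sub>2 \<alpha> = G\<^sub>2 (\<beta> \<bullet>\<^bsub>X\<^esub> \<alpha>)"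
    and G_hcmp [simp]: "\<lbrakk>\<alpha> \<in> Ce X; \<beta> \<in> Ce X; Cod X (Src X \<alpha>) = Dom X (Src X \<beta>)\<rbrakk>
          \<Longrightarrow> G\<^sub>2 \<beta> \<star>\<^bsub>Y\<^esub> G\<^sub>2 \<alpha> = G\<^sub>2 (\<beta> \<star>\<^bsub>X\<^esub> \<alpha>)"
begin

lemma G_mem [simp]:
  "a \<in> Ob X \<Longrightarrow> G\<^sub>0 a \<in> Ob Y" "f \<in> Ar X \<Longrightarrow> G\<^sub>1 f \<in> Ar Y" "\<alpha> \<in> Ce X \<Longrightarrow> G\<^sub>2 \<alpha> \<in> Ce Y"
  using G0 G1 G2 by (auto simp: bij_betw_def)

lemma G_inject [simp]:
  "\<lbrakk>a \<in> Ob X; b \<in> Ob X\<rbrakk> \<Longrightarrow> G\<^sub>0 a = G\<^sub>0 b \<longleftrightarrow> a = b"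
  "\<lbrakk>f \<in> Ar X; g \<in> Ar X\<rbrakk> \<Longrightarrow> G\<^sub>1 f = G\<^sub>1 g \<longleftrightarrow> f = g"
  "\<lbrakk>\<alpha> \<in> Ce X; \<beta> \<in> Ce X\<rbrakk> \<Longrightarrow> G\<^sub>2 \<alpha> = G\<^sub>2 \<beta> \<longleftrightarrow> \<alpha> = \<beta>"
  using G0 G1 G2 by (auto simp: bij_betw_def inj_on_def)

lemma G_surj:
  "b \<in> Ob Y \<Longrightarrow> \<exists>a\<in>Ob X. b = G\<^sub>0 a" "g \<in> Ar Y \<Longrightarrow> \<exists>f\<in>Ar X. g = G\<^sub>1 f"
  "\<beta> \<in> Ce Y \<Longrightarrow> \<exists>\<alpha>\<in>Ce X. \<beta> = G\<^sub>2 \<alpha>"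
  using G0 G1 G2 by (auto simp: bij_betw_def image_iff)

lemma hom1_YE:
  assumes "g \<in> hom1 Y a b"
  obtains f where "f \<in> Ar X" "g = G\<^sub>1 f" "a = G\<^sub>0 (Dom X f)" "b = G\<^sub>0 (Cod X f)"
  using assms G_surj(2)[of g] by (auto simp: hom1_def)

lemma hom2_YE:
  assumes "\<beta> \<in> hom2 Y f g"
  obtains \<alpha> where "\<alpha> \<in> Ce X" "\<beta> = G\<^sub>2 \<alpha>" "f = G\<^sub>1 (Src X \<alpha>)" "g = G\<^sub>1 (Tgt X \<alpha>)"
  using assms G_surj(3)[of \<beta>] by (auto simp: hom2_def)

lemma cells_YE:
  assumes "\<beta> \<in> cells Y a b"
  obtains \<alpha> where "\<alpha> \<in> Ce X" "\<beta> = G\<^sub>2 \<alpha>" "a = G\<^sub>0 (Dom X (Src X \<alpha>))" "b = G\<^sub>0 (Cod X (Src X \<alpha>))"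
  using assms G_surj(3)[of \<beta>] by (auto simp: cells_def hom1_def)

lemma two_category_Y: "two_category Y"
proof
  show "Dom Y f \<in> Ob Y" "Cod Y f \<in> Ob Y" if "f \<in> Ar Y" for f
    using G_surj(2)[OF that] by auto
  show "Src Y \<alpha> \<in> Ar Y" "Tgt Y \<alpha> \<in> Ar Y" "Dom Y (Tgt Y \<alpha>) = Dom Y (Src Y \<alpha>)"
    "Cod Y (Tgt Y \<alpha>) = Cod Y (Src Y \<alpha>)" if "\<alpha> \<in> Ce Y" for \<alpha>
    using G_surj(3)[OF that] by auto
  show "id1 Y a \<in> hom1 Y a a" if "a \<in> Ob Y" for a
    using G_surj(1)[OF that] by (auto simp: hom1_def)
  show "id2 Y f \<in> hom2 Y f f" if "f \<in> Ar Y" for f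
    using G_surj(2)[OF that] by (auto simp: hom2_def)
  show "g \<odot>\<^bsub>Y\<^esub> f \<in> hom1 Y a c" if "f \<in> hom1 Y a b" "g \<in> hom1 Y b c" for a b c f g
    using that by (elim hom1_YE) (auto simp: hom1_def)
  show "f \<odot>\<^bsub>Y\<^esub> id1 Y a = f" "id1 Y b \<odot>\<^bsub>Y\<^esub> f = f" if "f \<in> hom1 Y a b" for a b f
    using that by (elim hom1_YE; auto)+
  show "(h \<odot>\<^bsub>Y\<^esub> g) \<odot>\<^bsub>Y\<^esub> f = h \<odot>\<^bsub>Y\<^esub> (g \<odot>\<^bsub>Y\<^esub> f)"
    if "f \<in> hom1 Y a b" "g \<in> hom1 Y b c" "h \<in> hom1 Y c d" for a b c d f g h
    using that by (elim hom1_YE) auto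
  show "\<beta> \<bullet>\<^bsub>Y\<^esub> \<alpha> \<in> hom2 Y f h" if "\<alpha> \<in> hom2 Y f g" "\<beta> \<in> hom2 Y g h" for f g h \<alpha> \<beta>
    using that by (elim hom2_YE) (auto simp: hom2_def)
  show "\<alpha> \<bullet>\<^bsub>Y\<^esub> id2 Y f = \<alpha>" "id2 Y g \<bullet>\<^bsub>Y\<^esub> \<alpha> = \<alpha>" if "\<alpha> \<in> hom2 Y f g" for \<alpha> f g
    using that by (elim hom2_YE; auto)+
  show "(\<gamma> \<bullet>\<^bsub>Y\<^esub> \<beta>) \<bullet>\<^bsub>Y\<^esub> \<alpha> = \<gamma> \<bullet>\<^bsub>Y\<^esub> (\<beta> \<bullet>\<^bsub>Y\<^esub> \<alpha>)"
    if "\<alpha> \<in> hom2 Y f g" "\<beta> \<in> hom2 Y g h" "\<gamma> \<in> hom2 Y h k" for f g h k \<alpha> \<beta> \<gamma>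
    using that by (elim hom2_YE) auto
  show "\<beta> \<star>\<^bsub>Y\<^esub> \<alpha> \<in> hom2 Y (Src Y \<beta> \<odot>\<^bsub>Y\<^esub> Src Y \<alpha>) (Tgt Y \<beta> \<odot>\<^bsub>Y\<^esub> Tgt Y \<alpha>)"
    if "\<alpha> \<in> cells Y a b" "\<beta> \<in> cells Y b c" for a b c \<alpha> \<beta>
    using that by (elim cells_YE) (auto simp: hom2_def)
  show "\<alpha> \<star>\<^bsub>Y\<^esub> id2 Y (id1 Y a) = \<alpha>" "id2 Y (id1 Y b) \<star>\<^bsub>Y\<^esub> \<alpha> = \<alpha>" if "\<alpha> \<in> cells Y a b" for a b \<alpha>
    using that by (elim cells_YE;
        auto simp: X.whisker_id1[unfolded lwhisker_def rwhisker_def])+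
  show "(\<gamma> \<star>\<^bsub>Y\<^esub> \<beta>) \<star>\<^bsub>Y\<^esub> \<alpha> = \<gamma> \<star>\<^bsub>Y\<^esub> (\<beta> \<star>\<^bsub>Y\<^esub> \<alpha>)"
    if "\<alpha> \<in> cells Y a b" "\<beta> \<in> cells Y b c" "\<gamma> \<in> cells Y c d" for a b c d \<alpha> \<beta> \<gamma>
    using that by (elim cells_YE) (auto simp: X.hcmp_assoc')
  show "id2 Y g \<star>\<^bsub>Y\<^esub> id2 Y f = id2 Y (g \<odot>\<^bsub>Y\<^esub> f)" if "f \<in> hom1 Y a b" "g \<in> hom1 Y b c" for a b c f g
    using that by (elim hom1_YE) auto
  show "(\<beta>' \<bullet>\<^bsub>Y\<^esub> \<beta>) \<star>\<^bsub>Y\<^esub> (\<alpha>' \<bullet>\<^bsub>Y\<^esub> \<alpha>) = (\<beta>' \<star>\<^bsub>Y\<^esub> \<alpha>') \<bullet>\<^bsub>Y\<^esub> (\<beta> \<star>\<^bsub>Y\<^esub> \<alpha>)"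
    if "\<alpha> \<in> cells Y a b" "\<alpha>' \<in> cells Y a b" "Tgt Y \<alpha> = Src Y \<alpha>'"
      "\<beta> \<in> cells Y b c" "\<beta>' \<in> cells Y b c" "Tgt Y \<beta> = Src Y \<beta>'" for a b c \<alpha> \<alpha>' \<beta> \<beta>'
    using that by (elim cells_YE) (auto simp: X.interchange')
qed

lemma isomorphic: "isomorphic_two_categories X Y"
proof -
  let ?H0 = "the_inv_into (Ob X) G\<^sub>0" and ?H1 = "the_inv_into (Ar X) G\<^sub>1"
    and ?H2 = "the_inv_into (Ce X) G\<^sub>2"
  have inv [simp]: "\<And>a. a \<in> Ob X \<Longrightarrow> ?H0 (G\<^sub>0 a) = a" "\<And>f. f \<in> Ar X \<Longrightarrow> ?H1 (G\<^sub>1 f) = f"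
    "\<And>\<alpha>. \<alpha> \<in> Ce X \<Longrightarrow> ?H2 (G\<^sub>2 \<alpha>) = \<alpha>"
    using G0 G1 G2 by (auto simp: bij_betw_def the_inv_into_f_f)
  have F: "two_functor X Y G\<^sub>0 G\<^sub>1 G\<^sub>2"
    by (auto simp: two_functor_def hom1_def hom2_def)
  have H: "two_functor Y X ?H0 ?H1 ?H2"
    unfolding two_functor_def
    by (intro conjI ballI; (drule G_surj)+; auto simp: hom1_def hom2_def)
  show ?thesis
    unfolding isomorphic_two_categories_def
    by (intro conjI X.two_category_axioms two_category_Y exI[of _ G\<^sub>0] exI[of _ G\<^sub>1] exI[of _ G\<^sub>2]
        exI[of _ ?H0] exI[of _ ?H1] exI[of _ ?H2] F H) (auto dest: G_surj)
qed

lemma G_whisker [simp]: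
  "\<lbrakk>\<alpha> \<in> Ce X; f \<in> Ar X; Cod X (Src X \<alpha>) = Dom X f\<rbrakk> \<Longrightarrow> G\<^sub>1 f \<triangleleft>\<^bsub>Y\<^esub> G\<^sub>2 \<alpha> = G\<^sub>2 (f \<triangleleft>\<^bsub>X\<^esub> \<alpha>)"
  "\<lbrakk>\<alpha> \<in> Ce X; f \<in> Ar X; Cod X f = Dom X (Src X \<alpha>)\<rbrakk> \<Longrightarrow> G\<^sub>2 \<alpha> \<triangleright>\<^bsub>Y\<^esub> G\<^sub>1 f = G\<^sub>2 (\<alpha> \<triangleright>\<^bsub>X\<^esub> f)"
  by (auto simp: lwhisker_def rwhisker_def)

lemma G_iso2: "\<alpha> \<in> Ce X \<Longrightarrow> iso2 Y (G\<^sub>2 \<alpha>) \<longleftrightarrow> iso2 X \<alpha>"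
proof
  assume a: "\<alpha> \<in> Ce X" "iso2 Y (G\<^sub>2 \<alpha>)"
  then obtain \<beta>' where b: "\<beta>' \<in> hom2 Y (Tgt Y (G\<^sub>2 \<alpha>)) (Src Y (G\<^sub>2 \<alpha>))"
    "\<beta>' \<bullet>\<^bsub>Y\<^esub> G\<^sub>2 \<alpha> = id2 Y (Src Y (G\<^sub>2 \<alpha>))" "G\<^sub>2 \<alpha> \<bullet>\<^bsub>Y\<^esub> \<beta>' = id2 Y (Tgt Y (G\<^sub>2 \<alpha>))"
    by (auto simp: iso2_def)
  from b(1) obtain \<beta> where "\<beta> \<in> Ce X" "\<beta>' = G\<^sub>2 \<beta>" "Tgt X \<alpha> = Src X \<beta>" "Src X \<alpha> = Tgt X \<beta>"
    using a by (elim hom2_YE) auto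
  then show "iso2 X \<alpha>"
    using a b by (intro X.iso2I[of \<alpha> \<beta>]) auto
next
  assume a: "\<alpha> \<in> Ce X" "iso2 X \<alpha>"
  then obtain \<beta> where "\<beta> \<in> Ce X" "Src X \<beta> = Tgt X \<alpha>" "Tgt X \<beta> = Src X \<alpha>"
    "\<beta> \<bullet>\<^bsub>X\<^esub> \<alpha> = id2 X (Src X \<alpha>)" "\<alpha> \<bullet>\<^bsub>X\<^esub> \<beta> = id2 X (Tgt X \<alpha>)" by (auto elim: X.iso2E)
  with a(1) show "iso2 Y (G\<^sub>2 \<alpha>)"
    unfolding iso2_def by (intro conjI bexI[of _ "G\<^sub>2 \<beta>"]) (simp_all add: hom2_def)
qed

lemma G_adjunction:
  assumes "l \<in> Ar X" "r \<in> Ar X" "\<eta> \<in> Ce X" "\<epsilon> \<in> Ce X"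
  shows "adjunction Y (G\<^sub>1 l) (G\<^sub>1 r) (G\<^sub>2 \<eta>) (G\<^sub>2 \<epsilon>) \<longleftrightarrow> adjunction X l r \<eta> \<epsilon>"
proof -
  interpret Y: two_category Y by (rule two_category_Y)
  show ?thesis
    using assms unfolding X.adjunction_iff[OF assms(1)] Y.adjunction_iff[OF G_mem(2)[OF assms(1)]]
    by (auto 0 0)
qed

lemma G_mate:
  assumes l: "l\<^sub>1 \<in> Ar X" "l\<^sub>2 \<in> Ar X"
    and adj: "adjunction X l\<^sub>1 r\<^sub>1 \<eta>\<^sub>1 \<epsilon>\<^sub>1" "adjunction X l\<^sub>2 r\<^sub>2 \<eta>\<^sub>2 \<epsilon>\<^sub>2"
    and u: "u \<in> Ar X" "Dom X u = Dom X l\<^sub>1" "Cod X u = Dom X l\<^sub>2"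
    and v: "v \<in> Ar X" "Dom X v = Cod X l\<^sub>1" "Cod X v = Cod X l\<^sub>2"
    and sq: "l\<^sub>2 \<odot>\<^bsub>X\<^esub> u = v \<odot>\<^bsub>X\<^esub> l\<^sub>1"
  shows "mate Y (G\<^sub>1 r\<^sub>1) (G\<^sub>2 \<epsilon>\<^sub>1) (G\<^sub>1 r\<^sub>2) (G\<^sub>2 \<eta>\<^sub>2) (G\<^sub>1 u) (G\<^sub>1 v) = G\<^sub>2 (mate X r\<^sub>1 \<epsilon>\<^sub>1 r\<^sub>2 \<eta>\<^sub>2 u v)"
  using assms X.cmp1_fuse[OF sq, of r\<^sub>1] by (simp add: mate_def X.adjunction_iff)

end


section \<open>Objects with structure\<close>

lemma structured_sel [simp]:
  "Ob (structured X O' M) = O'"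
  "Dom (structured X O' M) = odom" "Cod (structured X O' M) = ocod"
  "Src (structured X O' M) c = Over (odom c) (Src X (ocell c)) (ocod c)"
  "Tgt (structured X O' M) c = Over (odom c) (Tgt X (ocell c)) (ocod c)"
  "id1 (structured X O' M) a = Over a (id1 X (fst a)) a"
  "g \<odot>\<^bsub>structured X O' M\<^esub> f = Over (odom f) (ocell g \<odot>\<^bsub>X\<^esub> ocell f) (ocod g)"
  "id2 (structured X O' M) f = Over (odom f) (id2 X (ocell f)) (ocod f)"
  "d \<bullet>\<^bsub>structured X O' M\<^esub> c = Over (odom c) (ocell d \<bullet>\<^bsub>X\<^esub> ocell c) (ocod d)"
  "d \<star>\<^bsub>structured X O' M\<^esub> c = Over (odom c) (ocell d \<star>\<^bsub>X\<^esub> ocell c) (ocod d)"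
  by (simp_all add: structured_def)

lemma structured_Ar:
  "f \<in> Ar (structured X O' M) \<longleftrightarrow> odom f \<in> O' \<and> ocod f \<in> O' \<and>
     ocell f \<in> hom1 X (fst (odom f)) (fst (ocod f)) \<and> M (odom f) (ocell f) (ocod f)"
  by (cases f) (auto simp: structured_def)

lemma structured_Ce:
  "c \<in> Ce (structured X O' M) \<longleftrightarrow> odom c \<in> O' \<and> ocod c \<in> O' \<and>
     ocell c \<in> cells X (fst (odom c)) (fst (ocod c)) \<and>
     M (odom c) (Src X (ocell c)) (ocod c) \<and> M (odom c) (Tgt X (ocell c)) (ocod c)"
  by (cases c) (auto simp: structured_def)

lemma over_eqI:
  "\<lbrakk>odom f = odom g; ocell f = ocell g; ocod f = ocod g\<rbrakk> \<Longrightarrow> f = g"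
  by (rule over.expand) simp

text \<open>Only the 1-cells are restricted, so closure of the condition on them is all that is needed.\<close>

lemma (in two_category) structured_two_category:
  assumes ob: "\<And>a. a \<in> O' \<Longrightarrow> fst a \<in> Ob X"
    and M_id: "\<And>a. a \<in> O' \<Longrightarrow> M a (id1 X (fst a)) a"
    and M_comp: "\<And>a b c f g. \<lbrakk>a \<in> O'; b \<in> O'; c \<in> O'; f \<in> hom1 X (fst a) (fst b);
          g \<in> hom1 X (fst b) (fst c); M a f b; M b g c\<rbrakk> \<Longrightarrow> M a (g \<odot> f) c"
  shows "two_category (structured X O' M)"
proof -
  let ?Y = "structured X O' M"
  note defs = hom1_def hom2_def cells_def structured_Ar structured_Ce
  show ?thesis
  proof
    show "g \<odot>\<^bsub>?Y\<^esub> f \<in> hom1 ?Y a c"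
      if "f \<in> hom1 ?Y a b" "g \<in> hom1 ?Y b c" for f g a b c
      using that M_comp[of a b c "ocell f" "ocell g"] by (auto simp: defs)
    show "\<beta> \<star>\<^bsub>?Y\<^esub> \<alpha> \<in> hom2 ?Y
        (Src ?Y \<beta> \<odot>\<^bsub>?Y\<^esub> Src ?Y \<alpha>)
        (Tgt ?Y \<beta> \<odot>\<^bsub>?Y\<^esub> Tgt ?Y \<alpha>)"
      if "\<alpha> \<in> cells ?Y a b" "\<beta> \<in> cells ?Y b c" for \<alpha> \<beta> a b c
      using that M_comp[of a b c "Src X (ocell \<alpha>)" "Src X (ocell \<beta>)"]
        M_comp[of a b c "Tgt X (ocell \<alpha>)" "Tgt X (ocell \<beta>)"] by (auto simp: defs)
    show "(\<gamma> \<star>\<^bsub>?Y\<^esub> \<beta>) \<star>\<^bsub>?Y\<^esub> \<alpha> = \<gamma> \<star>\<^bsub>?Y\<^esub> (\<beta> \<star>\<^bsub>?Y\<^esub> \<alpha>)"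
      if "\<alpha> \<in> cells ?Y a b" "\<beta> \<in> cells ?Y b c"
        "\<gamma> \<in> cells ?Y c d" for \<alpha> \<beta> \<gamma> a b c d
      using that by (auto simp: defs hcmp_assoc')
    show "(\<beta>' \<bullet>\<^bsub>?Y\<^esub> \<beta>) \<star>\<^bsub>?Y\<^esub> (\<alpha>' \<bullet>\<^bsub>?Y\<^esub> \<alpha>) =
        (\<beta>' \<star>\<^bsub>?Y\<^esub> \<alpha>') \<bullet>\<^bsub>?Y\<^esub> (\<beta> \<star>\<^bsub>?Y\<^esub> \<alpha>)"
      if "\<alpha> \<in> cells ?Y a b" "\<alpha>' \<in> cells ?Y a b"
        "Tgt ?Y \<alpha> = Src ?Y \<alpha>'"
        "\<beta> \<in> cells ?Y b c" "\<beta>' \<in> cells ?Y b c"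
        "Tgt ?Y \<beta> = Src ?Y \<beta>'" for \<alpha> \<alpha>' \<beta> \<beta>' a b c
    proof -
      have c: "ocell \<gamma> \<in> cells X (fst x) (fst y)" if "\<gamma> \<in> cells ?Y x y" for \<gamma> x y
        using that by (auto simp: defs)
      have "(ocell \<beta>' \<bullet> ocell \<beta>) \<star> (ocell \<alpha>' \<bullet> ocell \<alpha>) =
          (ocell \<beta>' \<star> ocell \<alpha>') \<bullet> (ocell \<beta> \<star> ocell \<alpha>)"
        using interchange[OF c[OF that(1)] c[OF that(2)] _ c[OF that(4)] c[OF that(5)]] that(3,6)
        by simp
      then show ?thesis by simp
    qed
  qed (auto simp: defs ob M_id whisker_id1[unfolded lwhisker_def rwhisker_def] intro!: over_eqI)
qed

text \<open>The extra structures on both sides need not have the same shape; a bijection between them that lies over the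
isomorphism and matches the conditions on 1-cells is enough.\<close>

lemma (in two_category_iso) structured_iso:
  assumes X': "two_category (structured X O\<^sub>X M\<^sub>X)"
    and H: "bij_betw H O\<^sub>X O\<^sub>Y"
    and H_fst: "\<And>a. a \<in> O\<^sub>X \<Longrightarrow> fst a \<in> Ob X \<and> fst (H a) = G\<^sub>0 (fst a)"
    and H_M: "\<And>a f b. \<lbrakk>a \<in> O\<^sub>X; b \<in> O\<^sub>X; f \<in> hom1 X (fst a) (fst b)\<rbrakk>
          \<Longrightarrow> M\<^sub>Y (H a) (G\<^sub>1 f) (H b) \<longleftrightarrow> M\<^sub>X a f b"
  shows "two_category_iso (structured X O\<^sub>X M\<^sub>X) (structured Y O\<^sub>Y M\<^sub>Y) H
    (\<lambda>f. Over (H (odom f)) (G\<^sub>1 (ocell f)) (H (ocod f)))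
    (\<lambda>c. Over (H (odom c)) (G\<^sub>2 (ocell c)) (H (ocod c)))"
    (is "two_category_iso ?X ?Y H ?G1 ?G2")
proof -
  note defs = hom1_def hom2_def cells_def structured_Ar structured_Ce
  have Hm [simp]: "\<And>a. a \<in> O\<^sub>X \<Longrightarrow> H a \<in> O\<^sub>Y" using H by (auto simp: bij_betw_def)
  have Hi [simp]: "\<And>a b. a \<in> O\<^sub>X \<Longrightarrow> b \<in> O\<^sub>X \<Longrightarrow> H a = H b \<longleftrightarrow> a = b"
    using H by (auto simp: bij_betw_def inj_on_def)
  have Hs: "\<And>b. b \<in> O\<^sub>Y \<Longrightarrow> \<exists>a\<in>O\<^sub>X. b = H a" using H by (auto simp: bij_betw_def)
  have Hf [simp]: "\<And>a. a \<in> O\<^sub>X \<Longrightarrow> fst a \<in> Ob X" "\<And>a. a \<in> O\<^sub>X \<Longrightarrow> fst (H a) = G\<^sub>0 (fst a)"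
    using H_fst by auto
  have A: "bij_betw ?G1 (Ar ?X) (Ar ?Y)"
    unfolding bij_betw_def
  proof (intro conjI equalityI subsetI)
    show "inj_on ?G1 (Ar ?X)" by (auto simp: inj_on_def defs intro!: over_eqI)
    show "g \<in> Ar ?Y" if "g \<in> ?G1 ` Ar ?X" for g
      using that by (auto simp: defs H_M)
    fix g assume g: "g \<in> Ar ?Y"
    then obtain a b f where ab: "a \<in> O\<^sub>X" "b \<in> O\<^sub>X" "odom g = H a" "ocod g = H b"
      and f: "f \<in> Ar X" "ocell g = G\<^sub>1 f"
      by (auto simp: defs dest!: Hs G_surj(2))
    have "g = ?G1 (Over a f b)" using ab f by (intro over_eqI) auto
    moreover have "Over a f b \<in> Ar ?X" using ab f g H_M[of a b f] by (auto simp: defs)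
    ultimately show "g \<in> ?G1 ` Ar ?X" by blast
  qed
  have B: "bij_betw ?G2 (Ce ?X) (Ce ?Y)"
    unfolding bij_betw_def
  proof (intro conjI equalityI subsetI)
    show "inj_on ?G2 (Ce ?X)" by (auto simp: inj_on_def defs intro!: over_eqI)
    show "g \<in> Ce ?Y" if "g \<in> ?G2 ` Ce ?X" for g
      using that by (auto simp: defs H_M)
    fix g assume g: "g \<in> Ce ?Y"
    then obtain a b f where ab: "a \<in> O\<^sub>X" "b \<in> O\<^sub>X" "odom g = H a" "ocod g = H b"
      and f: "f \<in> Ce X" "ocell g = G\<^sub>2 f"
      by (auto simp: defs dest!: Hs G_surj(3))
    have "g = ?G2 (Over a f b)" using ab f by (intro over_eqI) auto
    moreover have "Over a f b \<in> Ce ?X"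
      using ab f g H_M[of a b "Src X f"] H_M[of a b "Tgt X f"] by (auto simp: defs)
    ultimately show "g \<in> ?G2 ` Ce ?X" by blast
  qed
  show ?thesis
    by (intro two_category_iso.intro two_category_iso_axioms.intro X')
      (use A B H in \<open>auto simp: defs\<close>)
qed


section \<open>The 2-categories of spans\<close>

lemma dSpan_lax_sel [simp]:
  "Ob (dSpan_lax K D B C) = left_displayed_spans K D B C"
  "Ar (dSpan_lax K D B C) = lax_span_maps K D B C"
  "Ce (dSpan_lax K D B C) = span_cells K D B C"
  "Dom (dSpan_lax K D B C) = mdom" "Cod (dSpan_lax K D B C) = mcod"
  "Src (dSpan_lax K D B C) = csrc" "Tgt (dSpan_lax K D B C) = ctgt"
  "id1 (dSpan_lax K D B C) = span_maps_id K"
  "cmp1 (dSpan_lax K D B C) = span_maps_comp K"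
  "id2 (dSpan_lax K D B C) s = SpanCell s (id2 K (und s)) s"
  "b \<bullet>\<^bsub>dSpan_lax K D B C\<^esub> a = SpanCell (csrc a) (cund b \<bullet>\<^bsub>K\<^esub> cund a) (ctgt b)"
  "b \<star>\<^bsub>dSpan_lax K D B C\<^esub> a = SpanCell (span_maps_comp K (csrc b) (csrc a)) (cund b \<star>\<^bsub>K\<^esub> cund a)
     (span_maps_comp K (ctgt b) (ctgt a))"
  by (simp_all add: dSpan_lax_def)

lemma dSpan_sel [simp]:
  "Ob (dSpan K D B C) = left_displayed_spans K D B C"
  "Ar (dSpan K D B C) = strict_span_maps K D B C"
  "Ce (dSpan K D B C) = {c \<in> span_cells K D B C.
     csrc c \<in> strict_span_maps K D B C \<and> ctgt c \<in> strict_span_maps K D B C}"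
  "Dom (dSpan K D B C) = mdom" "Cod (dSpan K D B C) = mcod"
  "Src (dSpan K D B C) = csrc" "Tgt (dSpan K D B C) = ctgt"
  "id1 (dSpan K D B C) = span_maps_id K"
  "cmp1 (dSpan K D B C) = span_maps_comp K"
  "id2 (dSpan K D B C) s = SpanCell s (id2 K (und s)) s"
  "b \<bullet>\<^bsub>dSpan K D B C\<^esub> a = SpanCell (csrc a) (cund b \<bullet>\<^bsub>K\<^esub> cund a) (ctgt b)"
  "b \<star>\<^bsub>dSpan K D B C\<^esub> a = SpanCell (span_maps_comp K (csrc b) (csrc a)) (cund b \<star>\<^bsub>K\<^esub> cund a)
     (span_maps_comp K (ctgt b) (ctgt a))"
  by (simp_all add: dSpan_def dSpan_lax_def)

lemma span_maps_id_sel [simp]: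
  "mdom (span_maps_id K S) = S" "mcod (span_maps_id K S) = S"
  "und (span_maps_id K S) = id1 K (apex S)" "phi (span_maps_id K S) = id2 K (rleg S)"
  by (simp_all add: span_maps_id_def)

lemma span_maps_comp_sel [simp]:
  "mdom (span_maps_comp K t s) = mdom s" "mcod (span_maps_comp K t s) = mcod t"
  "und (span_maps_comp K t s) = und t \<odot>\<^bsub>K\<^esub> und s"
  "phi (span_maps_comp K t s) = phi s \<bullet>\<^bsub>K\<^esub> (phi t \<triangleright>\<^bsub>K\<^esub> und s)"
  by (simp_all add: span_maps_comp_def)

lemma span_map_eqI:
  "\<lbrakk>mdom s = mdom t; und s = und t; phi s = phi t; mcod s = mcod t\<rbrakk> \<Longrightarrow> s = t"
  by (rule span_map.expand) simp

lemma span_cell_eqI: "\<lbrakk>csrc a = csrc b; cund a = cund b; ctgt a = ctgt b\<rbrakk> \<Longrightarrow> a = b"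
  by (rule span_cell.expand) simp

locale displayed_two_category = two_category K for K :: "('o, 'm, 'c) two_cat" (structure) +
  fixes D :: "'m set"
begin

abbreviation "lds \<equiv> left_displayed_spans K D"
abbreviation "lax_maps \<equiv> lax_span_maps K D"
abbreviation "strict_maps \<equiv> strict_span_maps K D"
abbreviation "lax_cells \<equiv> span_cells K D"
abbreviation "id_map \<equiv> span_maps_id K"
abbreviation "comp_map \<equiv> span_maps_comp K"

lemma lds_iff:
  "S \<in> lds B C \<longleftrightarrow> lleg S \<in> D \<and> lleg S \<in> Ar K \<and> Dom K (lleg S) = apex S \<and>
     Cod K (lleg S) = B \<and> rleg S \<in> Ar K \<and> Dom K (rleg S) = apex S \<and> Cod K (rleg S) = C"
  by (auto simp: left_displayed_spans_def hom1_iff)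

lemma ldsD [simp]:
  assumes "S \<in> lds B C"
  shows "lleg S \<in> Ar K" "Dom K (lleg S) = apex S" "Cod K (lleg S) = B"
    "rleg S \<in> Ar K" "Dom K (rleg S) = apex S" "Cod K (rleg S) = C" "apex S \<in> Ob K" "lleg S \<in> D"
  using assms Dom_closed[of "lleg S"] by (auto simp: lds_iff)

lemma lax_iff:
  "s \<in> lax_maps B C \<longleftrightarrow>
     mdom s \<in> lds B C \<and> mcod s \<in> lds B C \<and>
     und s \<in> Ar K \<and> Dom K (und s) = apex (mdom s) \<and> Cod K (und s) = apex (mcod s) \<and>
     lleg (mcod s) \<odot> und s = lleg (mdom s) \<and>
     phi s \<in> Ce K \<and> Src K (phi s) = rleg (mcod s) \<odot> und s \<and> Tgt K (phi s) = rleg (mdom s)"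
  by (auto simp: lax_span_maps_def hom1_iff hom2_iff)

lemma laxD:
  assumes "s \<in> lax_maps B C"
  shows "mdom s \<in> lds B C" "mcod s \<in> lds B C"
    "und s \<in> Ar K" "Dom K (und s) = apex (mdom s)" "Cod K (und s) = apex (mcod s)"
    "lleg (mcod s) \<odot> und s = lleg (mdom s)"
    "phi s \<in> Ce K" "Src K (phi s) = rleg (mcod s) \<odot> und s" "Tgt K (phi s) = rleg (mdom s)"
  using assms by (auto simp: lax_iff)

lemma strict_iff:
  "s \<in> strict_maps B C \<longleftrightarrow>
     mdom s \<in> lds B C \<and> mcod s \<in> lds B C \<and>
     und s \<in> Ar K \<and> Dom K (und s) = apex (mdom s) \<and> Cod K (und s) = apex (mcod s) \<and>
     lleg (mcod s) \<odot> und s = lleg (mdom s) \<and> rleg (mcod s) \<odot> und s = rleg (mdom s) \<and>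
     phi s = id2 K (rleg (mdom s))"
  by (auto simp: strict_span_maps_def lax_iff)

lemma span_cells_iff:
  "c \<in> lax_cells B C \<longleftrightarrow> csrc c \<in> lax_maps B C \<and> ctgt c \<in> lax_maps B C \<and>
     mdom (csrc c) = mdom (ctgt c) \<and> mcod (csrc c) = mcod (ctgt c) \<and>
     cund c \<in> Ce K \<and> Src K (cund c) = und (csrc c) \<and> Tgt K (cund c) = und (ctgt c) \<and>
     lleg (mcod (ctgt c)) \<triangleleft> cund c = id2 K (lleg (mdom (ctgt c))) \<and>
     phi (ctgt c) \<bullet> (rleg (mcod (ctgt c)) \<triangleleft> cund c) = phi (csrc c)"
  by (auto simp: span_cells_def hom2_iff)

lemma span_cellsD:
  assumes "c \<in> lax_cells B C"
  shows "csrc c \<in> lax_maps B C" "ctgt c \<in> lax_maps B C"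
    "mdom (csrc c) = mdom (ctgt c)" "mcod (csrc c) = mcod (ctgt c)"
    "cund c \<in> Ce K" "Src K (cund c) = und (csrc c)" "Tgt K (cund c) = und (ctgt c)"
    "lleg (mcod (ctgt c)) \<triangleleft> cund c = id2 K (lleg (mdom (ctgt c)))"
    "phi (ctgt c) \<bullet> (rleg (mcod (ctgt c)) \<triangleleft> cund c) = phi (csrc c)"
  using assms by (auto simp: span_cells_iff)

lemma lax_comp:
  assumes "s \<in> lax_maps B C" "t \<in> lax_maps B C" "mcod s = mdom t"
  shows "comp_map t s \<in> lax_maps B C"
  using assms cmp1_fuse[of "lleg (mcod t)" "und t" "lleg (mdom t)" "und s"]
  by (auto simp: lax_iff)

lemma lax_id: "S \<in> lds B C \<Longrightarrow> id_map S \<in> lax_maps B C"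
  by (auto simp: lax_iff)

lemma lax_assoc:
  assumes "s \<in> lax_maps B C" "t \<in> lax_maps B C" "r \<in> lax_maps B C"
    "mcod s = mdom t" "mcod t = mdom r"
  shows "comp_map (comp_map r t) s = comp_map r (comp_map t s)"
  using assms by (intro span_map_eqI) (auto simp: lax_iff collect_whiskers)

lemma cells_vcomp:
  assumes "a \<in> lax_cells B C" "b \<in> lax_cells B C" "ctgt a = csrc b"
  shows "SpanCell (csrc a) (cund b \<bullet> cund a) (ctgt b) \<in> lax_cells B C"
proof -
  have "phi (ctgt b) \<bullet> ((rleg (mcod (ctgt b)) \<triangleleft> cund b) \<bullet> (rleg (mcod (ctgt b)) \<triangleleft> cund a))
      = phi (csrc b) \<bullet> (rleg (mcod (ctgt b)) \<triangleleft> cund a)"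
    by (rule vcmp_fuse) (use assms in \<open>auto simp: span_cells_iff lax_iff\<close>)
  with assms show ?thesis by (auto simp: span_cells_iff lax_iff lwhisker_vcmp)
qed

text \<open>For the composite of \<open>\<alpha> : s \<Rightarrow> s'\<close> and \<open>\<beta> : t \<Rightarrow> t'\<close>, the condition for \<open>\<beta>\<close> turns the 2-cell of \<open>t'\<close> into that of \<open>t\<close>, which
then slides past \<open>\<alpha>\<close> and leaves the condition for \<open>\<alpha>\<close>.\<close>

lemma cells_hcomp:
  assumes a: "a \<in> lax_cells B C" and b: "b \<in> lax_cells B C"
    and ab: "mcod (csrc a) = mdom (csrc b)"
  shows "SpanCell (comp_map (csrc b) (csrc a)) (cund b \<star> cund a)
     (comp_map (ctgt b) (ctgt a)) \<in> lax_cells B C"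
proof -
  let ?s = "csrc a" and ?s' = "ctgt a" and ?t = "csrc b" and ?t' = "ctgt b"
  let ?\<alpha> = "cund a" and ?\<beta> = "cund b"
  have st: "?s \<in> lax_maps B C" "?s' \<in> lax_maps B C"
    "?t \<in> lax_maps B C" "?t' \<in> lax_maps B C"
    using a b by (auto simp: span_cells_iff)
  have mm: "mdom ?s = mdom ?s'" "mdom ?t = mcod ?s'" "mcod ?s = mcod ?s'" "mdom ?t' = mcod ?s'"
    "mcod ?t = mcod ?t'"
    using a b ab by (auto simp: span_cells_iff)
  note T = st[THEN laxD(1), unfolded mm] st[THEN laxD(2), unfolded mm] st[THEN laxD(3), unfolded mm]
    st[THEN laxD(4), unfolded mm] st[THEN laxD(5), unfolded mm] st[THEN laxD(6), unfolded mm]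
    st[THEN laxD(7), unfolded mm] st[THEN laxD(8), unfolded mm] st[THEN laxD(9), unfolded mm]
  have A: "?\<alpha> \<in> Ce K" "Src K ?\<alpha> = und ?s" "Tgt K ?\<alpha> = und ?s'"
    "lleg (mcod ?s') \<triangleleft> ?\<alpha> = id2 K (lleg (mdom ?s'))" "phi ?s' \<bullet> (rleg (mcod ?s') \<triangleleft> ?\<alpha>) = phi ?s"
    using a by (auto simp: span_cells_iff)
  have B: "?\<beta> \<in> Ce K" "Src K ?\<beta> = und ?t" "Tgt K ?\<beta> = und ?t'"
    "lleg (mcod ?t') \<triangleleft> ?\<beta> = id2 K (lleg (mcod ?s'))" "phi ?t' \<bullet> (rleg (mcod ?t') \<triangleleft> ?\<beta>) = phi ?t"
    using b mm by (auto simp: span_cells_iff)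
  have bR: "rleg (mcod ?t') \<triangleleft> (?\<beta> \<star> ?\<alpha>) =
      ((rleg (mcod ?t') \<triangleleft> ?\<beta>) \<triangleright> und ?s') \<bullet> (rleg (mcod ?t') \<triangleleft> (und ?t \<triangleleft> ?\<alpha>))"
    using T A(1-3) B(1-3) by (simp add: hcmp_whisker(1) collect_whiskers)
  have bL: "lleg (mcod ?t') \<triangleleft> (?\<beta> \<star> ?\<alpha>) =
      ((lleg (mcod ?t') \<triangleleft> ?\<beta>) \<triangleright> und ?s') \<bullet> (lleg (mcod ?t') \<triangleleft> (und ?t \<triangleleft> ?\<alpha>))"
    using T A(1-3) B(1-3) by (simp add: hcmp_whisker(1) collect_whiskers)
  have L: "lleg (mcod ?t') \<triangleleft> (?\<beta> \<star> ?\<alpha>) = id2 K (lleg (mdom ?s'))"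
    unfolding bL using T A B by (simp add: lwhisker_lwhisker)
  define x where "x = phi ?t' \<triangleright> und ?s'"
  define y where "y = (rleg (mcod ?t') \<triangleleft> ?\<beta>) \<triangleright> und ?s'"
  define z where "z = rleg (mcod ?t') \<triangleleft> (und ?t \<triangleleft> ?\<alpha>)"
  define x' where "x' = phi ?t \<triangleright> und ?s'"
  have "x \<bullet> y = x'"
    using T A(1-3) B unfolding x_def y_def x'_def by (simp add: rwhisker_vcmp[symmetric])
  then have 1: "x \<bullet> (y \<bullet> z) = x' \<bullet> z"
    by (rule vcmp_fuse) (use T A(1-3) B(1-3) in \<open>simp_all add: x_def y_def z_def x'_def\<close>)
  have 2: "x' \<bullet> z = (rleg (mcod ?s') \<triangleleft> ?\<alpha>) \<bullet> (phi ?t \<triangleright> und ?s)"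
    using slide[of ?\<alpha> "phi ?t"] T A(1-3) unfolding x'_def z_def by (simp add: lwhisker_lwhisker)
  have 3: "phi ?s' \<bullet> ((rleg (mcod ?s') \<triangleleft> ?\<alpha>) \<bullet> (phi ?t \<triangleright> und ?s)) = phi ?s \<bullet> (phi ?t \<triangleright> und ?s)"
    by (rule vcmp_fuse) (use T A in simp_all)
  have R: "phi (comp_map ?t' ?s') \<bullet> (rleg (mcod ?t') \<triangleleft> (?\<beta> \<star> ?\<alpha>))
      = phi (comp_map ?t ?s)"
    unfolding bR using T A(1-3) B(1-3) 1 2 3 unfolding x_def y_def z_def by simp
  show ?thesis
    using L R st mm A B lax_comp[OF st(1,3)] lax_comp[OF st(2,4)]
    by (simp add: span_cells_iff lax_iff)
qed

lemma cells_dSpan_laxD: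
  assumes "\<gamma> \<in> cells (dSpan_lax K D B C) a b"
  shows "\<gamma> \<in> lax_cells B C" "csrc \<gamma> \<in> lax_maps B C" "ctgt \<gamma> \<in> lax_maps B C"
    "mdom (csrc \<gamma>) = a" "mcod (csrc \<gamma>) = b" "mdom (ctgt \<gamma>) = a" "mcod (ctgt \<gamma>) = b"
    "cund \<gamma> \<in> cells K (apex a) (apex b)"
  using assms laxD(4,5)[of "csrc \<gamma>" B C] span_cellsD(5,6)[of \<gamma> B C]
  by (auto simp: cells_iff cells_def[of "dSpan_lax K D B C"] hom1_def)

lemma dSpan_lax_two_category: "two_category (dSpan_lax K D B C)"
proof
  let ?L = "dSpan_lax K D B C"
  note defs = hom1_def hom2_def
  note c = cells_dSpan_laxD
  show "g \<odot>\<^bsub>?L\<^esub> f \<in> hom1 ?L a c" if "f \<in> hom1 ?L a b" "g \<in> hom1 ?L b c" for f g a b c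
    using that lax_comp[of f B C g] by (auto simp: defs)
  show "(h \<odot>\<^bsub>?L\<^esub> g) \<odot>\<^bsub>?L\<^esub> f = h \<odot>\<^bsub>?L\<^esub> (g \<odot>\<^bsub>?L\<^esub> f)"
    if "f \<in> hom1 ?L a b" "g \<in> hom1 ?L b c" "h \<in> hom1 ?L c d" for f g h a b c d
    using that by (auto simp: defs intro: lax_assoc)
  show "f \<odot>\<^bsub>?L\<^esub> id1 ?L a = f" "id1 ?L b \<odot>\<^bsub>?L\<^esub> f = f" if "f \<in> hom1 ?L a b" for f a b
    using that laxD[of f B C] by (auto simp: defs intro!: span_map_eqI)
  show "\<beta> \<bullet>\<^bsub>?L\<^esub> \<alpha> \<in> hom2 ?L f h" if "\<alpha> \<in> hom2 ?L f g" "\<beta> \<in> hom2 ?L g h" for \<alpha> \<beta> f g h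
    using that cells_vcomp[of \<alpha> B C \<beta>] by (auto simp: defs)
  show "\<beta> \<star>\<^bsub>?L\<^esub> \<alpha> \<in> hom2 ?L (Src ?L \<beta> \<odot>\<^bsub>?L\<^esub> Src ?L \<alpha>) (Tgt ?L \<beta> \<odot>\<^bsub>?L\<^esub> Tgt ?L \<alpha>)"
    if "\<alpha> \<in> cells ?L a b" "\<beta> \<in> cells ?L b c" for \<alpha> \<beta> a b c
    using cells_hcomp[OF c(1)[OF that(1)] c(1)[OF that(2)]] c(5)[OF that(1)] c(4)[OF that(2)]
    by (simp add: defs)
  show "\<alpha> \<star>\<^bsub>?L\<^esub> id2 ?L (id1 ?L a) = \<alpha>" "id2 ?L (id1 ?L b) \<star>\<^bsub>?L\<^esub> \<alpha> = \<alpha>" if "\<alpha> \<in> cells ?L a b" for \<alpha> a b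
    using c[OF that] laxD[OF c(2)[OF that]] laxD[OF c(3)[OF that]]
      hcmp_id_right[OF c(8)[OF that]] hcmp_id_left[OF c(8)[OF that]]
    by (auto intro!: span_cell_eqI span_map_eqI)
  show "(\<gamma> \<star>\<^bsub>?L\<^esub> \<beta>) \<star>\<^bsub>?L\<^esub> \<alpha> = \<gamma> \<star>\<^bsub>?L\<^esub> (\<beta> \<star>\<^bsub>?L\<^esub> \<alpha>)"
    if "\<alpha> \<in> cells ?L a b" "\<beta> \<in> cells ?L b c" "\<gamma> \<in> cells ?L c d" for \<alpha> \<beta> \<gamma> a b c d
    using c[OF that(1)] c[OF that(2)] c[OF that(3)]
      lax_assoc[OF c(2)[OF that(1)] c(2)[OF that(2)] c(2)[OF that(3)]]
      lax_assoc[OF c(3)[OF that(1)] c(3)[OF that(2)] c(3)[OF that(3)]]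
      hcmp_assoc[OF c(8)[OF that(1)] c(8)[OF that(2)] c(8)[OF that(3)]]
    by simp
  show "id2 ?L g \<star>\<^bsub>?L\<^esub> id2 ?L f = id2 ?L (g \<odot>\<^bsub>?L\<^esub> f)" if "f \<in> hom1 ?L a b" "g \<in> hom1 ?L b c" for f g a b c
    using that laxD[of f B C] laxD[of g B C] by (auto simp: defs)
  show "(\<beta>' \<bullet>\<^bsub>?L\<^esub> \<beta>) \<star>\<^bsub>?L\<^esub> (\<alpha>' \<bullet>\<^bsub>?L\<^esub> \<alpha>) = (\<beta>' \<star>\<^bsub>?L\<^esub> \<alpha>') \<bullet>\<^bsub>?L\<^esub> (\<beta> \<star>\<^bsub>?L\<^esub> \<alpha>)"
    if "\<alpha> \<in> cells ?L a b" "\<alpha>' \<in> cells ?L a b" "Tgt ?L \<alpha> = Src ?L \<alpha>'"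
      "\<beta> \<in> cells ?L b c" "\<beta>' \<in> cells ?L b c" "Tgt ?L \<beta> = Src ?L \<beta>'" for \<alpha> \<alpha>' \<beta> \<beta>' a b c
  proof -
    have t: "Tgt K (cund \<gamma>) = Src K (cund \<gamma>')"
      if "\<gamma> \<in> cells ?L x y" "\<gamma>' \<in> cells ?L x y" "Tgt ?L \<gamma> = Src ?L \<gamma>'" for \<gamma> \<gamma>' x y
      using that(3) span_cellsD(6)[OF c(1)[OF that(2)]] span_cellsD(7)[OF c(1)[OF that(1)]] by simp
    have "(cund \<beta>' \<bullet> cund \<beta>) \<star> (cund \<alpha>' \<bullet> cund \<alpha>) = (cund \<beta>' \<star> cund \<alpha>') \<bullet> (cund \<beta> \<star> cund \<alpha>)"
      using interchange[OF c(8)[OF that(1)] c(8)[OF that(2)] t[OF that(1-3)]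
          c(8)[OF that(4)] c(8)[OF that(5)] t[OF that(4-6)]] .
    then show ?thesis by simp
  qed
  show "Src ?L \<alpha> \<in> Ar ?L" "Tgt ?L \<alpha> \<in> Ar ?L" "Dom ?L (Tgt ?L \<alpha>) = Dom ?L (Src ?L \<alpha>)"
    "Cod ?L (Tgt ?L \<alpha>) = Cod ?L (Src ?L \<alpha>)" if "\<alpha> \<in> Ce ?L" for \<alpha>
    using that span_cellsD[of \<alpha> B C] by auto
  show "\<alpha> \<bullet>\<^bsub>?L\<^esub> id2 ?L f = \<alpha>" "id2 ?L g \<bullet>\<^bsub>?L\<^esub> \<alpha> = \<alpha>" if "\<alpha> \<in> hom2 ?L f g" for \<alpha> f g
    using that span_cellsD(5-7)[of \<alpha> B C] by (auto simp: defs intro!: span_cell_eqI)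
  show "id2 ?L f \<in> hom2 ?L f f" if "f \<in> Ar ?L" for f
    using that laxD[of f B C] by (auto simp: defs span_cells_iff)
  show "(\<gamma> \<bullet>\<^bsub>?L\<^esub> \<beta>) \<bullet>\<^bsub>?L\<^esub> \<alpha> = \<gamma> \<bullet>\<^bsub>?L\<^esub> (\<beta> \<bullet>\<^bsub>?L\<^esub> \<alpha>)"
    if "\<alpha> \<in> hom2 ?L f g" "\<beta> \<in> hom2 ?L g h" "\<gamma> \<in> hom2 ?L h k" for \<alpha> \<beta> \<gamma> f g h k
    using that span_cellsD(5-7)[of \<alpha> B C] span_cellsD(5-7)[of \<beta> B C] span_cellsD(5-7)[of \<gamma> B C]
    by (auto simp: defs)
qed (auto simp: hom1_def lax_id laxD)

text \<open>The inverse of a vertical cell is vertical, and composing the condition on the 2-cells of the span maps with an inverse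
gives the same condition for the inverse.\<close>

lemma span_iso2_iff:
  assumes "c \<in> lax_cells B C"
  shows "iso2 (dSpan_lax K D B C) c \<longleftrightarrow> iso2 K (cund c)"
proof
  interpret L: two_category "dSpan_lax K D B C" by (rule dSpan_lax_two_category)
  assume "iso2 (dSpan_lax K D B C) c"
  then obtain b where b: "b \<in> lax_cells B C" "csrc b = ctgt c" "ctgt b = csrc c"
    "cund b \<bullet> cund c = id2 K (und (csrc c))" "cund c \<bullet> cund b = id2 K (und (ctgt c))"
    by (rule L.iso2E) auto
  with assms show "iso2 K (cund c)"
    by (intro iso2I[of _ "cund b"]) (auto simp: span_cells_iff)
next
  interpret L: two_category "dSpan_lax K D B C" by (rule dSpan_lax_two_category)
  assume "iso2 K (cund c)"
  then obtain \<beta> where \<beta>: "\<beta> \<in> Ce K" "Src K \<beta> = Tgt K (cund c)" "Tgt K \<beta> = Src K (cund c)"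
    "\<beta> \<bullet> cund c = id2 K (Src K (cund c))" "cund c \<bullet> \<beta> = id2 K (Tgt K (cund c))"
    by (rule iso2E)
  note c = span_cellsD[OF assms] laxD[OF span_cellsD(1)[OF assms]] laxD[OF span_cellsD(2)[OF assms]]
  have "lleg (mcod (ctgt c)) \<triangleleft> (cund c \<bullet> \<beta>) = lleg (mcod (ctgt c)) \<triangleleft> id2 K (Tgt K (cund c))"
    using \<beta> by simp
  then have l: "lleg (mcod (ctgt c)) \<triangleleft> \<beta> = id2 K (lleg (mdom (ctgt c)))"
    using c \<beta>(1-3) by (simp add: lwhisker_vcmp)
  have "(rleg (mcod (ctgt c)) \<triangleleft> cund c) \<bullet> (rleg (mcod (ctgt c)) \<triangleleft> \<beta>) =
      id2 K (rleg (mcod (ctgt c)) \<odot> und (ctgt c))"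
    using c \<beta> by (simp add: lwhisker_vcmp[symmetric])
  then have r: "phi (csrc c) \<bullet> (rleg (mcod (ctgt c)) \<triangleleft> \<beta>) = phi (ctgt c)"
    using c \<beta>(1-3) vcmp_assoc'[of "rleg (mcod (ctgt c)) \<triangleleft> \<beta>" "rleg (mcod (ctgt c)) \<triangleleft> cund c" "phi (ctgt c)"]
    by simp
  have "SpanCell (ctgt c) \<beta> (csrc c) \<in> lax_cells B C"
    using c \<beta>(1-3) l r by (auto simp: span_cells_iff lax_iff)
  then show "iso2 (dSpan_lax K D B C) c"
    using assms \<beta> by (intro L.iso2I[of _ "SpanCell (ctgt c) \<beta> (csrc c)"]) (auto simp: span_cells_iff)
qed

end


section \<open>Composition of spans\<close>

locale paradise_choice = displayed_two_category K D
  for K :: "('o, 'm, 'c) two_cat" (structure) and D +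
  fixes pb :: "'m \<Rightarrow> 'm \<Rightarrow> 'm \<times> 'm" and ar :: "'o \<Rightarrow> 'm \<times> 'm \<times> 'c"
  assumes paradise: "paradise K D"
    and chosen_pb: "chosen_pullbacks K D pb"
    and chosen_ar: "chosen_arrow_objects K ar"
begin

abbreviation "d0 c \<equiv> fst (ar c)"
abbreviation "d1 c \<equiv> fst (snd (ar c))"
abbreviation "chi c \<equiv> snd (snd (ar c))"
abbreviation "arr c \<equiv> arrow_span K ar c"
abbreviation "pl S R \<equiv> fst (span_pb pb S R)"
abbreviation "pr S R \<equiv> snd (span_pb pb S R)"
abbreviation "tup S R \<equiv> tup1 K (span_pb pb S R)"
abbreviation "named c \<equiv> arrow_name K (ar c)"
abbreviation "comp1 \<equiv> span_comp1 K pb"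
abbreviation "unit_map \<equiv> arrow_unit K ar"
abbreviation "mult_map \<equiv> arrow_mult K pb ar"
abbreviation "pre \<equiv> pre_arrow K pb ar"
abbreviation "post \<equiv> post_arrow K pb ar"
abbreviation "idn S \<equiv> id_name K pb ar (lleg S)"
abbreviation "comma S R \<equiv> comma_map K pb ar (lleg S) (lleg R)"
abbreviation "fib S \<equiv> fibration K D pb ar (lleg S)"
abbreviation "cart S st R st' \<equiv> cartesian K pb ar (lleg S) st (lleg R) st'"
abbreviation compose_spans (infixl "\<otimes>" 75) where "S \<otimes> R \<equiv> span_comp K pb S R"

lemma display: "display_map_two_category K D"
  using paradise by (simp add: paradise_def)

lemma D_Ar [simp]: "d \<in> D \<Longrightarrow> d \<in> Ar K"
  using display by (auto simp: display_map_two_category_def)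

lemma D_comp: "\<lbrakk>d \<in> D; e \<in> D; Cod K d = Dom K e\<rbrakk> \<Longrightarrow> e \<odot> d \<in> D"
  using paradise by (auto simp: paradise_def)

lemma D_iso: "iso1 K f \<Longrightarrow> f \<in> D"
  using paradise by (auto simp: paradise_def)

lemma pb_pullback:
  "\<lbrakk>d \<in> D; f \<in> Ar K; Cod K f = Cod K d\<rbrakk> \<Longrightarrow> is_pullback K f d (fst (pb f d)) (snd (pb f d))"
  using chosen_pb by (auto simp: chosen_pullbacks_def)

text \<open>The chosen pullback is only known to be some pullback, and displayed maps are only known to have some displayed pullback;
the two are isomorphic.\<close>

lemma pb_displayed:
  assumes "d \<in> D" "f \<in> Ar K" "Cod K f = Cod K d"
  shows "fst (pb f d) \<in> D"
proof -
  obtain u v where uv: "is_pullback K f d u v" "u \<in> D"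
    using display assms unfolding display_map_two_category_def by blast
  obtain i where "iso1 K i" "Dom K i = Dom K (fst (pb f d))" "Cod K i = Dom K u" "u \<odot> i = fst (pb f d)"
    by (rule pullback_iso1[OF pb_pullback[OF assms] uv(1)])
  then show ?thesis using D_comp[OF D_iso uv(2)] by metis
qed

lemma arrow_object: "c \<in> Ob K \<Longrightarrow> is_arrow_object K c (d0 c, d1 c, chi c)"
  using chosen_ar by (simp add: chosen_arrow_objects_def)

lemma d0_D: "c \<in> Ob K \<Longrightarrow> d0 c \<in> D"
  using paradise arrow_object unfolding paradise_def by blast

lemma arr_simps [simp]:
  assumes "c \<in> Ob K"
  shows "d0 c \<in> Ar K" "Cod K (d0 c) = c" "d1 c \<in> Ar K" "Dom K (d1 c) = Dom K (d0 c)"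
    "Cod K (d1 c) = c" "chi c \<in> Ce K" "Src K (chi c) = d0 c" "Tgt K (chi c) = d1 c"
  using arrow_objectD[OF arrow_object[OF assms]] by auto

lemma arr_sel [simp]:
  "lleg (arr c) = d0 c" "apex (arr c) = Dom K (d0 c)" "rleg (arr c) = d1 c"
  by (simp_all add: arrow_span_def split_beta)

lemma arr_lds [simp]: "c \<in> Ob K \<Longrightarrow> arr c \<in> lds c c"
  by (simp add: lds_iff d0_D del: ldsD)

lemma span_unit_sel [simp]:
  "lleg (span_unit K c) = id1 K c" "apex (span_unit K c) = c" "rleg (span_unit K c) = id1 K c"
  by (simp_all add: span_unit_def)

lemma span_unit_lds [simp]:
  assumes "c \<in> Ob K" shows "span_unit K c \<in> lds c c"
proof -
  have "iso1 K (id1 K c)"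
    unfolding iso1_def using assms by (intro conjI bexI[of _ "id1 K c"]) (simp_all add: hom1_iff)
  then show ?thesis using assms D_iso by (simp add: lds_iff del: ldsD)
qed

lemma span_pullback:
  assumes "S \<in> lds a b" "R \<in> lds b c"
  shows "is_pullback K (rleg S) (lleg R) (pl S R) (pr S R)"
  using pb_pullback[of "lleg R" "rleg S"] ldsD[OF assms(1)] ldsD[OF assms(2)]
  by (simp add: span_pb_def)

lemma span_proj [simp]:
  assumes "S \<in> lds a b" "R \<in> lds b c"
  shows "pl S R \<in> Ar K" "Cod K (pl S R) = apex S" "pr S R \<in> Ar K" "Dom K (pr S R) = Dom K (pl S R)"
    "Cod K (pr S R) = apex R"
  using pullbackD[OF span_pullback[OF assms]] assms by auto

lemma span_square:
  assumes "S \<in> lds a b" "R \<in> lds b c"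
  shows "rleg S \<odot> pl S R = lleg R \<odot> pr S R"
  using pullbackD(9)[OF span_pullback[OF assms]] .

lemma span_comp_sel [simp]:
  "lleg (S \<otimes> R) = lleg S \<odot> pl S R" "apex (S \<otimes> R) = Dom K (pl S R)" "rleg (S \<otimes> R) = rleg R \<odot> pr S R"
  by (simp_all add: span_comp_def split_beta)

lemma span_comp_lds:
  assumes "S \<in> lds a b" "R \<in> lds b c"
  shows "S \<otimes> R \<in> lds a c"
  using pb_displayed[of "lleg R" "rleg S"] D_comp[of "pl S R" "lleg S"]
    ldsD[OF assms(1)] ldsD[OF assms(2)] span_proj[OF assms]
  by (simp add: lds_iff span_pb_def[symmetric] del: ldsD)

lemma tup1_span:
  assumes S: "S \<in> lds a b" and R: "R \<in> lds b c"
    and "x \<in> Ar K" "y \<in> Ar K" "Dom K y = Dom K x" "Cod K x = apex S" "Cod K y = apex R"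
    "rleg S \<odot> x = lleg R \<odot> y"
  shows "tup S R x y \<in> Ar K" "Dom K (tup S R x y) = Dom K x"
    "Cod K (tup S R x y) = Dom K (pl S R)"
    "pl S R \<odot> tup S R x y = x" "pr S R \<odot> tup S R x y = y"
  using pullback_tup1[OF span_pullback[OF S R], of x y] assms by simp_all

lemma tup2_span:
  assumes S: "S \<in> lds a b" and R: "R \<in> lds b c"
    and "\<xi> \<in> Ce K" "\<zeta> \<in> Ce K" "Dom K (Src K \<zeta>) = Dom K (Src K \<xi>)"
      "Cod K (Src K \<xi>) = apex S" "Cod K (Src K \<zeta>) = apex R" "rleg S \<triangleleft> \<xi> = lleg R \<triangleleft> \<zeta>"
  shows "tup2 K (span_pb pb S R) \<xi> \<zeta> \<in> Ce K"
    "pl S R \<triangleleft> tup2 K (span_pb pb S R) \<xi> \<zeta> = \<xi>" "pr S R \<triangleleft> tup2 K (span_pb pb S R) \<xi> \<zeta> = \<zeta>"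
    "Src K (tup2 K (span_pb pb S R) \<xi> \<zeta>) = tup S R (Src K \<xi>) (Src K \<zeta>)"
    "Tgt K (tup2 K (span_pb pb S R) \<xi> \<zeta>) = tup S R (Tgt K \<xi>) (Tgt K \<zeta>)"
  using pullback_tup2[OF span_pullback[OF S R], of \<xi> \<zeta>] assms by simp_all

lemma strictD:
  assumes "s \<in> strict_maps a b"
  shows "mdom s \<in> lds a b" "mcod s \<in> lds a b"
    "und s \<in> Ar K" "Dom K (und s) = apex (mdom s)" "Cod K (und s) = apex (mcod s)"
    "lleg (mcod s) \<odot> und s = lleg (mdom s)" "rleg (mcod s) \<odot> und s = rleg (mdom s)"
    "phi s = id2 K (rleg (mdom s))"
  using assms by (auto simp: strict_iff)

lemma strict_comp:
  assumes "s \<in> strict_maps a b" "t \<in> strict_maps a b" "mcod s = mdom t"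
  shows "comp_map t s \<in> strict_maps a b"
  using strictD[OF assms(1)] strictD[OF assms(2)] assms(3)
    cmp1_fuse[OF strictD(6)[OF assms(2)], of "und s"] cmp1_fuse[OF strictD(7)[OF assms(2)], of "und s"]
  by (simp add: strict_iff)

lemma strict_id: "S \<in> lds a b \<Longrightarrow> id_map S \<in> strict_maps a b"
  by (simp add: strict_iff)

lemma strict_eqI:
  "\<lbrakk>s \<in> strict_maps a b; t \<in> strict_maps a' b'; mdom s = mdom t; mcod s = mcod t;
    und s = und t\<rbrakk> \<Longrightarrow> s = t"
  using strictD(8)[of s a b] strictD(8)[of t a' b'] by (intro span_map_eqI) simp_all

lemma span_comp1_sel [simp]:
  "mdom (comp1 s r) = mdom s \<otimes> mdom r" "mcod (comp1 s r) = mcod s \<otimes> mcod r"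
  "phi (comp1 s r) = id2 K (rleg (mdom s \<otimes> mdom r))"
  "und (comp1 s r) = tup (mcod s) (mcod r)
     (und s \<odot> pl (mdom s) (mdom r)) (und r \<odot> pr (mdom s) (mdom r))"
  by (simp_all add: span_comp1_def split_beta Let_def)

lemma span_comp1:
  assumes s: "s \<in> strict_maps a b" and r: "r \<in> strict_maps b c"
  shows "comp1 s r \<in> strict_maps a c"
    "pl (mcod s) (mcod r) \<odot> und (comp1 s r) = und s \<odot> pl (mdom s) (mdom r)"
    "pr (mcod s) (mcod r) \<odot> und (comp1 s r) = und r \<odot> pr (mdom s) (mdom r)"
proof -
  note s' = strictD[OF s] and r' = strictD[OF r]
  note sq = span_square[OF s'(1) r'(1)]
  have "rleg (mcod s) \<odot> (und s \<odot> pl (mdom s) (mdom r)) = lleg (mcod r) \<odot> (und r \<odot> pr (mdom s) (mdom r))"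
    using s' r' sq by (simp add: cmp1_fuse[OF s'(7)] cmp1_fuse[OF r'(6)])
  note t = tup1_span[OF s'(2) r'(2) _ _ _ _ _ this]
  show eq: "pl (mcod s) (mcod r) \<odot> und (comp1 s r) = und s \<odot> pl (mdom s) (mdom r)"
    "pr (mcod s) (mcod r) \<odot> und (comp1 s r) = und r \<odot> pr (mdom s) (mdom r)"
    using s' r' t by simp_all
  show "comp1 s r \<in> strict_maps a c"
    using s' r' t span_comp_lds[OF s'(1) r'(1)] span_comp_lds[OF s'(2) r'(2)]
    by (simp add: strict_iff cmp1_fuse[OF s'(6)] cmp1_fuse[OF r'(7)])
qed

lemma arrow_named:
  assumes "\<theta> \<in> Ce K" "Cod K (Src K \<theta>) = c"
  shows "named c \<theta> \<in> Ar K" "Dom K (named c \<theta>) = Dom K (Src K \<theta>)"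
    "Cod K (named c \<theta>) = Dom K (d0 c)" "chi c \<triangleright> named c \<theta> = \<theta>"
    "d0 c \<odot> named c \<theta> = Src K \<theta>" "d1 c \<odot> named c \<theta> = Tgt K \<theta>"
  using arrow_name[OF arrow_object, of c \<theta>] assms by auto

lemma arrow_unit_sel [simp]:
  "mdom (unit_map c) = span_unit K c" "mcod (unit_map c) = arr c"
  "und (unit_map c) = named c (id2 K (id1 K c))"
  "phi (unit_map c) = id2 K (id1 K c)"
  by (simp_all add: arrow_unit_def)

lemma arrow_unit_strict:
  assumes "c \<in> Ob K" shows "unit_map c \<in> strict_maps c c"
  using assms arrow_named[of "id2 K (id1 K c)" c] by (simp add: strict_iff)

lemma arrow_mult_sel [simp]:
  "mdom (mult_map c) = arr c \<otimes> arr c" "mcod (mult_map c) = arr c"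
  "und (mult_map c) = named c
     ((chi c \<triangleright> pr (arr c) (arr c)) \<bullet> (chi c \<triangleright> pl (arr c) (arr c)))"
  "phi (mult_map c) = id2 K (rleg (arr c \<otimes> arr c))"
  by (simp_all add: arrow_mult_def split_beta Let_def)

lemma arrow_mult:
  assumes c: "c \<in> Ob K"
  shows "mult_map c \<in> strict_maps c c"
    "chi c \<triangleright> und (mult_map c) = (chi c \<triangleright> pr (arr c) (arr c)) \<bullet> (chi c \<triangleright> pl (arr c) (arr c))"
proof -
  note A = arr_lds[OF c]
  have sq: "d1 c \<odot> pl (arr c) (arr c) = d0 c \<odot> pr (arr c) (arr c)"
    using span_square[OF A A] by simp
  have t: "(chi c \<triangleright> pr (arr c) (arr c)) \<bullet> (chi c \<triangleright> pl (arr c) (arr c)) \<in> Ce K"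
    "Src K ((chi c \<triangleright> pr (arr c) (arr c)) \<bullet> (chi c \<triangleright> pl (arr c) (arr c))) = d0 c \<odot> pl (arr c) (arr c)"
    "Tgt K ((chi c \<triangleright> pr (arr c) (arr c)) \<bullet> (chi c \<triangleright> pl (arr c) (arr c))) = d1 c \<odot> pr (arr c) (arr c)"
    using span_proj[OF A A] sq c by simp_all
  then have *: "Cod K (Src K ((chi c \<triangleright> pr (arr c) (arr c)) \<bullet> (chi c \<triangleright> pl (arr c) (arr c)))) = c"
    using span_proj[OF A A] c by simp
  note n = arrow_named[OF t(1) *]
  show "chi c \<triangleright> und (mult_map c) = (chi c \<triangleright> pr (arr c) (arr c)) \<bullet> (chi c \<triangleright> pl (arr c) (arr c))"
    using n by simp
  show "mult_map c \<in> strict_maps c c"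
    using n t span_comp_lds[OF A A] span_proj[OF A A] A c by (simp add: strict_iff)
qed

lemma right_unitor:
  assumes S: "S \<in> lds b c"
  shows "right_unitor K pb S \<in> strict_maps b c" "mdom (right_unitor K pb S) = S"
    "mcod (right_unitor K pb S) = S \<otimes> span_unit K c"
    "pl S (span_unit K c) \<odot> und (right_unitor K pb S) = id1 K (apex S)"
    "pr S (span_unit K c) \<odot> und (right_unitor K pb S) = rleg S"
proof -
  have c: "c \<in> Ob K" using ldsD(4,6)[OF S] by auto
  note I = span_unit_lds[OF c]
  note S' = ldsD[OF S]
  have t: "tup S (span_unit K c) (id1 K (apex S)) (rleg S) \<in> Ar K"
    "Dom K (tup S (span_unit K c) (id1 K (apex S)) (rleg S)) = apex S"
    "Cod K (tup S (span_unit K c) (id1 K (apex S)) (rleg S)) = Dom K (pl S (span_unit K c))"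
    "pl S (span_unit K c) \<odot> tup S (span_unit K c) (id1 K (apex S)) (rleg S) = id1 K (apex S)"
    "pr S (span_unit K c) \<odot> tup S (span_unit K c) (id1 K (apex S)) (rleg S) = rleg S"
    using tup1_span[OF S I, of "id1 K (apex S)" "rleg S"] S' c by simp_all
  show "mdom (right_unitor K pb S) = S" "mcod (right_unitor K pb S) = S \<otimes> span_unit K c"
    "pl S (span_unit K c) \<odot> und (right_unitor K pb S) = id1 K (apex S)"
    "pr S (span_unit K c) \<odot> und (right_unitor K pb S) = rleg S"
    using t S' by (simp_all add: right_unitor_def Let_def)
  show "right_unitor K pb S \<in> strict_maps b c"
    using t S S' I c span_comp_lds[OF S I] span_proj[OF S I]
    by (simp add: right_unitor_def Let_def strict_iff)
qed

lemma left_unitor: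
  assumes S: "S \<in> lds b c"
  shows "left_unitor K pb S \<in> strict_maps b c" "mdom (left_unitor K pb S) = S"
    "mcod (left_unitor K pb S) = span_unit K b \<otimes> S"
    "pl (span_unit K b) S \<odot> und (left_unitor K pb S) = lleg S"
    "pr (span_unit K b) S \<odot> und (left_unitor K pb S) = id1 K (apex S)"
proof -
  have c: "b \<in> Ob K" using ldsD(1,3)[OF S] by auto
  note I = span_unit_lds[OF c]
  note S' = ldsD[OF S]
  have t: "tup (span_unit K b) S (lleg S) (id1 K (apex S)) \<in> Ar K"
    "Dom K (tup (span_unit K b) S (lleg S) (id1 K (apex S))) = apex S"
    "Cod K (tup (span_unit K b) S (lleg S) (id1 K (apex S))) = Dom K (pl (span_unit K b) S)"
    "pl (span_unit K b) S \<odot> tup (span_unit K b) S (lleg S) (id1 K (apex S)) = lleg S"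
    "pr (span_unit K b) S \<odot> tup (span_unit K b) S (lleg S) (id1 K (apex S)) = id1 K (apex S)"
    using tup1_span[OF I S, of "lleg S" "id1 K (apex S)"] S' c by simp_all
  show "mdom (left_unitor K pb S) = S" "mcod (left_unitor K pb S) = span_unit K b \<otimes> S"
    "pl (span_unit K b) S \<odot> und (left_unitor K pb S) = lleg S"
    "pr (span_unit K b) S \<odot> und (left_unitor K pb S) = id1 K (apex S)"
    using t S' by (simp_all add: left_unitor_def Let_def)
  show "left_unitor K pb S \<in> strict_maps b c"
    using t S S' I c span_comp_lds[OF I S] span_proj[OF I S]
    by (simp add: left_unitor_def Let_def strict_iff)
qed

lemma associator:
  assumes S: "S \<in> lds a b" and R: "R \<in> lds b c"
    and Q: "Q \<in> lds c d"
  shows "associator K pb S R Q \<in> strict_maps a d"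
    "mdom (associator K pb S R Q) = (S \<otimes> R) \<otimes> Q" "mcod (associator K pb S R Q) = S \<otimes> (R \<otimes> Q)"
    "pl S (R \<otimes> Q) \<odot> und (associator K pb S R Q) = pl S R \<odot> pl (S \<otimes> R) Q"
    "pl R Q \<odot> (pr S (R \<otimes> Q) \<odot> und (associator K pb S R Q)) = pr S R \<odot> pl (S \<otimes> R) Q"
    "pr R Q \<odot> (pr S (R \<otimes> Q) \<odot> und (associator K pb S R Q)) = pr (S \<otimes> R) Q"
proof -
  note SR = span_comp_lds[OF S R] and RQ = span_comp_lds[OF R Q]
  note T = ldsD[OF S] ldsD[OF R] ldsD[OF Q] span_proj[OF S R] span_proj[OF R Q]
    span_proj[OF SR Q] span_proj[OF S RQ]
  note sSR = span_square[OF S R] and sRQ = span_square[OF R Q]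
    and sSR_Q = span_square[OF SR Q] and sS_RQ = span_square[OF S RQ]
  let ?w = "tup R Q (pr S R \<odot> pl (S \<otimes> R) Q) (pr (S \<otimes> R) Q)"
  have w: "?w \<in> Ar K" "Dom K ?w = Dom K (pl (S \<otimes> R) Q)" "Cod K ?w = Dom K (pl R Q)"
    "pl R Q \<odot> ?w = pr S R \<odot> pl (S \<otimes> R) Q" "pr R Q \<odot> ?w = pr (S \<otimes> R) Q"
    using tup1_span[OF R Q, of "pr S R \<odot> pl (S \<otimes> R) Q" "pr (S \<otimes> R) Q"] T sSR_Q by simp_all
  let ?a = "tup S (R \<otimes> Q) (pl S R \<odot> pl (S \<otimes> R) Q) ?w"
  have "rleg S \<odot> (pl S R \<odot> pl (S \<otimes> R) Q) = lleg (R \<otimes> Q) \<odot> ?w"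
    using T w by (simp add: cmp1_fuse[OF sSR])
  then have a: "?a \<in> Ar K" "Dom K ?a = Dom K (pl (S \<otimes> R) Q)" "Cod K ?a = Dom K (pl S (R \<otimes> Q))"
    "pl S (R \<otimes> Q) \<odot> ?a = pl S R \<odot> pl (S \<otimes> R) Q" "pr S (R \<otimes> Q) \<odot> ?a = ?w"
    using tup1_span[OF S RQ, of "pl S R \<odot> pl (S \<otimes> R) Q" ?w] T w by simp_all
  have und: "und (associator K pb S R Q) = ?a" "mdom (associator K pb S R Q) = (S \<otimes> R) \<otimes> Q"
    "mcod (associator K pb S R Q) = S \<otimes> (R \<otimes> Q)"
    "phi (associator K pb S R Q) = id2 K (rleg ((S \<otimes> R) \<otimes> Q))"
    by (simp_all add: associator_def Let_def split_beta)
  show "mdom (associator K pb S R Q) = (S \<otimes> R) \<otimes> Q" "mcod (associator K pb S R Q) = S \<otimes> (R \<otimes> Q)"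
    "pl S (R \<otimes> Q) \<odot> und (associator K pb S R Q) = pl S R \<odot> pl (S \<otimes> R) Q"
    "pl R Q \<odot> (pr S (R \<otimes> Q) \<odot> und (associator K pb S R Q)) = pr S R \<odot> pl (S \<otimes> R) Q"
    "pr R Q \<odot> (pr S (R \<otimes> Q) \<odot> und (associator K pb S R Q)) = pr (S \<otimes> R) Q"
    using und a w by simp_all
  show "associator K pb S R Q \<in> strict_maps a d"
    using und a w T span_comp_lds[OF SR Q] span_comp_lds[OF S RQ] by (simp add: strict_iff)
qed

lemma associator_inv:
  assumes S: "S \<in> lds a b" and R: "R \<in> lds b c"
    and Q: "Q \<in> lds c d"
  shows "associator_inv K pb S R Q \<in> strict_maps a d"
    "mdom (associator_inv K pb S R Q) = S \<otimes> (R \<otimes> Q)" "mcod (associator_inv K pb S R Q) = (S \<otimes> R) \<otimes> Q"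
    "pr (S \<otimes> R) Q \<odot> und (associator_inv K pb S R Q) = pr R Q \<odot> pr S (R \<otimes> Q)"
    "pr S R \<odot> (pl (S \<otimes> R) Q \<odot> und (associator_inv K pb S R Q)) = pl R Q \<odot> pr S (R \<otimes> Q)"
    "pl S R \<odot> (pl (S \<otimes> R) Q \<odot> und (associator_inv K pb S R Q)) = pl S (R \<otimes> Q)"
proof -
  note SR = span_comp_lds[OF S R] and RQ = span_comp_lds[OF R Q]
  note T = ldsD[OF S] ldsD[OF R] ldsD[OF Q] span_proj[OF S R] span_proj[OF R Q]
    span_proj[OF SR Q] span_proj[OF S RQ]
  note sSR = span_square[OF S R] and sRQ = span_square[OF R Q]
    and sSR_Q = span_square[OF SR Q] and sS_RQ = span_square[OF S RQ]
  let ?w = "tup S R (pl S (R \<otimes> Q)) (pl R Q \<odot> pr S (R \<otimes> Q))"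
  have w: "?w \<in> Ar K" "Dom K ?w = Dom K (pl S (R \<otimes> Q))" "Cod K ?w = Dom K (pl S R)"
    "pl S R \<odot> ?w = pl S (R \<otimes> Q)" "pr S R \<odot> ?w = pl R Q \<odot> pr S (R \<otimes> Q)"
    using tup1_span[OF S R, of "pl S (R \<otimes> Q)" "pl R Q \<odot> pr S (R \<otimes> Q)"] T sS_RQ by simp_all
  let ?a = "tup (S \<otimes> R) Q ?w (pr R Q \<odot> pr S (R \<otimes> Q))"
  have "rleg (S \<otimes> R) \<odot> ?w = lleg Q \<odot> (pr R Q \<odot> pr S (R \<otimes> Q))"
    using T w by (simp add: cmp1_fuse[OF sRQ])
  then have a: "?a \<in> Ar K" "Dom K ?a = Dom K (pl S (R \<otimes> Q))" "Cod K ?a = Dom K (pl (S \<otimes> R) Q)"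
    "pl (S \<otimes> R) Q \<odot> ?a = ?w" "pr (S \<otimes> R) Q \<odot> ?a = pr R Q \<odot> pr S (R \<otimes> Q)"
    using tup1_span[OF SR Q, of ?w "pr R Q \<odot> pr S (R \<otimes> Q)"] T w by simp_all
  have und: "und (associator_inv K pb S R Q) = ?a" "mcod (associator_inv K pb S R Q) = (S \<otimes> R) \<otimes> Q"
    "mdom (associator_inv K pb S R Q) = S \<otimes> (R \<otimes> Q)"
    "phi (associator_inv K pb S R Q) = id2 K (rleg (S \<otimes> (R \<otimes> Q)))"
    by (simp_all add: associator_inv_def Let_def split_beta)
  show "mdom (associator_inv K pb S R Q) = S \<otimes> (R \<otimes> Q)" "mcod (associator_inv K pb S R Q) = (S \<otimes> R) \<otimes> Q"
    "pr (S \<otimes> R) Q \<odot> und (associator_inv K pb S R Q) = pr R Q \<odot> pr S (R \<otimes> Q)"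
    "pr S R \<odot> (pl (S \<otimes> R) Q \<odot> und (associator_inv K pb S R Q)) = pl R Q \<odot> pr S (R \<otimes> Q)"
    "pl S R \<odot> (pl (S \<otimes> R) Q \<odot> und (associator_inv K pb S R Q)) = pl S (R \<otimes> Q)"
    using und a w by simp_all
  show "associator_inv K pb S R Q \<in> strict_maps a d"
    using und a w T span_comp_lds[OF SR Q] span_comp_lds[OF S RQ] by (simp add: strict_iff cmp1_fuse[OF w(4)])
qed


section \<open>Units and multiplications of the arrow monads\<close>

text \<open>The coherence isomorphisms of \<open>*\<close> enter the arrow monads through their projections only: the following lemmas describe
the two components of each structure map, with a 1-cell into the arrow object given by the 2-cell that it names.\<close>

lemma post_unit:
  assumes S: "S \<in> lds b c"
  shows "unt (post c) S \<in> strict_maps b c"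
    "mdom (unt (post c) S) = S" "mcod (unt (post c) S) = S \<otimes> arr c"
    "pl S (arr c) \<odot> und (unt (post c) S) = id1 K (apex S)"
    "chi c \<triangleright> (pr S (arr c) \<odot> und (unt (post c) S)) = id2 K (rleg S)"
proof -
  note S' = ldsD[OF S]
  have c: "c \<in> Ob K" using S' Cod_closed by auto
  let ?u = "comp1 (id_map S) (unit_map c)"
  let ?n = "named c (id2 K (id1 K c))"
  note U = span_comp1[OF strict_id[OF S] arrow_unit_strict[OF c]]
  note R = right_unitor[OF S]
  have n: "?n \<in> Ar K" "Dom K ?n = c" "Cod K ?n = Dom K (d0 c)" "chi c \<triangleright> ?n = id2 K (id1 K c)"
    using arrow_named[of "id2 K (id1 K c)" c] c by simp_all
  note P = span_proj[OF S span_unit_lds[OF c]] span_proj[OF S arr_lds[OF c]]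
  have eq: "unt (post c) S = comp_map ?u (right_unitor K pb S)"
    by (simp add: post_arrow_def Let_def)
  show "unt (post c) S \<in> strict_maps b c"
    "mdom (unt (post c) S) = S" "mcod (unt (post c) S) = S \<otimes> arr c"
    unfolding eq using R by (simp_all add: strict_comp[OF R(1) U(1)])
  have u: "und ?u \<in> Ar K" "Dom K (und ?u) = Dom K (pl S (span_unit K c))" "Cod K (und ?u) = Dom K (pl S (arr c))"
    using strictD(3-5)[OF U(1)] by simp_all
  have r: "und (right_unitor K pb S) \<in> Ar K" "Dom K (und (right_unitor K pb S)) = apex S"
    "Cod K (und (right_unitor K pb S)) = Dom K (pl S (span_unit K c))"
    using strictD(3-5)[OF R(1)] R by simp_all
  have l: "pl S (arr c) \<odot> und ?u = pl S (span_unit K c)"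
    "pr S (arr c) \<odot> und ?u = ?n \<odot> pr S (span_unit K c)"
    using U(2,3) P S' by (simp_all del: span_comp1_sel(4))
  show "pl S (arr c) \<odot> und (unt (post c) S) = id1 K (apex S)"
    unfolding eq using l u r R(4) P by (simp add: cmp1_fuse[OF l(1)] del: span_comp1_sel(4))
  have "pr S (arr c) \<odot> und (unt (post c) S) = ?n \<odot> rleg S"
    unfolding eq using l u r R(5) P n by (simp add: cmp1_fuse[OF l(2)] del: span_comp1_sel(4))
  then show "chi c \<triangleright> (pr S (arr c) \<odot> und (unt (post c) S)) = id2 K (rleg S)"
    using n S' c rwhisker_rwhisker[of "chi c" ?n "rleg S"] by simp
qed

lemma pre_unit:
  assumes S: "S \<in> lds b c"
  shows "unt (pre b) S \<in> strict_maps b c"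
    "mdom (unt (pre b) S) = S" "mcod (unt (pre b) S) = arr b \<otimes> S"
    "pl (arr b) S \<odot> und (unt (pre b) S) = named b (id2 K (lleg S))"
    "pr (arr b) S \<odot> und (unt (pre b) S) = id1 K (apex S)"
proof -
  note S' = ldsD[OF S]
  have c: "b \<in> Ob K" using S' Cod_closed by auto
  let ?u = "comp1 (unit_map b) (id_map S)"
  let ?n = "named b (id2 K (id1 K b))"
  note U = span_comp1[OF arrow_unit_strict[OF c] strict_id[OF S]]
  note R = left_unitor[OF S]
  have n: "?n \<in> Ar K" "Dom K ?n = b" "Cod K ?n = Dom K (d0 b)" "chi b \<triangleright> ?n = id2 K (id1 K b)"
    using arrow_named[of "id2 K (id1 K b)" b] c by simp_all
  note P = span_proj[OF span_unit_lds[OF c] S] span_proj[OF arr_lds[OF c] S]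
  have eq: "unt (pre b) S = comp_map ?u (left_unitor K pb S)"
    by (simp add: pre_arrow_def Let_def)
  show "unt (pre b) S \<in> strict_maps b c"
    "mdom (unt (pre b) S) = S" "mcod (unt (pre b) S) = arr b \<otimes> S"
    unfolding eq using R by (simp_all add: strict_comp[OF R(1) U(1)])
  have u: "und ?u \<in> Ar K" "Dom K (und ?u) = Dom K (pl (span_unit K b) S)" "Cod K (und ?u) = Dom K (pl (arr b) S)"
    using strictD(3-5)[OF U(1)] by simp_all
  have r: "und (left_unitor K pb S) \<in> Ar K" "Dom K (und (left_unitor K pb S)) = apex S"
    "Cod K (und (left_unitor K pb S)) = Dom K (pl (span_unit K b) S)"
    using strictD(3-5)[OF R(1)] R by simp_all
  have l: "pl (arr b) S \<odot> und ?u = ?n \<odot> pl (span_unit K b) S"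
    "pr (arr b) S \<odot> und ?u = pr (span_unit K b) S"
    using U(2,3) P S' by (simp_all del: span_comp1_sel(4))
  show "pr (arr b) S \<odot> und (unt (pre b) S) = id1 K (apex S)"
    unfolding eq using l u r R(5) P by (simp add: cmp1_fuse[OF l(2)] del: span_comp1_sel(4))
  have e: "pl (arr b) S \<odot> und (unt (pre b) S) = ?n \<odot> lleg S"
    unfolding eq using l u r R(4) P n by (simp add: cmp1_fuse[OF l(1)] del: span_comp1_sel(4))
  note m = arrow_named[of "id2 K (lleg S)" b]
  have "?n \<odot> lleg S = named b (id2 K (lleg S))"
    by (rule arrow_eqI1[OF arrow_object[OF c]])
      (use n S' c m rwhisker_rwhisker[of "chi b" ?n "lleg S"] in simp_all)
  with e show "pl (arr b) S \<odot> und (unt (pre b) S) = named b (id2 K (lleg S))"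
    by simp
qed

lemma post_mult:
  assumes S: "S \<in> lds b c"
  shows "mlt (post c) S \<in> strict_maps b c"
    "mdom (mlt (post c) S) = (S \<otimes> arr c) \<otimes> arr c"
    "mcod (mlt (post c) S) = S \<otimes> arr c"
    "pl S (arr c) \<odot> und (mlt (post c) S) = pl S (arr c) \<odot> pl (S \<otimes> arr c) (arr c)"
    "chi c \<triangleright> (pr S (arr c) \<odot> und (mlt (post c) S)) =
      (chi c \<triangleright> pr (S \<otimes> arr c) (arr c)) \<bullet> (chi c \<triangleright> (pr S (arr c) \<odot> pl (S \<otimes> arr c) (arr c)))"
    "d1 c \<odot> (pr S (arr c) \<odot> und (mlt (post c) S)) = d1 c \<odot> pr (S \<otimes> arr c) (arr c)"
proof -
  note S' = ldsD[OF S]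
  have c: "c \<in> Ob K" using S' Cod_closed by auto
  let ?A = "arr c"
  note A = arr_lds[OF c]
  note SA = span_comp_lds[OF S A] and AA = span_comp_lds[OF A A]
  let ?u = "comp1 (id_map S) (mult_map c)"
  let ?a = "associator K pb S ?A ?A"
  let ?m = "und (mult_map c)"
  note U = span_comp1[OF strict_id[OF S] arrow_mult(1)[OF c]]
  note R = associator[OF S A A]
  note P = span_proj[OF S A] span_proj[OF SA A] span_proj[OF A A] span_proj[OF S AA]
  have m: "?m \<in> Ar K" "Dom K ?m = Dom K (pl ?A ?A)" "Cod K ?m = Dom K (d0 c)"
    using strictD(3-5)[OF arrow_mult(1)[OF c]] by simp_all
  have mm: "chi c \<triangleright> ?m = (chi c \<triangleright> pr ?A ?A) \<bullet> (chi c \<triangleright> pl ?A ?A)"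
    by (rule arrow_mult(2)[OF c])
  have eq: "mlt (post c) S = comp_map ?u ?a"
    by (simp add: post_arrow_def Let_def)
  show "mlt (post c) S \<in> strict_maps b c"
    "mdom (mlt (post c) S) = (S \<otimes> arr c) \<otimes> arr c"
    "mcod (mlt (post c) S) = S \<otimes> arr c"
    unfolding eq using R by (simp_all add: strict_comp[OF R(1) U(1)])
  have u: "und ?u \<in> Ar K" "Dom K (und ?u) = Dom K (pl S (?A \<otimes> ?A))" "Cod K (und ?u) = Dom K (pl S ?A)"
    using strictD(3-5)[OF U(1)] by simp_all
  have r: "und ?a \<in> Ar K" "Dom K (und ?a) = Dom K (pl (S \<otimes> ?A) ?A)"
    "Cod K (und ?a) = Dom K (pl S (?A \<otimes> ?A))"
    using strictD(3-5)[OF R(1)] R by simp_all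
  have l: "pl S ?A \<odot> und ?u = pl S (?A \<otimes> ?A)" "pr S ?A \<odot> und ?u = ?m \<odot> pr S (?A \<otimes> ?A)"
    using U(2,3) P S' by (simp_all del: span_comp1_sel(4) arrow_mult_sel(3))
  show "pl S (arr c) \<odot> und (mlt (post c) S) = pl S (arr c) \<odot> pl (S \<otimes> arr c) (arr c)"
    unfolding eq using l u r R(4) P by (simp add: cmp1_fuse[OF l(1)] del: span_comp1_sel(4))
  have e: "pr S ?A \<odot> und (mlt (post c) S) = ?m \<odot> (pr S (?A \<otimes> ?A) \<odot> und ?a)"
    unfolding eq using l u r P m
    by (simp add: cmp1_fuse[OF l(2)] del: span_comp1_sel(4) arrow_mult_sel(3))
  have "chi c \<triangleright> (?m \<odot> (pr S (?A \<otimes> ?A) \<odot> und ?a)) = (chi c \<triangleright> ?m) \<triangleright> (pr S (?A \<otimes> ?A) \<odot> und ?a)"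
    by (rule rwhisker_rwhisker[symmetric]) (use m r c P in \<open>simp_all del: arrow_mult_sel(3)\<close>)
  also have "\<dots> = (chi c \<triangleright> (pr ?A ?A \<odot> (pr S (?A \<otimes> ?A) \<odot> und ?a)))
      \<bullet> (chi c \<triangleright> (pl ?A ?A \<odot> (pr S (?A \<otimes> ?A) \<odot> und ?a)))"
    unfolding mm using r c P span_square[OF A A] by (simp add: collect_whiskers)
  also have "\<dots> = (chi c \<triangleright> pr (S \<otimes> ?A) ?A) \<bullet> (chi c \<triangleright> (pr S ?A \<odot> pl (S \<otimes> ?A) ?A))"
    using R(5,6) by simp
  finally show *: "chi c \<triangleright> (pr S (arr c) \<odot> und (mlt (post c) S)) =
      (chi c \<triangleright> pr (S \<otimes> arr c) (arr c)) \<bullet> (chi c \<triangleright> (pr S (arr c) \<odot> pl (S \<otimes> arr c) (arr c)))"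
    using e by simp
  have "und (mlt (post c) S) \<in> Ar K"
    "Cod K (und (mlt (post c) S)) = Dom K (pl S ?A)"
    unfolding eq using u r by (simp_all del: span_comp1_sel(4))
  then have "d1 c \<odot> (pr S ?A \<odot> und (mlt (post c) S))
      = Tgt K (chi c \<triangleright> (pr S ?A \<odot> und (mlt (post c) S)))"
    using c P by simp
  also have "\<dots> = d1 c \<odot> pr (S \<otimes> ?A) ?A"
    unfolding * using c P span_square[OF SA A] by simp
  finally show "d1 c \<odot> (pr S (arr c) \<odot> und (mlt (post c) S)) = d1 c \<odot> pr (S \<otimes> arr c) (arr c)" .
qed

lemma post_far:
  assumes s: "s \<in> strict_maps b c"
  shows "far (post c) s \<in> strict_maps b c"
    "mdom (far (post c) s) = mdom s \<otimes> arr c"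
    "mcod (far (post c) s) = mcod s \<otimes> arr c"
    "pl (mcod s) (arr c) \<odot> und (far (post c) s) = und s \<odot> pl (mdom s) (arr c)"
    "pr (mcod s) (arr c) \<odot> und (far (post c) s) = pr (mdom s) (arr c)"
proof -
  have c: "c \<in> Ob K" using ldsD(4,6)[OF strictD(1)[OF s]] by auto
  have eq: "far (post c) s = comp1 s (id_map (arr c))"
    by (simp add: post_arrow_def Let_def)
  note U = span_comp1[OF s strict_id[OF arr_lds[OF c]]]
  note P = span_proj[OF strictD(1)[OF s] arr_lds[OF c]]
  show "far (post c) s \<in> strict_maps b c"
    "mdom (far (post c) s) = mdom s \<otimes> arr c"
    "mcod (far (post c) s) = mcod s \<otimes> arr c"
    "pl (mcod s) (arr c) \<odot> und (far (post c) s) = und s \<odot> pl (mdom s) (arr c)"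
    "pr (mcod s) (arr c) \<odot> und (far (post c) s) = pr (mdom s) (arr c)"
    unfolding eq using U P by (simp_all del: span_comp1_sel(4))
qed

lemma post_fce:
  assumes a: "a \<in> lax_cells b c" "csrc a \<in> strict_maps b c" "ctgt a \<in> strict_maps b c"
  shows "csrc (fce (post c) a) = far (post c) (csrc a)"
    "ctgt (fce (post c) a) = far (post c) (ctgt a)"
    "cund (fce (post c) a) \<in> Ce K"
    "Src K (cund (fce (post c) a)) = und (far (post c) (csrc a))"
    "Tgt K (cund (fce (post c) a)) = und (far (post c) (ctgt a))"
    "pl (mcod (csrc a)) (arr c) \<triangleleft> cund (fce (post c) a) = cund a \<triangleright> pl (mdom (csrc a)) (arr c)"
    "pr (mcod (csrc a)) (arr c) \<triangleleft> cund (fce (post c) a) = id2 K (pr (mdom (csrc a)) (arr c))"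
proof -
  have c: "c \<in> Ob K" using ldsD(4,6)[OF strictD(1)[OF a(2)]] by auto
  note A = arr_lds[OF c]
  note a' = span_cellsD[OF a(1)] and s = strictD[OF a(2)] and t = strictD[OF a(3)]
  let ?S = "mdom (csrc a)" and ?R = "mcod (csrc a)"
  note P = span_proj[OF s(1) A] span_proj[OF s(2) A]
  let ?\<zeta> = "id2 K (id1 K (Dom K (d0 c))) \<triangleright> pr ?S (arr c)"
  have z: "?\<zeta> = id2 K (pr ?S (arr c))" using c P by simp
  have ra: "rleg ?R \<triangleleft> cund a = id2 K (rleg ?S)"
    using a' s t by simp
  have "rleg ?R \<triangleleft> (cund a \<triangleright> pl ?S (arr c)) = (rleg ?R \<triangleleft> cund a) \<triangleright> pl ?S (arr c)"
    by (rule whisker_whisker[symmetric]) (use a' s t P in simp_all)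
  then have sq: "rleg ?R \<triangleleft> (cund a \<triangleright> pl ?S (arr c)) = lleg (arr c) \<triangleleft> id2 K (pr ?S (arr c))"
    unfolding ra using s P c span_square[OF s(1) A] by simp
  note T = tup2_span[OF s(2) A _ _ _ _ _ sq]
  have eq: "fce (post c) a = SpanCell (far (post c) (csrc a))
      (tup2 K (span_pb pb ?R (arr c)) (cund a \<triangleright> pl ?S (arr c)) (id2 K (pr ?S (arr c))))
      (far (post c) (ctgt a))"
    using z by (simp add: post_arrow_def span_comp2_def Let_def split_beta)
  show "csrc (fce (post c) a) = far (post c) (csrc a)"
    "ctgt (fce (post c) a) = far (post c) (ctgt a)"
    by (simp_all add: eq)
  show "cund (fce (post c) a) \<in> Ce K"
    "Src K (cund (fce (post c) a)) = und (far (post c) (csrc a))"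
    "Tgt K (cund (fce (post c) a)) = und (far (post c) (ctgt a))"
    "pl (mcod (csrc a)) (arr c) \<triangleleft> cund (fce (post c) a) = cund a \<triangleright> pl (mdom (csrc a)) (arr c)"
    "pr (mcod (csrc a)) (arr c) \<triangleleft> cund (fce (post c) a) = id2 K (pr (mdom (csrc a)) (arr c))"
    unfolding eq using T a' s t P c by (simp_all add: post_arrow_def Let_def)
qed

end


section \<open>Lax maps of spans as Kleisli maps\<close>

locale paradise_spans = paradise_choice K D pb ar
  for K :: "('o, 'm, 'c) two_cat" (structure) and D pb ar +
  fixes B C :: 'o
  assumes B [simp]: "B \<in> Ob K" and C [simp]: "C \<in> Ob K"
begin

abbreviation "spans \<equiv> lds B C"
abbreviation "lax \<equiv> lax_maps B C"
abbreviation "strict \<equiv> strict_maps B C"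
abbreviation "L \<equiv> dSpan_lax K D B C"
abbreviation "cells\<^sub>L \<equiv> lax_cells B C"
abbreviation "T \<equiv> post C"
abbreviation "KlT \<equiv> Kl T (dSpan K D B C)"

lemma Kl_sel [simp]:
  "Ob KlT = spans" "Dom KlT = odom" "Cod KlT = ocod"
  "Src KlT c = Over (odom c) (csrc (ocell c)) (ocod c)"
  "Tgt KlT c = Over (odom c) (ctgt (ocell c)) (ocod c)"
  "id1 KlT a = Over a (unt T a) a"
  "l \<odot>\<^bsub>KlT\<^esub> k = Over (odom k) (comp_map (mlt T (ocod l))
     (comp_map (far T (ocell l)) (ocell k))) (ocod l)"
  "id2 KlT k = Over (odom k) (SpanCell (ocell k) (id2 K (und (ocell k))) (ocell k)) (ocod k)"
  "d \<bullet>\<^bsub>KlT\<^esub> c = Over (odom c) (SpanCell (csrc (ocell c)) (cund (ocell d) \<bullet> cund (ocell c))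
     (ctgt (ocell d))) (ocod d)"
  "d \<star>\<^bsub>KlT\<^esub> c = Over (odom c) (SpanCell
      (comp_map (mlt T (ocod d)) (comp_map (csrc (fce T (ocell d))) (csrc (ocell c))))
      (und (mlt T (ocod d)) \<triangleleft> (cund (fce T (ocell d)) \<star> cund (ocell c)))
      (comp_map (mlt T (ocod d)) (comp_map (ctgt (fce T (ocell d))) (ctgt (ocell c)))))
     (ocod d)"
  by (simp_all add: Kl_def lwhisker_def)

lemma Kl_Ar: "k \<in> Ar KlT \<longleftrightarrow> odom k \<in> spans \<and> ocod k \<in> spans \<and> ocell k \<in> strict \<and>
    mdom (ocell k) = odom k \<and> mcod (ocell k) = ocod k \<otimes> arr C"
  by (cases k) (auto simp: Kl_def hom1_def post_arrow_def Let_def)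

lemma Kl_Ce: "c \<in> Ce KlT \<longleftrightarrow> odom c \<in> spans \<and> ocod c \<in> spans \<and> ocell c \<in> cells\<^sub>L \<and>
    csrc (ocell c) \<in> strict \<and> ctgt (ocell c) \<in> strict \<and>
    mdom (csrc (ocell c)) = odom c \<and> mcod (csrc (ocell c)) = ocod c \<otimes> arr C \<and>
    mdom (ctgt (ocell c)) = odom c \<and> mcod (ctgt (ocell c)) = ocod c \<otimes> arr C"
  by (cases c) (auto simp: Kl_def cells_def hom1_def post_arrow_def Let_def)

lemma proj [simp]:
  assumes "S \<in> spans"
  shows "pl S (arr C) \<in> Ar K" "Cod K (pl S (arr C)) = apex S" "pr S (arr C) \<in> Ar K"
    "Dom K (pr S (arr C)) = Dom K (pl S (arr C))" "Cod K (pr S (arr C)) = Dom K (d0 C)"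
    "S \<otimes> arr C \<in> spans"
  using span_proj[OF assms arr_lds[OF C]] span_comp_lds[OF assms arr_lds[OF C]] by simp_all

lemma square: "S \<in> spans \<Longrightarrow> rleg S \<odot> pl S (arr C) = d0 C \<odot> pr S (arr C)"
  using span_square[OF _ arr_lds[OF C], of S B] by simp

text \<open>A 1-cell into \<open>S \<otimes> arr C\<close> amounts to a 1-cell into the apex of \<open>S\<close> and a 2-cell out of its composite with the right leg
of \<open>S\<close>.\<close>

lemma composite_eqI1:
  assumes S: "S \<in> spans"
    and h: "h \<in> Ar K" "h' \<in> Ar K" "Dom K h' = Dom K h" "Cod K h = Dom K (pl S (arr C))"
      "Cod K h' = Dom K (pl S (arr C))"
    and eq: "pl S (arr C) \<odot> h = pl S (arr C) \<odot> h'"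
      "chi C \<triangleright> (pr S (arr C) \<odot> h) = chi C \<triangleright> (pr S (arr C) \<odot> h')"
  shows "h = h'"
proof (rule pullback_eqI1[OF span_pullback[OF S arr_lds[OF C]] h eq(1)])
  show "pr S (arr C) \<odot> h = pr S (arr C) \<odot> h'"
    by (rule arrow_eqI1[OF arrow_object[OF C]]) (use S h eq(2) in simp_all)
qed

text \<open>The \<open>d0\<close>-side of the component in the arrow object is forced by the pullback square, so the \<open>d1\<close>-side suffices.\<close>

lemma composite_eqI2:
  assumes S: "S \<in> spans"
    and c: "\<gamma> \<in> Ce K" "\<gamma>' \<in> Ce K" "Src K \<gamma>' = Src K \<gamma>" "Tgt K \<gamma>' = Tgt K \<gamma>"
      "Cod K (Src K \<gamma>) = Dom K (pl S (arr C))"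
    and eq: "pl S (arr C) \<triangleleft> \<gamma> = pl S (arr C) \<triangleleft> \<gamma>'"
      "(d1 C \<odot> pr S (arr C)) \<triangleleft> \<gamma> = (d1 C \<odot> pr S (arr C)) \<triangleleft> \<gamma>'"
  shows "\<gamma> = \<gamma>'"
proof (rule pullback_eqI2[OF span_pullback[OF S arr_lds[OF C]] c(1,2) _ c(5) _ eq(1)])
  have d0: "d0 C \<triangleleft> (pr S (arr C) \<triangleleft> x) = rleg S \<triangleleft> (pl S (arr C) \<triangleleft> x)"
    if "x \<in> Ce K" "Cod K (Src K x) = Dom K (pl S (arr C))" for x
    using that S square[OF S] ldsD[OF S] by (simp add: lwhisker_lwhisker)
  have 0: "d0 C \<triangleleft> (pr S (arr C) \<triangleleft> \<gamma>) = d0 C \<triangleleft> (pr S (arr C) \<triangleleft> \<gamma>')"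
    using d0 c eq(1) by simp
  have 1: "d1 C \<triangleleft> (pr S (arr C) \<triangleleft> \<gamma>) = d1 C \<triangleleft> (pr S (arr C) \<triangleleft> \<gamma>')"
    using eq(2) S c by (simp add: lwhisker_lwhisker)
  show "pr S (arr C) \<triangleleft> \<gamma> = pr S (arr C) \<triangleleft> \<gamma>'"
    by (rule arrow_eqI2[OF arrow_object[OF C] _ _ _ _ _ 0 1]) (use S c in simp_all)
qed (use c in simp_all)

text \<open>The hypothesis on \<open>\<alpha>\<close> is that the square of the component in the arrow object commutes when its \<open>d1\<close>-side
is an identity.  Such 2-cells are exactly the ones that fix the right leg of the composite span.\<close>

lemma composite_cell:
  assumes S: "S \<in> spans"
    and h: "h \<in> Ar K" "h' \<in> Ar K" "Dom K h' = Dom K h" "Cod K h = Dom K (pl S (arr C))"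
      "Cod K h' = Dom K (pl S (arr C))"
    and \<alpha>: "\<alpha> \<in> Ce K" "Src K \<alpha> = pl S (arr C) \<odot> h" "Tgt K \<alpha> = pl S (arr C) \<odot> h'"
    and d1: "d1 C \<odot> (pr S (arr C) \<odot> h) = r" "d1 C \<odot> (pr S (arr C) \<odot> h') = r"
    and sq: "(chi C \<triangleright> (pr S (arr C) \<odot> h')) \<bullet> (rleg S \<triangleleft> \<alpha>) = chi C \<triangleright> (pr S (arr C) \<odot> h)"
  obtains \<gamma> where "\<gamma> \<in> Ce K" "Src K \<gamma> = h" "Tgt K \<gamma> = h'" "pl S (arr C) \<triangleleft> \<gamma> = \<alpha>"
    "(d1 C \<odot> pr S (arr C)) \<triangleleft> \<gamma> = id2 K r"
proof -
  let ?u = "pl S (arr C)" and ?v = "pr S (arr C)"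
  note S' = ldsD[OF S] and P = span_pullback[OF S arr_lds[OF C]]
  note f = cmp1_fuse[OF square[OF S]]
  obtain \<delta> where \<delta>: "\<delta> \<in> Ce K" "Src K \<delta> = ?v \<odot> h" "Tgt K \<delta> = ?v \<odot> h'"
    "d0 C \<triangleleft> \<delta> = rleg S \<triangleleft> \<alpha>" "d1 C \<triangleleft> \<delta> = id2 K r"
  proof (rule arrow_cell_exists[OF arrow_object[OF C], of "?v \<odot> h" "?v \<odot> h'" "rleg S \<triangleleft> \<alpha>" "id2 K r"])
    have "Dom K r = Dom K h" "r \<in> Ar K" using d1(1) h S by auto
    then show "id2 K r \<in> Ce K" "Src K (id2 K r) = d1 C \<odot> (?v \<odot> h)" "Tgt K (id2 K r) = d1 C \<odot> (?v \<odot> h')"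
      using d1 by simp_all
    have "id2 K r \<bullet> (chi C \<triangleright> (?v \<odot> h)) = chi C \<triangleright> (?v \<odot> h)"
      by (rule vcmp_id2) (use h S d1 in simp_all)
    with sq show "(chi C \<triangleright> (?v \<odot> h')) \<bullet> (rleg S \<triangleleft> \<alpha>) = id2 K r \<bullet> (chi C \<triangleright> (?v \<odot> h))" by simp
  qed (use h S S' \<alpha> f in simp_all)
  let ?\<gamma> = "tup2 K (span_pb pb S (arr C)) \<alpha> \<delta>"
  have t: "?\<gamma> \<in> Ce K" "?u \<triangleleft> ?\<gamma> = \<alpha>" "?v \<triangleleft> ?\<gamma> = \<delta>"
    "Src K ?\<gamma> = tup S (arr C) (Src K \<alpha>) (Src K \<delta>)"
    "Tgt K ?\<gamma> = tup S (arr C) (Tgt K \<alpha>) (Tgt K \<delta>)"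
    using tup2_span[OF S arr_lds[OF C], of \<alpha> \<delta>] \<alpha> \<delta> h S by simp_all
  note t1 = tup1_span[OF S arr_lds[OF C], of "?u \<odot> h" "?v \<odot> h"]
  note t1' = tup1_span[OF S arr_lds[OF C], of "?u \<odot> h'" "?v \<odot> h'"]
  have s: "Src K ?\<gamma> = h"
    by (rule pullback_eqI1[OF P]) (use t(4) t1 \<alpha> \<delta> h S S' f in simp_all)
  have t': "Tgt K ?\<gamma> = h'"
    by (rule pullback_eqI1[OF P]) (use t(5) t1' \<alpha> \<delta> h S S' f in simp_all)
  have "(d1 C \<odot> ?v) \<triangleleft> ?\<gamma> = d1 C \<triangleleft> (?v \<triangleleft> ?\<gamma>)"
    by (rule lwhisker_lwhisker[symmetric]) (use t s h S in simp_all)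
  then show ?thesis using that[of ?\<gamma>] t s t' \<delta>(5) by simp
qed

text \<open>The 1-cell that corresponds to \<open>(k, \<phi>)\<close>: its components are \<open>k\<close> and the name of \<open>\<phi>\<close>.\<close>

definition kl_und :: "('o, 'm, 'c) span_map \<Rightarrow> 'm" where
  "kl_und s = tup (mcod s) (arr C) (und s) (named C (phi s))"

definition kl_map :: "('o, 'm, 'c) span_map \<Rightarrow> ('o, 'm, 'c) span_map" where
  "kl_map s = SpanMap (mdom s) (kl_und s) (id2 K (rleg (mdom s))) (mcod s \<otimes> arr C)"

lemma kl_map_sel [simp]:
  "mdom (kl_map s) = mdom s" "und (kl_map s) = kl_und s" "phi (kl_map s) = id2 K (rleg (mdom s))"
  "mcod (kl_map s) = mcod s \<otimes> arr C"
  by (simp_all add: kl_map_def)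

lemma kl_und:
  assumes s: "s \<in> lax"
  shows "kl_und s \<in> Ar K" "Dom K (kl_und s) = apex (mdom s)" "Cod K (kl_und s) = Dom K (pl (mcod s) (arr C))"
    "pl (mcod s) (arr C) \<odot> kl_und s = und s"
    "chi C \<triangleright> (pr (mcod s) (arr C) \<odot> kl_und s) = phi s"
    "d1 C \<odot> (pr (mcod s) (arr C) \<odot> kl_und s) = rleg (mdom s)"
proof -
  note s' = laxD[OF s]
  note m = ldsD[OF s'(1)] ldsD[OF s'(2)]
  note n = arrow_named[of "phi s" C]
  show "kl_und s \<in> Ar K" "Dom K (kl_und s) = apex (mdom s)" "Cod K (kl_und s) = Dom K (pl (mcod s) (arr C))"
    "pl (mcod s) (arr C) \<odot> kl_und s = und s"
    "chi C \<triangleright> (pr (mcod s) (arr C) \<odot> kl_und s) = phi s"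
    "d1 C \<odot> (pr (mcod s) (arr C) \<odot> kl_und s) = rleg (mdom s)"
    unfolding kl_und_def
    using s' m n tup1_span[OF s'(2) arr_lds[OF C], of "und s" "named C (phi s)"]
    by simp_all
qed

lemma kl_map_strict:
  assumes s: "s \<in> lax" shows "kl_map s \<in> strict"
  using laxD[OF s] kl_und[OF s] by (simp add: strict_iff)

lemma kl_map_inject:
  assumes s: "s \<in> lax" and t: "t \<in> lax" and "mcod s = mcod t" "kl_map s = kl_map t"
  shows "s = t"
  using assms(3,4) kl_und[OF s] kl_und[OF t] by (intro span_map_eqI) (auto simp: kl_map_def)

text \<open>The lax map is recovered by projecting to the apex and by whiskering the universal 2-cell.\<close>

lemma kl_map_surj:
  assumes k: "k \<in> strict" and S: "S \<in> spans" "mcod k = S \<otimes> arr C"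
  obtains s where "s \<in> lax" "mdom s = mdom k" "mcod s = S" "kl_map s = k"
proof -
  note k' = strictD[OF k, unfolded S(2)]
  note S' = ldsD[OF S(1)]
  let ?s = "SpanMap (mdom k) (pl S (arr C) \<odot> und k) (chi C \<triangleright> (pr S (arr C) \<odot> und k)) S"
  have s: "?s \<in> lax"
    using k' S S' cmp1_fuse[OF square[OF S(1)]] by (simp add: lax_iff)
  note n = kl_und[OF s]
  have "kl_und ?s = und k"
    by (rule composite_eqI1[OF S(1)]) (use n k' S in simp_all)
  then have "kl_map ?s = k"
    using k' S by (intro span_map_eqI) simp_all
  with s that show thesis by simp
qed

lemma kl_cell_ex1:
  assumes c: "c \<in> cells\<^sub>L"
  shows "\<exists>!\<gamma>. \<gamma> \<in> Ce K \<and> Src K \<gamma> = kl_und (csrc c) \<and> Tgt K \<gamma> = kl_und (ctgt c) \<and>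
    pl (mcod (ctgt c)) (arr C) \<triangleleft> \<gamma> = cund c \<and>
    (d1 C \<odot> pr (mcod (ctgt c)) (arr C)) \<triangleleft> \<gamma> = id2 K (rleg (mdom (ctgt c)))"
proof -
  note c' = span_cellsD[OF c]
  note s = laxD[OF c'(1)] kl_und[OF c'(1)]
  note t = laxD[OF c'(2)] kl_und[OF c'(2)]
  let ?S = "mcod (ctgt c)"
  obtain \<gamma> where g: "\<gamma> \<in> Ce K" "Src K \<gamma> = kl_und (csrc c)" "Tgt K \<gamma> = kl_und (ctgt c)"
    "pl ?S (arr C) \<triangleleft> \<gamma> = cund c" "(d1 C \<odot> pr ?S (arr C)) \<triangleleft> \<gamma> = id2 K (rleg (mdom (ctgt c)))"
    by (rule composite_cell[OF t(2), of "kl_und (csrc c)" "kl_und (ctgt c)" "cund c" "rleg (mdom (ctgt c))"])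
      (use c' s t in simp_all)
  show ?thesis
  proof (rule ex1I)
    show "\<gamma> \<in> Ce K \<and> Src K \<gamma> = kl_und (csrc c) \<and> Tgt K \<gamma> = kl_und (ctgt c) \<and>
        pl ?S (arr C) \<triangleleft> \<gamma> = cund c \<and> (d1 C \<odot> pr ?S (arr C)) \<triangleleft> \<gamma> = id2 K (rleg (mdom (ctgt c)))"
      using g by simp
    show "\<gamma>' = \<gamma>" if "\<gamma>' \<in> Ce K \<and> Src K \<gamma>' = kl_und (csrc c) \<and> Tgt K \<gamma>' = kl_und (ctgt c) \<and>
        pl ?S (arr C) \<triangleleft> \<gamma>' = cund c \<and> (d1 C \<odot> pr ?S (arr C)) \<triangleleft> \<gamma>' = id2 K (rleg (mdom (ctgt c)))" for \<gamma>'
      by (rule composite_eqI2[OF t(2)]) (use g that s t c' in simp_all)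
  qed
qed

text \<open>The identity on the \<open>d1\<close>-side is the requirement that a 2-cell of strict maps fixes the right leg.\<close>

definition kl_cund :: "('o, 'm, 'c) span_cell \<Rightarrow> 'c" where
  "kl_cund c = (THE \<gamma>. \<gamma> \<in> Ce K \<and> Src K \<gamma> = kl_und (csrc c) \<and> Tgt K \<gamma> = kl_und (ctgt c) \<and>
    pl (mcod (ctgt c)) (arr C) \<triangleleft> \<gamma> = cund c \<and>
    (d1 C \<odot> pr (mcod (ctgt c)) (arr C)) \<triangleleft> \<gamma> = id2 K (rleg (mdom (ctgt c))))"

lemma kl_cund:
  assumes c: "c \<in> cells\<^sub>L"
  shows "kl_cund c \<in> Ce K" "Src K (kl_cund c) = kl_und (csrc c)" "Tgt K (kl_cund c) = kl_und (ctgt c)"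
    "pl (mcod (ctgt c)) (arr C) \<triangleleft> kl_cund c = cund c"
    "(d1 C \<odot> pr (mcod (ctgt c)) (arr C)) \<triangleleft> kl_cund c = id2 K (rleg (mdom (ctgt c)))"
  using theI'[OF kl_cell_ex1[OF c]] by (auto simp: kl_cund_def)

lemma kl_cund_eqI:
  assumes c: "c \<in> cells\<^sub>L"
    and "\<gamma> \<in> Ce K" "Src K \<gamma> = kl_und (csrc c)" "Tgt K \<gamma> = kl_und (ctgt c)"
    "pl (mcod (ctgt c)) (arr C) \<triangleleft> \<gamma> = cund c"
    "(d1 C \<odot> pr (mcod (ctgt c)) (arr C)) \<triangleleft> \<gamma> = id2 K (rleg (mdom (ctgt c)))"
  shows "kl_cund c = \<gamma>"
  using kl_cell_ex1[OF c] kl_cund[OF c] assms(2-) by blast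

definition kl_cell :: "('o, 'm, 'c) span_cell \<Rightarrow> ('o, 'm, 'c) span_cell" where
  "kl_cell c = SpanCell (kl_map (csrc c)) (kl_cund c) (kl_map (ctgt c))"

lemma kl_cell_sel [simp]:
  "csrc (kl_cell c) = kl_map (csrc c)" "cund (kl_cell c) = kl_cund c" "ctgt (kl_cell c) = kl_map (ctgt c)"
  by (simp_all add: kl_cell_def)

lemma strict_lax: "s \<in> strict \<Longrightarrow> s \<in> lax"
  by (simp add: strict_span_maps_def)

lemma kl_cell_mem:
  assumes c: "c \<in> cells\<^sub>L"
  shows "kl_cell c \<in> cells\<^sub>L"
proof -
  note c' = span_cellsD[OF c]
  note s = laxD[OF c'(1)] kl_und[OF c'(1)]
  note t = laxD[OF c'(2)] kl_und[OF c'(2)]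
  note k = kl_cund[OF c]
  let ?S = "mcod (ctgt c)"
  have "(lleg ?S \<odot> pl ?S (arr C)) \<triangleleft> kl_cund c = lleg ?S \<triangleleft> (pl ?S (arr C) \<triangleleft> kl_cund c)"
    by (rule lwhisker_lwhisker[symmetric]) (use c' s t k in simp_all)
  then have "(lleg ?S \<odot> pl ?S (arr C)) \<triangleleft> kl_cund c = id2 K (lleg (mdom (ctgt c)))"
    using k c' by simp
  then show ?thesis
    unfolding span_cells_iff
    using c' k strict_lax[OF kl_map_strict[OF c'(1)]] strict_lax[OF kl_map_strict[OF c'(2)]] s t
    by simp
qed

lemma kl_cell_inject:
  assumes a: "a \<in> cells\<^sub>L" and b: "b \<in> cells\<^sub>L"
    and ab: "mcod (csrc a) = mcod (csrc b)" "kl_cell a = kl_cell b"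
  shows "a = b"
proof (rule span_cell_eqI)
  note a' = span_cellsD[OF a] and b' = span_cellsD[OF b]
  have k: "kl_map (csrc a) = kl_map (csrc b)" "kl_map (ctgt a) = kl_map (ctgt b)" "kl_cund a = kl_cund b"
    using ab(2) by (simp_all add: kl_cell_def)
  show "csrc a = csrc b"
    by (rule kl_map_inject) (use k a' b' ab in simp_all)
  show "ctgt a = ctgt b"
    by (rule kl_map_inject) (use k a' b' ab in simp_all)
  then show "cund a = cund b"
    using kl_cund(4)[OF a] kl_cund(4)[OF b] k(3) by simp
qed

text \<open>The square that a 2-cell into the arrow object fills is the condition on the 2-cells of the two lax maps.\<close>

lemma kl_cell_surj:
  assumes d: "d \<in> cells\<^sub>L" and s: "s \<in> lax" "csrc d = kl_map s"
    and t: "t \<in> lax" "ctgt d = kl_map t" and st: "mcod s = mcod t"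
  shows "\<exists>c \<in> cells\<^sub>L. csrc c = s \<and> ctgt c = t \<and> kl_cell c = d"
proof -
  note d' = span_cellsD[OF d, unfolded s(2) t(2) kl_map_sel]
  note s' = laxD[OF s(1)] kl_und[OF s(1)]
  note t' = laxD[OF t(1)] kl_und[OF t(1)]
  let ?S = "mcod t" and ?A = "arr C"
  let ?\<alpha> = "pl ?S ?A \<triangleleft> cund d"
  note S' = ldsD[OF t'(2)]
  have m: "mdom s = mdom t" using d' by simp
  have l: "lleg ?S \<triangleleft> ?\<alpha> = id2 K (lleg (mdom t))"
    using d'(8) d'(5-7) s' t' st S' by (simp add: lwhisker_lwhisker)
  have r: "(d1 C \<odot> pr ?S ?A) \<triangleleft> cund d = id2 K (rleg (mdom t))"
    using d'(9) d'(5-7) s' t' st S' m by simp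
  have "phi t \<bullet> (d0 C \<triangleleft> (pr ?S ?A \<triangleleft> cund d)) = (d1 C \<triangleleft> (pr ?S ?A \<triangleleft> cund d)) \<bullet> phi s"
    using slide[of "pr ?S ?A \<triangleleft> cund d" "chi C"] d'(5-7) s' t' st by simp
  moreover have "d1 C \<triangleleft> (pr ?S ?A \<triangleleft> cund d) = id2 K (rleg (mdom t))"
    using r d'(5-7) s' t' st by (simp add: lwhisker_lwhisker)
  moreover have "d0 C \<triangleleft> (pr ?S ?A \<triangleleft> cund d) = rleg ?S \<triangleleft> ?\<alpha>"
    using d'(5-7) s' t' st S' square[OF t'(2)] by (simp add: lwhisker_lwhisker)
  ultimately have p: "phi t \<bullet> (rleg ?S \<triangleleft> ?\<alpha>) = phi s"
    using s' m by simp
  let ?c = "SpanCell s ?\<alpha> t"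
  have c: "?c \<in> cells\<^sub>L"
    using s t st m l p d'(5-7) s' t' by (simp add: span_cells_iff)
  have "kl_cund ?c = cund d"
    by (rule kl_cund_eqI[OF c]) (use d'(5-7) r in simp_all)
  then have "kl_cell ?c = d"
    using s t by (intro span_cell_eqI) simp_all
  with c show ?thesis by (intro bexI[of _ ?c]) simp_all
qed

abbreviation "G1 s \<equiv> Over (mdom s) (kl_map s) (mcod s)"
abbreviation "G2 c \<equiv> Over (mdom (csrc c)) (kl_cell c) (mcod (csrc c))"

lemma kl_id: "S \<in> spans \<Longrightarrow> unt T S = kl_map (id_map S)"
proof (rule strict_eqI)
  assume S: "S \<in> spans"
  note u = post_unit[OF S] and I = lax_id[OF S]
  note k = kl_und[OF I]
  show "unt T S \<in> strict" "kl_map (id_map S) \<in> strict"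
    "mdom (unt T S) = mdom (kl_map (id_map S))" "mcod (unt T S) = mcod (kl_map (id_map S))"
    using u(1-3) kl_map_strict[OF I] by simp_all
  have "und (unt T S) = kl_und (id_map S)"
    by (rule composite_eqI1[OF S]) (use S u k strictD[OF u(1)] in simp_all)
  then show "und (unt T S) = und (kl_map (id_map S))" by simp
qed

text \<open>The multiplication composes the arrow named by the 2-cell of \<open>t\<close>, precomposed with \<open>s\<close>, with the arrow named by the
2-cell of \<open>s\<close>; this is the 2-cell of the composite lax map.\<close>

lemma kl_comp:
  assumes s: "s \<in> lax" and t: "t \<in> lax" and st: "mcod s = mdom t"
  shows "comp_map (mlt T (mcod t)) (comp_map (far T (kl_map t)) (kl_map s))
    = kl_map (comp_map t s)" (is "?l = _")
proof (rule strict_eqI)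
  note s' = laxD[OF s] kl_und[OF s]
  note t' = laxD[OF t] kl_und[OF t]
  note ts = lax_comp[OF s t st]
  let ?R = "mcod t" and ?A = "arr C"
  note m = post_mult[OF t'(2)] and f = post_far[OF kl_map_strict[OF t], unfolded kl_map_sel]
  have RA: "?R \<otimes> ?A \<in> spans" using t' by simp
  note M = strictD(3-5)[OF m(1), unfolded m(2,3)] and F = strictD(3-5)[OF f(1), unfolded f(2,3)]
  show "?l \<in> strict"
    by (intro strict_comp kl_map_strict s m f) (simp_all add: st m f)
  show "kl_map (comp_map t s) \<in> strict" by (rule kl_map_strict[OF ts])
  show "mdom ?l = mdom (kl_map (comp_map t s))" "mcod ?l = mcod (kl_map (comp_map t s))"
    by (simp_all add: m)
  let ?h = "und (mlt T ?R) \<odot> (und (far T (kl_map t)) \<odot> kl_und s)"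
  have h: "?h \<in> Ar K" "Dom K ?h = apex (mdom s)" "Cod K ?h = Dom K (pl ?R ?A)"
    using s' t' M F st RA by simp_all
  have u: "pl ?R ?A \<odot> ?h = und t \<odot> und s"
    using s' t' M F st RA
    by (simp add: cmp1_fuse[OF m(4)] cmp1_fuse[OF f(4)] cmp1_fuse[OF t'(13)])
  have "pr ?R ?A \<odot> ?h = (pr ?R ?A \<odot> und (mlt T ?R)) \<odot> (und (far T (kl_map t)) \<odot> kl_und s)"
    using s' t' M F st RA by simp
  then have "chi C \<triangleright> (pr ?R ?A \<odot> ?h) = (chi C \<triangleright> (pr ?R ?A \<odot> und (mlt T ?R))) \<triangleright> (und (far T (kl_map t)) \<odot> kl_und s)"
    using s' t' M F st RA by (simp add: rwhisker_rwhisker)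
  also have "\<dots> = (chi C \<triangleright> (pr (?R \<otimes> ?A) ?A \<odot> (und (far T (kl_map t)) \<odot> kl_und s)))
      \<bullet> (chi C \<triangleright> (pr ?R ?A \<odot> (pl (?R \<otimes> ?A) ?A \<odot> (und (far T (kl_map t)) \<odot> kl_und s))))"
    unfolding m(5) using s' t' M F st RA square[OF RA] by (simp add: rwhisker_vcmp rwhisker_rwhisker)
  also have "\<dots> = (chi C \<triangleright> (pr (mcod s) ?A \<odot> kl_und s)) \<bullet> (chi C \<triangleright> (pr ?R ?A \<odot> (kl_und t \<odot> und s)))"
    using s' t' M F st RA by (simp add: cmp1_fuse[OF f(4)] cmp1_fuse[OF f(5)])
  also have "\<dots> = phi s \<bullet> (phi t \<triangleright> und s)"
    using s' t' st rwhisker_rwhisker[of "chi C" "pr ?R ?A \<odot> kl_und t" "und s"] by simp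
  finally have v: "chi C \<triangleright> (pr ?R ?A \<odot> ?h) = phi s \<bullet> (phi t \<triangleright> und s)" .
  have "?h = kl_und (comp_map t s)"
    by (rule composite_eqI1[OF t'(2)]) (use h u v kl_und[OF ts] in simp_all)
  then show "und ?l = und (kl_map (comp_map t s))" by simp
qed

text \<open>Both sides have the same components: on the apex the projections of the multiplication leave the horizontal
composite, and on the \<open>d1\<close>-side only the identity that comes with \<open>a\<close> survives.\<close>

lemma kl_hcmp:
  assumes a: "a \<in> cells\<^sub>L" and b: "b \<in> cells\<^sub>L"
    and ab: "mcod (csrc a) = mdom (csrc b)"
  shows "kl_cund (b \<star>\<^bsub>L\<^esub> a) = und (mlt T (mcod (csrc b))) \<triangleleft> (cund (fce T (kl_cell b)) \<star> kl_cund a)"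
proof (rule kl_cund_eqI)
  note a' = span_cellsD[OF a] and b' = span_cellsD[OF b]
  note s = laxD[OF a'(1)] kl_und[OF a'(1)] and s' = laxD[OF a'(2)] kl_und[OF a'(2)]
  note t = laxD[OF b'(1)] kl_und[OF b'(1)] and t' = laxD[OF b'(2)] kl_und[OF b'(2)]
  note k = kl_cund[OF a] and l = kl_cund[OF b]
  let ?S = "mdom (csrc b)" and ?R = "mcod (csrc b)" and ?A = "arr C"
  have RA: "?R \<otimes> ?A \<in> spans" using t by simp
  note m = post_mult[OF t(2)]
  note M = strictD(3-5)[OF m(1), unfolded m(2,3)]
  note f = post_fce[OF kl_cell_mem[OF b], unfolded kl_cell_sel kl_map_sel,
      OF kl_map_strict[OF b'(1)] kl_map_strict[OF b'(2)]]
  note F = post_far[OF kl_map_strict[OF b'(1)], unfolded kl_map_sel]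
    and F' = post_far[OF kl_map_strict[OF b'(2)], unfolded kl_map_sel]
  note Fd = strictD(3-5)[OF F(1), unfolded F(2,3)] and F'd = strictD(3-5)[OF F'(1), unfolded F'(2,3)]
  let ?\<phi> = "cund (fce T (kl_cell b))"
  let ?g = "und (mlt T ?R) \<triangleleft> (?\<phi> \<star> kl_cund a)"
  note T = a'(3,4) b'(3,4) ab s(1-5) s'(1-5) t(1-5) t'(1-5) k(1-3) l(1-3) M f(3-5) Fd F'd
    s(10-12) s'(10-12) t(10-12) t'(10-12)
  have c: "?\<phi> \<star> kl_cund a \<in> Ce K"
    "Src K (?\<phi> \<star> kl_cund a) = und (far T (kl_map (csrc b))) \<odot> kl_und (csrc a)"
    "Tgt K (?\<phi> \<star> kl_cund a) = und (far T (kl_map (ctgt b))) \<odot> kl_und (ctgt a)"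
    using T by simp_all
  show "b \<star>\<^bsub>L\<^esub> a \<in> cells\<^sub>L" using cells_hcomp[OF a b ab] by simp
  show "?g \<in> Ce K" using T by simp
  show "Src K ?g = kl_und (csrc (b \<star>\<^bsub>L\<^esub> a))"
    using c T arg_cong[OF kl_comp[OF a'(1) b'(1) ab], of und] by simp
  show "Tgt K ?g = kl_und (ctgt (b \<star>\<^bsub>L\<^esub> a))"
    using c T arg_cong[OF kl_comp[OF a'(2) b'(2)], of und] by simp
  have "pl ?R ?A \<triangleleft> ?g = (pl ?R ?A \<odot> und (mlt T ?R)) \<triangleleft> (?\<phi> \<star> kl_cund a)"
    by (rule lwhisker_lwhisker) (use T in simp_all)
  also have "\<dots> = pl ?R ?A \<triangleleft> (pl (?R \<otimes> ?A) ?A \<triangleleft> (?\<phi> \<star> kl_cund a))"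
    unfolding m(4) by (rule lwhisker_lwhisker[symmetric]) (use T RA in simp_all)
  also have "\<dots> = pl ?R ?A \<triangleleft> ((pl (?R \<otimes> ?A) ?A \<triangleleft> ?\<phi>) \<star> kl_cund a)"
    using T RA by (simp add: lwhisker_hcmp)
  also have "\<dots> = pl ?R ?A \<triangleleft> (kl_cund b \<star> (pl ?S ?A \<triangleleft> kl_cund a))"
    unfolding f(6) using T by (simp add: rwhisker_hcmp)
  also have "\<dots> = (pl ?R ?A \<triangleleft> kl_cund b) \<star> (pl ?S ?A \<triangleleft> kl_cund a)"
    using T by (simp add: lwhisker_hcmp)
  also have "\<dots> = cund b \<star> cund a"
    using k(4) l(4) T by simp
  finally show "pl (mcod (ctgt (b \<star>\<^bsub>L\<^esub> a))) ?A \<triangleleft> ?g = cund (b \<star>\<^bsub>L\<^esub> a)"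
    using T by simp
  have "(d1 C \<odot> pr ?R ?A) \<triangleleft> ?g = (d1 C \<odot> (pr ?R ?A \<odot> und (mlt T ?R))) \<triangleleft> (?\<phi> \<star> kl_cund a)"
    using T by (simp add: lwhisker_lwhisker)
  also have "\<dots> = d1 C \<triangleleft> (pr (?R \<otimes> ?A) ?A \<triangleleft> (?\<phi> \<star> kl_cund a))"
    unfolding m(6) by (rule lwhisker_lwhisker[symmetric]) (use T RA in simp_all)
  also have "\<dots> = d1 C \<triangleleft> ((pr (?R \<otimes> ?A) ?A \<triangleleft> ?\<phi>) \<star> kl_cund a)"
    using T RA by (simp add: lwhisker_hcmp)
  also have "\<dots> = (d1 C \<odot> pr ?S ?A) \<triangleleft> kl_cund a"
    unfolding f(7) using T lwhisker_lwhisker[of "kl_cund a" "pr ?S ?A" "d1 C"] by (simp add: lwhisker_def)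
  also have "\<dots> = id2 K (rleg (mdom (csrc a)))"
    using k(5) T by simp
  finally show "(d1 C \<odot> pr (mcod (ctgt (b \<star>\<^bsub>L\<^esub> a))) ?A) \<triangleleft> ?g = id2 K (rleg (mdom (ctgt (b \<star>\<^bsub>L\<^esub> a))))"
    using T by simp
qed

lemma kl_vcmp:
  assumes a: "a \<in> cells\<^sub>L" and b: "b \<in> cells\<^sub>L" and ab: "ctgt a = csrc b"
  shows "kl_cund (b \<bullet>\<^bsub>L\<^esub> a) = kl_cund b \<bullet> kl_cund a"
proof (rule kl_cund_eqI)
  note a' = span_cellsD[OF a] and b' = span_cellsD[OF b]
  note s = laxD[OF a'(1)] kl_und[OF a'(1)] and s' = laxD[OF a'(2)] kl_und[OF a'(2)]
  note t' = laxD[OF b'(2)] kl_und[OF b'(2)]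
  note k = kl_cund[OF a] and l = kl_cund[OF b]
  show "b \<bullet>\<^bsub>L\<^esub> a \<in> cells\<^sub>L" using cells_vcomp[OF a b ab] by simp
  show "kl_cund b \<bullet> kl_cund a \<in> Ce K" "Src K (kl_cund b \<bullet> kl_cund a) = kl_und (csrc (b \<bullet>\<^bsub>L\<^esub> a))"
    "Tgt K (kl_cund b \<bullet> kl_cund a) = kl_und (ctgt (b \<bullet>\<^bsub>L\<^esub> a))"
    using k l ab by simp_all
  show "pl (mcod (ctgt (b \<bullet>\<^bsub>L\<^esub> a))) (arr C) \<triangleleft> (kl_cund b \<bullet> kl_cund a) = cund (b \<bullet>\<^bsub>L\<^esub> a)"
    "(d1 C \<odot> pr (mcod (ctgt (b \<bullet>\<^bsub>L\<^esub> a))) (arr C)) \<triangleleft> (kl_cund b \<bullet> kl_cund a) =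
      id2 K (rleg (mdom (ctgt (b \<bullet>\<^bsub>L\<^esub> a))))"
    using k l ab a'(3,4) b'(3,4) s t' by (simp_all add: lwhisker_vcmp)
qed

lemma kl_id2:
  assumes s: "s \<in> lax"
  shows "kl_cund (id2 L s) = id2 K (kl_und s)"
proof (rule kl_cund_eqI)
  note s' = laxD[OF s] kl_und[OF s]
  show "id2 L s \<in> cells\<^sub>L" using s s' by (simp add: span_cells_iff)
qed (use laxD[OF s] kl_und[OF s] in simp_all)

lemma kleisli_iso: "two_category_iso L KlT (\<lambda>S. S) G1 G2"
proof (intro two_category_iso.intro two_category_iso_axioms.intro)
  show "two_category L" by (rule dSpan_lax_two_category)
  show "bij_betw (\<lambda>S. S) (Ob L) (Ob KlT)" by (simp add: bij_betw_def)
  show "bij_betw G1 (Ar L) (Ar KlT)"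
    unfolding bij_betw_def
  proof (intro conjI equalityI subsetI)
    show "inj_on G1 (Ar L)" by (auto simp: inj_on_def intro: kl_map_inject)
    show "k \<in> Ar KlT" if "k \<in> G1 ` Ar L" for k
      using that laxD(1,2) kl_map_strict by (auto simp: Kl_Ar)
    show "k \<in> G1 ` Ar L" if "k \<in> Ar KlT" for k
    proof -
      from that obtain s where "s \<in> lax" "mdom s = mdom (ocell k)" "mcod s = ocod k" "kl_map s = ocell k"
        by (auto simp: Kl_Ar elim: kl_map_surj)
      with that show ?thesis by (intro image_eqI[of _ _ s] over_eqI) (simp_all add: Kl_Ar)
    qed
  qed
  show "bij_betw G2 (Ce L) (Ce KlT)"
    unfolding bij_betw_def
  proof (intro conjI equalityI subsetI)
    show "inj_on G2 (Ce L)" by (auto simp: inj_on_def intro: kl_cell_inject)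
    show "k \<in> Ce KlT" if k: "k \<in> G2 ` Ce L" for k
    proof -
      obtain c where c: "c \<in> cells\<^sub>L" "k = G2 c" using k by auto
      note c' = span_cellsD[OF c(1)]
      show ?thesis
        using c(2) kl_cell_mem[OF c(1)] laxD(1,2)[OF c'(1)] c'(3,4) kl_map_strict[OF c'(1)] kl_map_strict[OF c'(2)]
        by (simp add: Kl_Ce)
    qed
    show "k \<in> G2 ` Ce L" if "k \<in> Ce KlT" for k
    proof -
      note k = that[unfolded Kl_Ce]
      obtain s where s: "s \<in> lax" "mdom s = mdom (csrc (ocell k))" "mcod s = ocod k" "kl_map s = csrc (ocell k)"
        using k by (elim conjE kl_map_surj)
      obtain t where t: "t \<in> lax" "mdom t = mdom (ctgt (ocell k))" "mcod t = ocod k" "kl_map t = ctgt (ocell k)"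
        using k kl_map_surj[of "ctgt (ocell k)" "ocod k"] by blast
      obtain c where c: "c \<in> cells\<^sub>L" "csrc c = s" "kl_cell c = ocell k"
        using kl_cell_surj[of "ocell k" s t] s t k by auto
      with s k show ?thesis by (intro image_eqI[of _ _ c] over_eqI) simp_all
    qed
  qed
  show "id1 KlT a = G1 (id1 L a)" if "a \<in> Ob L" for a
    using that kl_id by simp
  show "G1 g \<odot>\<^bsub>KlT\<^esub> G1 f = G1 (g \<odot>\<^bsub>L\<^esub> f)" if "f \<in> Ar L" "g \<in> Ar L" "Cod L f = Dom L g" for f g
    using that kl_comp[of f g] by simp
  show "id2 KlT (G1 f) = G2 (id2 L f)" if "f \<in> Ar L" for f
    using that kl_id2[of f] by (simp add: kl_cell_def)
  show "G2 b \<bullet>\<^bsub>KlT\<^esub> G2 a = G2 (b \<bullet>\<^bsub>L\<^esub> a)" if "a \<in> Ce L" "b \<in> Ce L" "Tgt L a = Src L b" for a b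
    using that kl_vcmp[of a b] span_cellsD(4)[of a B C] by (simp add: kl_cell_def)
  show "G2 b \<star>\<^bsub>KlT\<^esub> G2 a = G2 (b \<star>\<^bsub>L\<^esub> a)"
    if "a \<in> Ce L" "b \<in> Ce L" "Cod L (Src L a) = Dom L (Src L b)" for a b
  proof -
    have a: "a \<in> cells\<^sub>L" and b: "b \<in> cells\<^sub>L" and ab: "mcod (csrc a) = mdom (csrc b)"
      using that by simp_all
    note a' = span_cellsD[OF a] and b' = span_cellsD[OF b]
    note f = post_fce[OF kl_cell_mem[OF b], unfolded kl_cell_sel kl_map_sel,
      OF kl_map_strict[OF b'(1)] kl_map_strict[OF b'(2)]]
    show ?thesis
      using kl_hcmp[OF a b ab] kl_comp[OF a'(1) b'(1) ab] kl_comp[OF a'(2) b'(2)] ab a'(3,4) b'(3,4) f(1,2)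
      by (simp add: kl_cell_def)
  qed
qed (auto simp: span_cellsD(3,4))


section \<open>Fibrations as algebras\<close>

abbreviation "P \<equiv> pre B"
abbreviation "M \<equiv> pre_arrow_Kl K D pb ar B C"

lemma comma_proj [simp]:
  assumes "S \<in> spans"
  shows "pl (arr B) S \<in> Ar K" "Cod K (pl (arr B) S) = Dom K (d0 B)" "pr (arr B) S \<in> Ar K"
    "Dom K (pr (arr B) S) = Dom K (pl (arr B) S)" "Cod K (pr (arr B) S) = apex S"
    "arr B \<otimes> S \<in> spans"
  using span_proj[OF arr_lds[OF B] assms] span_comp_lds[OF arr_lds[OF B] assms] by simp_all

lemma comma_square: "S \<in> spans \<Longrightarrow> d1 B \<odot> pl (arr B) S = lleg S \<odot> pr (arr B) S"
  using span_square[OF arr_lds[OF B], of S C] by simp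

lemma comma_pullback: "S \<in> spans \<Longrightarrow> is_pullback K (d1 B) (lleg S) (pl (arr B) S) (pr (arr B) S)"
  using span_pullback[OF arr_lds[OF B], of S C] by simp

lemma comma_pb_eq: "S \<in> spans \<Longrightarrow> comma_pb K pb ar (lleg S) = span_pb pb (arr B) S"
  by (simp add: comma_pb_def span_pb_def split_beta)

lemma comma_d0_eq: "S \<in> spans \<Longrightarrow> comma_d0 K pb ar (lleg S) = d0 B \<odot> pl (arr B) S"
  by (simp add: comma_d0_def comma_pb_eq split_beta)

lemma id_name:
  assumes S: "S \<in> spans"
  shows "idn S \<in> Ar K" "Dom K (idn S) = apex S"
    "Cod K (idn S) = Dom K (pl (arr B) S)"
    "pl (arr B) S \<odot> idn S = named B (id2 K (lleg S))"
    "pr (arr B) S \<odot> idn S = id1 K (apex S)"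
  using tup1_span[OF arr_lds[OF B] S, of "named B (id2 K (lleg S))" "id1 K (apex S)"]
    arrow_named[of "id2 K (lleg S)" B] ldsD[OF S] S
  by (simp_all add: id_name_def comma_pb_eq)

lemma unt_eq_id_name:
  assumes S: "S \<in> spans"
  shows "und (unt P S) = idn S"
  by (rule pullback_eqI1[OF comma_pullback[OF S]])
    (use id_name[OF S] pre_unit[OF S] strictD(3-5)[OF pre_unit(1)[OF S]] in simp_all)

lemma unt_lax:
  assumes S: "S \<in> spans"
  shows "unt P S \<in> lax" "mdom (unt P S) = S" "mcod (unt P S) = arr B \<otimes> S"
    "phi (unt P S) = id2 K (rleg S)"
  using pre_unit[OF S] strictD(8)[OF pre_unit(1)[OF S]] strict_lax by auto

text \<open>This is the free functor to the Kleisli 2-category, which turns the unit of the monad into the unit of its lift.\<close>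

lemma unt_strict_eq_kl_map:
  assumes f: "f \<in> strict"
  shows "comp_map (unt T (mcod f)) f = kl_map f"
proof -
  note f' = strictD[OF f]
  note u = post_unit[OF f'(2)]
  note k = kl_und[OF strict_lax[OF f]]
  note U = strictD(3-5)[OF u(1), unfolded u(2,3)]
  show ?thesis
  proof (rule strict_eqI)
    show "comp_map (unt T (mcod f)) f \<in> strict" by (rule strict_comp[OF f u(1)]) (simp add: u)
    show "kl_map f \<in> strict" by (rule kl_map_strict[OF strict_lax[OF f]])
    have "chi C \<triangleright> (pr (mcod f) (arr C) \<odot> (und (unt T (mcod f)) \<odot> und f)) =
        (chi C \<triangleright> (pr (mcod f) (arr C) \<odot> und (unt T (mcod f)))) \<triangleright> und f"
      using f' U by (simp add: rwhisker_rwhisker)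
    also have "\<dots> = phi f"
      unfolding u(5) using f' by simp
    finally have v: "chi C \<triangleright> (pr (mcod f) (arr C) \<odot> (und (unt T (mcod f)) \<odot> und f)) = phi f" .
    have "und (unt T (mcod f)) \<odot> und f = kl_und f"
      by (rule composite_eqI1[OF f'(2)]) (use f' U u(4) k v in \<open>simp_all add: cmp1_fuse[OF u(4)]\<close>)
    then show "und (comp_map (unt T (mcod f)) f) = und (kl_map f)" by simp
  qed (simp_all add: u)
qed

lemma M_fob: "fob M S = arr B \<otimes> S"
  by (simp add: pre_arrow_Kl_def Kl_lift_def pre_arrow_def Let_def)

lemma M_unt:
  assumes S: "S \<in> spans" shows "unt M S = G1 (unt P S)"
proof -
  have "fob P S = arr B \<otimes> S" by (simp add: pre_arrow_def Let_def)
  then have "unt M S = Over S (comp_map (unt T (arr B \<otimes> S)) (unt P S)) (arr B \<otimes> S)"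
    by (simp add: pre_arrow_Kl_def Kl_lift_def)
  then show ?thesis
    using unt_strict_eq_kl_map[OF pre_unit(1)[OF S]] unt_lax[OF S] by simp
qed

definition comma_span_map :: "('o, 'm, 'c) span_map \<Rightarrow> ('o, 'm, 'c) span_map" where
  "comma_span_map s = SpanMap (arr B \<otimes> mdom s) (comma (mdom s) (mcod s) (und s))
     (phi s \<triangleright> pr (arr B) (mdom s)) (arr B \<otimes> mcod s)"

lemma comma_span_map_sel [simp]:
  "mdom (comma_span_map s) = arr B \<otimes> mdom s" "mcod (comma_span_map s) = arr B \<otimes> mcod s"
  "und (comma_span_map s) = comma (mdom s) (mcod s) (und s)"
  "phi (comma_span_map s) = phi s \<triangleright> pr (arr B) (mdom s)"
  by (simp_all add: comma_span_map_def)

lemma comma_map: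
  assumes S: "S \<in> spans" and R: "R \<in> spans"
    and k: "k \<in> Ar K" "Dom K k = apex S" "Cod K k = apex R" "lleg R \<odot> k = lleg S"
  shows "comma S R k \<in> Ar K"
    "Dom K (comma S R k) = Dom K (pl (arr B) S)"
    "Cod K (comma S R k) = Dom K (pl (arr B) R)"
    "pl (arr B) R \<odot> comma S R k = pl (arr B) S"
    "pr (arr B) R \<odot> comma S R k = k \<odot> pr (arr B) S"
  using tup1_span[OF arr_lds[OF B] R, of "pl (arr B) S" "k \<odot> pr (arr B) S"] ldsD[OF S] ldsD[OF R] S R k
    comma_square[OF S] cmp1_fuse[OF k(4)]
  by (simp_all add: comma_map_def comma_pb_eq split_beta)

lemma comma_span_map_lax:
  assumes s: "s \<in> lax" shows "comma_span_map s \<in> lax"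
proof -
  note s' = laxD[OF s]
  note c = comma_map[OF s'(1,2) s'(3-6)]
  note m = ldsD[OF s'(1)] ldsD[OF s'(2)]
  show ?thesis
    using s' c m by (simp add: lax_iff cmp1_fuse[OF c(4)])
qed

text \<open>The distributive law only changes the bracketing, so the 2-cell of \<open>s\<close> is whiskered by the projection and otherwise
untouched.\<close>

lemma M_far:
  assumes s: "s \<in> lax"
  shows "far M (G1 s) = G1 (comma_span_map s)"
proof -
  let ?S = "mdom s" and ?R = "mcod s"
  note s' = laxD[OF s]
  note c = comma_map[OF s'(1,2) s'(3-6)]
  note k = kl_und[OF s]
  note cl = comma_span_map_lax[OF s]
  note ck = kl_und[OF cl]
  note m = ldsD[OF s'(1)] ldsD[OF s'(2)]
  have RC: "?R \<otimes> arr C \<in> spans" using s' by simp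
  let ?a = "associator_inv K pb (arr B) ?R (arr C)"
  let ?f = "comp1 (id_map (arr B)) (kl_map s)"
  note a = associator_inv[OF arr_lds[OF B] s'(2) arr_lds[OF C]]
  note f = span_comp1[OF strict_id[OF arr_lds[OF B]] kl_map_strict[OF s], unfolded span_maps_id_sel kl_map_sel]
  note F = strictD(3-5)[OF f(1)]
  note A = strictD(3-5)[OF a(1), unfolded a(2,3)]
  let ?h = "und ?a \<odot> und ?f"
  let ?BR = "arr B \<otimes> ?R"
  have BR: "?BR \<in> spans" using s' by simp
  have Fd: "und ?f \<in> Ar K" "Dom K (und ?f) = Dom K (pl (arr B) ?S)"
    "Cod K (und ?f) = Dom K (pl (arr B) (?R \<otimes> arr C))"
    using F by simp_all
  have Ad: "und ?a \<in> Ar K" "Dom K (und ?a) = Dom K (pl (arr B) (?R \<otimes> arr C))"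
    "Cod K (und ?a) = Dom K (pl ?BR (arr C))"
    using A by simp_all
  have f2: "pl (arr B) (?R \<otimes> arr C) \<odot> und ?f = pl (arr B) ?S"
    "pr (arr B) (?R \<otimes> arr C) \<odot> und ?f = kl_und s \<odot> pr (arr B) ?S"
    using f(2,3) s' by (simp_all del: span_comp1_sel(4))
  note facts = s'(1-5) RC BR Fd Ad k(1-3) ck(1-3)[unfolded comma_span_map_sel]
  have h: "?h \<in> Ar K" "Dom K ?h = Dom K (pl (arr B) ?S)" "Cod K ?h = Dom K (pl ?BR (arr C))"
    using Fd Ad by (simp_all del: span_comp1_sel(4))
  have 1: "pl (arr B) ?R \<odot> (pl ?BR (arr C) \<odot> ?h) = pl (arr B) ?S"
  proof -
    have "pl (arr B) ?R \<odot> (pl ?BR (arr C) \<odot> ?h) = (pl (arr B) ?R \<odot> (pl ?BR (arr C) \<odot> und ?a)) \<odot> und ?f"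
      using facts by (simp del: span_comp1_sel(4))
    then show ?thesis unfolding a(6) f2 .
  qed
  have 2: "pr (arr B) ?R \<odot> (pl ?BR (arr C) \<odot> ?h) = und s \<odot> pr (arr B) ?S"
  proof -
    have "pr (arr B) ?R \<odot> (pl ?BR (arr C) \<odot> ?h) = (pr (arr B) ?R \<odot> (pl ?BR (arr C) \<odot> und ?a)) \<odot> und ?f"
      using facts by (simp del: span_comp1_sel(4))
    also have "\<dots> = pl ?R (arr C) \<odot> (pr (arr B) (?R \<otimes> arr C) \<odot> und ?f)"
      unfolding a(5) using facts by (simp del: span_comp1_sel(4))
    also have "\<dots> = und s \<odot> pr (arr B) ?S"
      unfolding f2 using facts by (simp add: cmp1_fuse[OF k(4)])
    finally show ?thesis .
  qed
  have 3: "pr ?BR (arr C) \<odot> ?h = pr ?R (arr C) \<odot> (kl_und s \<odot> pr (arr B) ?S)"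
  proof -
    have "pr ?BR (arr C) \<odot> ?h = (pr ?BR (arr C) \<odot> und ?a) \<odot> und ?f"
      using facts by (simp del: span_comp1_sel(4))
    also have "\<dots> = pr ?R (arr C) \<odot> (pr (arr B) (?R \<otimes> arr C) \<odot> und ?f)"
      unfolding a(4) using facts by (simp del: span_comp1_sel(4))
    finally show ?thesis unfolding f2 .
  qed
  have u: "pl ?BR (arr C) \<odot> ?h = und (comma_span_map s)"
    by (rule pullback_eqI1[OF comma_pullback[OF s'(2)]])
      (use facts h 1 2 c in \<open>simp_all del: span_comp1_sel(4)\<close>)
  have v: "chi C \<triangleright> (pr ?BR (arr C) \<odot> ?h) = phi (comma_span_map s)"
    unfolding 3 using facts k(5) rwhisker_rwhisker[of "chi C" "pr ?R (arr C) \<odot> kl_und s" "pr (arr B) ?S"] by simp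
  have "?h = kl_und (comma_span_map s)"
    by (rule composite_eqI1[OF BR])
      (use facts h u v ck in \<open>simp_all del: span_comp1_sel(4)\<close>)
  then have "comp_map ?a ?f = kl_map (comma_span_map s)"
    by (intro strict_eqI[OF strict_comp[OF f(1) a(1)] kl_map_strict[OF cl]])
      (simp_all add: a del: span_comp1_sel(4))
  then show ?thesis
    by (simp add: pre_arrow_Kl_def Kl_lift_def pre_arrow_def Let_def)
qed

lemma comma_natural:
  assumes S: "S \<in> spans" and R: "R \<in> spans"
    and k: "k \<in> Ar K" "Dom K k = apex S" "Cod K k = apex R" "lleg R \<odot> k = lleg S"
  shows "idn R \<odot> k = comma S R k \<odot> idn S"
proof (rule pullback_eqI1[OF comma_pullback[OF R]])
  note c = comma_map[OF S R k] and nS = id_name[OF S] and nR = id_name[OF R]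
  note m = ldsD[OF S] ldsD[OF R]
  note aS = arrow_named[of "id2 K (lleg S)" B] and aR = arrow_named[of "id2 K (lleg R)" B]
  have "named B (id2 K (lleg R)) \<odot> k = named B (id2 K (lleg S))"
    by (rule arrow_eqI1[OF arrow_object[OF B]])
      (use m k aS aR rwhisker_rwhisker[of "chi B" "named B (id2 K (lleg R))" k] in simp_all)
  then show "pl (arr B) R \<odot> (idn R \<odot> k) =
      pl (arr B) R \<odot> (comma S R k \<odot> idn S)"
    using c nS nR R S k by (simp add: cmp1_fuse[OF nR(4)] cmp1_fuse[OF c(4)])
  show "pr (arr B) R \<odot> (idn R \<odot> k) =
      pr (arr B) R \<odot> (comma S R k \<odot> idn S)"
    using c nS nR R S k by (simp add: cmp1_fuse[OF nR(5)] cmp1_fuse[OF c(5)])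
qed (use comma_map[OF S R k] id_name[OF S] id_name[OF R] k in simp_all)

lemma comma_map_id:
  assumes S: "S \<in> spans"
  shows "comma S S (id1 K (apex S)) = id1 K (Dom K (pl (arr B) S))"
  by (rule pullback_eqI1[OF comma_pullback[OF S]])
    (use comma_map[OF S S, of "id1 K (apex S)"] ldsD[OF S] S in simp_all)

lemma comma_map_comp:
  assumes S: "S \<in> spans" and R: "R \<in> spans" and Q: "Q \<in> spans"
    and k: "k \<in> Ar K" "Dom K k = apex S" "Cod K k = apex R" "lleg R \<odot> k = lleg S"
    and l: "l \<in> Ar K" "Dom K l = apex R" "Cod K l = apex Q" "lleg Q \<odot> l = lleg R"
  shows "comma S Q (l \<odot> k) =
    comma R Q l \<odot> comma S R k"
proof -
  note c = comma_map[OF S R k] and d = comma_map[OF R Q l]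
  have lk: "l \<odot> k \<in> Ar K" "Dom K (l \<odot> k) = apex S" "Cod K (l \<odot> k) = apex Q" "lleg Q \<odot> (l \<odot> k) = lleg S"
    using k l ldsD[OF Q] cmp1_fuse[OF l(4)] by simp_all
  note e = comma_map[OF S Q lk]
  show ?thesis
    by (rule pullback_eqI1[OF comma_pullback[OF Q]])
      (use c d e S R Q k l in \<open>simp_all add: cmp1_fuse[OF d(4)] cmp1_fuse[OF d(5)]\<close>)
qed

lemma comma_span_map_natural:
  assumes s: "s \<in> lax"
  shows "comp_map (unt P (mcod s)) s = comp_map (comma_span_map s) (unt P (mdom s))"
proof (rule span_map_eqI)
  note s' = laxD[OF s]
  note m = ldsD[OF s'(1)] ldsD[OF s'(2)]
  note uS = unt_lax[OF s'(1)] and uR = unt_lax[OF s'(2)]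
  note nS = id_name[OF s'(1)] and nR = id_name[OF s'(2)]
  show "und (comp_map (unt P (mcod s)) s) = und (comp_map (comma_span_map s) (unt P (mdom s)))"
    using comma_natural[OF s'(1,2) s'(3-6)] by (simp add: unt_eq_id_name s')
  have "phi s \<triangleright> pr (arr B) (mdom s) \<triangleright> idn (mdom s) = phi s"
    using s' nS m by (simp add: rwhisker_rwhisker)
  then show "phi (comp_map (unt P (mcod s)) s) = phi (comp_map (comma_span_map s) (unt P (mdom s)))"
    using s' uS uR m by (simp add: unt_eq_id_name)
qed (use unt_lax[OF laxD(1)[OF s]] unt_lax[OF laxD(2)[OF s]] in simp_all)

lemma fibrationD:
  assumes S: "S \<in> spans" and fib_S: "fib S (pull, \<eta>, \<epsilon>)"
  shows "adjunction K (idn S) pull \<eta> \<epsilon>"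
    "pull \<in> Ar K" "Dom K pull = Dom K (pl (arr B) S)" "Cod K pull = apex S"
    "\<eta> \<in> Ce K" "Src K \<eta> = id1 K (apex S)" "Tgt K \<eta> = pull \<odot> idn S"
    "\<epsilon> \<in> Ce K" "Src K \<epsilon> = idn S \<odot> pull" "Tgt K \<epsilon> = id1 K (Dom K (pl (arr B) S))"
    "(\<epsilon> \<triangleright> idn S) \<bullet> (idn S \<triangleleft> \<eta>) = id2 K (idn S)"
    "(pull \<triangleleft> \<epsilon>) \<bullet> (\<eta> \<triangleright> pull) = id2 K pull"
    "lleg S \<odot> pull = d0 B \<odot> pl (arr B) S" "lleg S \<triangleleft> \<eta> = id2 K (lleg S)"
    "(d0 B \<odot> pl (arr B) S) \<triangleleft> \<epsilon> = id2 K (d0 B \<odot> pl (arr B) S)"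
  using fib_S adjunction_iff[OF id_name(1)[OF S], of pull \<eta> \<epsilon>] id_name[OF S] comma_d0_eq[OF S]
  by (auto simp: fibration_def)

text \<open>Let \<open>n\<close> be the name of the identity of \<open>p\<close>.  The first triangle identity makes \<open>\<sigma> = \<partial>\<^sub>1 \<epsilon> n\<close> a left inverse of the unit.
It is also a right inverse: \<open>\<epsilon> n\<close> is a 2-cell between names of identities with trivial \<open>d0\<close>-side, so \<open>\<sigma>\<close> is vertical and
\<open>\<epsilon> n = n \<sigma>\<close>; now naturality of the unit and the second triangle identity apply.\<close>

lemma fibration_unit_iso:
  assumes S: "S \<in> spans" and fib_S: "fib S (pull, \<eta>, \<epsilon>)"
  shows "iso2 K \<eta>"
proof -
  let ?n = "idn S" and ?u = "pl (arr B) S" and ?v = "pr (arr B) S"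
  note F = fibrationD[OF S fib_S]
  note T = F(2-10) id_name[OF S] ldsD[OF S]
  define \<sigma> where "\<sigma> = ?v \<triangleleft> (\<epsilon> \<triangleright> ?n)"
  have \<sigma>: "\<sigma> \<in> Ce K" "Src K \<sigma> = pull \<odot> ?n" "Tgt K \<sigma> = id1 K (apex S)"
    using T S unfolding \<sigma>_def by (simp_all add: cmp1_fuse[OF id_name(5)[OF S]])
  have 1: "\<sigma> \<bullet> \<eta> = id2 K (id1 K (apex S))"
  proof -
    have "?v \<triangleleft> ((\<epsilon> \<triangleright> ?n) \<bullet> (?n \<triangleleft> \<eta>)) = id2 K (id1 K (apex S))"
      unfolding F(11) using T S by simp
    moreover have "?v \<triangleleft> ((\<epsilon> \<triangleright> ?n) \<bullet> (?n \<triangleleft> \<eta>)) = \<sigma> \<bullet> \<eta>"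
      unfolding \<sigma>_def using T S by (simp add: lwhisker_vcmp lwhisker_lwhisker)
    ultimately show ?thesis by simp
  qed
  have e: "\<epsilon> \<triangleright> ?n \<in> Ce K" "Src K (\<epsilon> \<triangleright> ?n) = ?n \<odot> (pull \<odot> ?n)" "Tgt K (\<epsilon> \<triangleright> ?n) = ?n"
    using T by simp_all
  have d0e: "d0 B \<triangleleft> (?u \<triangleleft> (\<epsilon> \<triangleright> ?n)) = id2 K (lleg S)"
  proof -
    have "d0 B \<triangleleft> (?u \<triangleleft> (\<epsilon> \<triangleright> ?n)) = ((d0 B \<odot> ?u) \<triangleleft> \<epsilon>) \<triangleright> ?n"
      using T S by (simp add: lwhisker_lwhisker whisker_whisker)
    then show ?thesis
      unfolding F(15) using T S arrow_named[of "id2 K (lleg S)" B] by simp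
  qed
  \<comment> \<open>the square filled by \<open>\<epsilon> n\<close> has identities on three sides, hence on the fourth\<close>
  have vert: "lleg S \<triangleleft> \<sigma> = id2 K (lleg S)"
  proof -
    have n: "named B (id2 K (lleg S)) \<in> Ar K" "Dom K (named B (id2 K (lleg S))) = apex S"
      "chi B \<triangleright> named B (id2 K (lleg S)) = id2 K (lleg S)"
      "d0 B \<odot> named B (id2 K (lleg S)) = lleg S"
      "d1 B \<odot> named B (id2 K (lleg S)) = lleg S"
      "Cod K (named B (id2 K (lleg S))) = Dom K (d0 B)"
      using arrow_named[of "id2 K (lleg S)" B] T by simp_all
    let ?a = "named B (id2 K (lleg S))"
    have c: "chi B \<triangleright> (?a \<odot> (pull \<odot> ?n)) = id2 K (lleg S)"
    proof -
      have "chi B \<triangleright> (?a \<odot> (pull \<odot> ?n)) = (chi B \<triangleright> ?a) \<triangleright> (pull \<odot> ?n)"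
        by (rule rwhisker_rwhisker[symmetric]) (use n T in simp_all)
      also have "\<dots> = id2 K (lleg S \<odot> (pull \<odot> ?n))"
        unfolding n(3) using T by simp
      also have "lleg S \<odot> (pull \<odot> ?n) = lleg S"
        using T S F(13) n by (simp add: cmp1_fuse[OF F(13)])
      finally show ?thesis .
    qed
    have src: "?u \<odot> (?n \<odot> (pull \<odot> ?n)) = ?a \<odot> (pull \<odot> ?n)"
      using T S by (simp add: cmp1_fuse[OF id_name(4)[OF S]])
    have d1: "d1 B \<triangleleft> (?u \<triangleleft> (\<epsilon> \<triangleright> ?n)) = lleg S \<triangleleft> \<sigma>"
      unfolding \<sigma>_def using T S e comma_square[OF S] by (simp add: lwhisker_lwhisker)
    have "(chi B \<triangleright> ?a) \<bullet> (d0 B \<triangleleft> (?u \<triangleleft> (\<epsilon> \<triangleright> ?n)))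
        = (d1 B \<triangleleft> (?u \<triangleleft> (\<epsilon> \<triangleright> ?n))) \<bullet> (chi B \<triangleright> (?a \<odot> (pull \<odot> ?n)))"
      using slide[of "?u \<triangleleft> (\<epsilon> \<triangleright> ?n)" "chi B"] T S e src n(1,2,6) by simp
    then have "id2 K (lleg S) = (lleg S \<triangleleft> \<sigma>) \<bullet> id2 K (lleg S)"
      unfolding d0e c d1 n using T by simp
    moreover have "Src K (lleg S \<triangleleft> \<sigma>) = lleg S"
      using \<sigma> T S F(13) n(4) by (simp add: cmp1_fuse[OF F(13)])
    ultimately show ?thesis using \<sigma> T by simp
  qed
  \<comment> \<open>both sides have the component \<open>\<sigma>\<close> in \<open>E\<close> and trivial component in the arrow object\<close>
  have n\<sigma>: "?n \<triangleleft> \<sigma> = \<epsilon> \<triangleright> ?n"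
  proof (rule pullback_eqI2[OF comma_pullback[OF S]])
    show "?v \<triangleleft> (?n \<triangleleft> \<sigma>) = ?v \<triangleleft> (\<epsilon> \<triangleright> ?n)"
      using \<sigma> T S by (simp add: lwhisker_lwhisker \<sigma>_def[symmetric])
    have dd: "d0 B \<triangleleft> (?u \<triangleleft> (?n \<triangleleft> \<sigma>)) = lleg S \<triangleleft> \<sigma>" "d1 B \<triangleleft> (?u \<triangleleft> (?n \<triangleleft> \<sigma>)) = lleg S \<triangleleft> \<sigma>"
      using \<sigma> T S arrow_named[of "id2 K (lleg S)" B] by (simp_all add: lwhisker_lwhisker)
    have d1: "d1 B \<triangleleft> (?u \<triangleleft> (\<epsilon> \<triangleright> ?n)) = lleg S \<triangleleft> \<sigma>"
      unfolding \<sigma>_def using T S e comma_square[OF S] by (simp add: lwhisker_lwhisker)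
    show "?u \<triangleleft> (?n \<triangleleft> \<sigma>) = ?u \<triangleleft> (\<epsilon> \<triangleright> ?n)"
      by (rule arrow_eqI2[OF arrow_object[OF B]]) (use dd d0e d1 vert \<sigma> e T S in simp_all)
  qed (use \<sigma> e T S in simp_all)
  have 2: "\<eta> \<bullet> \<sigma> = id2 K (pull \<odot> ?n)"
  proof -
    have "\<eta> \<bullet> \<sigma> = ((pull \<odot> ?n) \<triangleleft> \<sigma>) \<bullet> (\<eta> \<triangleright> (pull \<odot> ?n))"
      using slide[of \<sigma> \<eta>] \<sigma> T by simp
    also have "(pull \<odot> ?n) \<triangleleft> \<sigma> = pull \<triangleleft> (\<epsilon> \<triangleright> ?n)"
      unfolding n\<sigma>[symmetric] using \<sigma> T by (simp add: lwhisker_lwhisker)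
    also have "(pull \<triangleleft> (\<epsilon> \<triangleright> ?n)) \<bullet> (\<eta> \<triangleright> (pull \<odot> ?n)) = ((pull \<triangleleft> \<epsilon>) \<bullet> (\<eta> \<triangleright> pull)) \<triangleright> ?n"
      using T by (simp add: rwhisker_vcmp rwhisker_rwhisker whisker_whisker)
    also have "\<dots> = id2 K (pull \<odot> ?n)"
      unfolding F(12) using T by simp
    finally show ?thesis .
  qed
  show ?thesis
    by (rule iso2I[of _ \<sigma>]) (use F \<sigma> 1 2 in simp_all)
qed

text \<open>The 2-cell of the right adjoint is the only one for which the counit is a 2-cell of spans, see \<open>adjunction_fibration\<close>.\<close>

definition pull_map :: "('o, 'm) span \<Rightarrow> 'm \<Rightarrow> 'c \<Rightarrow> ('o, 'm, 'c) span_map" where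
  "pull_map S pull \<epsilon> = SpanMap (arr B \<otimes> S) pull (rleg S \<triangleleft> (pr (arr B) S \<triangleleft> \<epsilon>)) S"

lemma pull_map_sel [simp]:
  "mdom (pull_map S pull \<epsilon>) = arr B \<otimes> S" "und (pull_map S pull \<epsilon>) = pull"
  "phi (pull_map S pull \<epsilon>) = rleg S \<triangleleft> (pr (arr B) S \<triangleleft> \<epsilon>)" "mcod (pull_map S pull \<epsilon>) = S"
  by (simp_all add: pull_map_def)

definition unit_cell :: "('o, 'm) span \<Rightarrow> 'm \<Rightarrow> 'c \<Rightarrow> 'c \<Rightarrow> ('o, 'm, 'c) span_cell" where
  "unit_cell S pull \<eta> \<epsilon> =
     SpanCell (id_map S) \<eta> (comp_map (pull_map S pull \<epsilon>) (unt P S))"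

definition counit_cell :: "('o, 'm) span \<Rightarrow> 'm \<Rightarrow> 'c \<Rightarrow> ('o, 'm, 'c) span_cell" where
  "counit_cell S pull \<epsilon> =
     SpanCell (comp_map (unt P S) (pull_map S pull \<epsilon>)) \<epsilon> (id_map (arr B \<otimes> S))"

text \<open>The condition for the unit to be a 2-cell of spans is the first triangle identity, whiskered by the right leg.\<close>

lemma fibration_cells:
  assumes S: "S \<in> spans" and fib_S: "fib S (pull, \<eta>, \<epsilon>)"
  shows "pull_map S pull \<epsilon> \<in> lax" "unit_cell S pull \<eta> \<epsilon> \<in> cells\<^sub>L"
    "counit_cell S pull \<epsilon> \<in> cells\<^sub>L"
proof -
  let ?n = "idn S" and ?u = "pl (arr B) S" and ?v = "pr (arr B) S"
  note F = fibrationD[OF S fib_S]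
  note T = F(2-10) id_name[OF S] ldsD[OF S]
  note l = unt_lax[OF S]
  show p: "pull_map S pull \<epsilon> \<in> lax"
    using T S F(13) by (simp add: lax_iff cmp1_fuse[OF id_name(5)[OF S]])
  have "(rleg S \<odot> ?v) \<triangleleft> ((\<epsilon> \<triangleright> ?n) \<bullet> (?n \<triangleleft> \<eta>)) = id2 K (rleg S)"
    unfolding F(11) using T S by simp
  then have t: "((rleg S \<odot> ?v) \<triangleleft> (\<epsilon> \<triangleright> ?n)) \<bullet> (rleg S \<triangleleft> \<eta>) = id2 K (rleg S)"
    using T S by (simp add: lwhisker_vcmp lwhisker_lwhisker)
  show "unit_cell S pull \<eta> \<epsilon> \<in> cells\<^sub>L"
    using T S t F(14) l lax_id[OF S] lax_comp[OF l(1) p]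
    by (simp add: unit_cell_def span_cells_iff unt_eq_id_name lwhisker_lwhisker whisker_whisker
        cmp1_fuse[OF id_name(5)[OF S]])
  show "counit_cell S pull \<epsilon> \<in> cells\<^sub>L"
    using T S F(15) l lax_id[OF comma_proj(6)[OF S]] lax_comp[OF p l(1)]
    by (simp add: counit_cell_def span_cells_iff unt_eq_id_name lwhisker_lwhisker
        cmp1_fuse[OF id_name(5)[OF S]])
qed

text \<open>Between 2-cells of spans with the same source and target, equality is equality of the underlying 2-cells, so the
triangle identities are those of the underlying 1-cells.\<close>

lemma L_adjunction_iff:
  assumes S: "S \<in> spans"
  shows "adjunction L (unt P S) r \<eta>' \<epsilon>' \<longleftrightarrow> r \<in> lax \<and> mdom r = arr B \<otimes> S \<and> mcod r = S \<and>
    \<eta>' \<in> cells\<^sub>L \<and> csrc \<eta>' = id_map S \<and> ctgt \<eta>' = comp_map r (unt P S) \<and>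
    \<epsilon>' \<in> cells\<^sub>L \<and> csrc \<epsilon>' = comp_map (unt P S) r \<and> ctgt \<epsilon>' = id_map (arr B \<otimes> S) \<and>
    adjunction K (idn S) (und r) (cund \<eta>') (cund \<epsilon>')" (is "_ \<longleftrightarrow> ?R")
proof -
  interpret L: two_category L by (rule dSpan_lax_two_category)
  note l = unt_lax[OF S] and n = unt_eq_id_name[OF S]
  have iff: "adjunction L (unt P S) r \<eta>' \<epsilon>' \<longleftrightarrow> r \<in> lax \<and> mdom r = arr B \<otimes> S \<and> mcod r = S \<and>
    \<eta>' \<in> cells\<^sub>L \<and> csrc \<eta>' = id_map S \<and> ctgt \<eta>' = comp_map r (unt P S) \<and>
    \<epsilon>' \<in> cells\<^sub>L \<and> csrc \<epsilon>' = comp_map (unt P S) r \<and> ctgt \<epsilon>' = id_map (arr B \<otimes> S) \<and>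
    (\<epsilon>' \<triangleright>\<^bsub>L\<^esub> unt P S) \<bullet>\<^bsub>L\<^esub> (unt P S \<triangleleft>\<^bsub>L\<^esub> \<eta>') = id2 L (unt P S) \<and>
    (r \<triangleleft>\<^bsub>L\<^esub> \<epsilon>') \<bullet>\<^bsub>L\<^esub> (\<eta>' \<triangleright>\<^bsub>L\<^esub> r) = id2 L r"
    using L.adjunction_iff[of "unt P S" r \<eta>' \<epsilon>'] l by simp
  have t1: "(\<epsilon>' \<triangleright>\<^bsub>L\<^esub> unt P S) \<bullet>\<^bsub>L\<^esub> (unt P S \<triangleleft>\<^bsub>L\<^esub> \<eta>') = id2 L (unt P S) \<longleftrightarrow>
      (cund \<epsilon>' \<triangleright> idn S) \<bullet> (idn S \<triangleleft> cund \<eta>') = id2 K (idn S)"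
    if "csrc \<eta>' = id_map S" "ctgt \<epsilon>' = id_map (arr B \<otimes> S)"
    using that l n L.cmp1_id1[of "unt P S"] by (simp add: lwhisker_def rwhisker_def)
  have t2: "(r \<triangleleft>\<^bsub>L\<^esub> \<epsilon>') \<bullet>\<^bsub>L\<^esub> (\<eta>' \<triangleright>\<^bsub>L\<^esub> r) = id2 L r \<longleftrightarrow>
      (und r \<triangleleft> cund \<epsilon>') \<bullet> (cund \<eta>' \<triangleright> und r) = id2 K (und r)"
    if "csrc \<eta>' = id_map S" "ctgt \<epsilon>' = id_map (arr B \<otimes> S)" "r \<in> lax"
      "mdom r = arr B \<otimes> S" "mcod r = S"
    using that L.cmp1_id1[of r] by (simp add: lwhisker_def rwhisker_def)
  have cells: "cund \<gamma> \<in> Ce K \<and> Src K (cund \<gamma>) = und (csrc \<gamma>) \<and> Tgt K (cund \<gamma>) = und (ctgt \<gamma>)"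
    if "\<gamma> \<in> cells\<^sub>L" for \<gamma>
    using span_cellsD[OF that] by simp
  have rl: "und r \<in> Ar K \<and> Dom K (und r) = apex (mdom r) \<and> Cod K (und r) = apex (mcod r)" if "r \<in> lax"
    using laxD[OF that] by simp
  show ?thesis
    unfolding iff adjunction_iff[OF id_name(1)[OF S]]
    using t1 t2 cells[of \<eta>'] cells[of \<epsilon>'] rl n id_name[OF S] by auto
qed

lemma fibration_adjunction:
  assumes S: "S \<in> spans" and fib_S: "fib S (pull, \<eta>, \<epsilon>)"
  shows "adjunction L (unt P S) (pull_map S pull \<epsilon>) (unit_cell S pull \<eta> \<epsilon>) (counit_cell S pull \<epsilon>)"
    "iso2 L (unit_cell S pull \<eta> \<epsilon>)"
proof -
  note c = fibration_cells[OF S fib_S]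
  show "adjunction L (unt P S) (pull_map S pull \<epsilon>) (unit_cell S pull \<eta> \<epsilon>) (counit_cell S pull \<epsilon>)"
    unfolding L_adjunction_iff[OF S] using c fibrationD(1)[OF S fib_S]
    by (simp add: unit_cell_def counit_cell_def)
  show "iso2 L (unit_cell S pull \<eta> \<epsilon>)"
    unfolding span_iso2_iff[OF c(2)] using fibration_unit_iso[OF S fib_S] by (simp add: unit_cell_def)
qed

text \<open>Everything but the 1-cell \<open>pull\<close>, the unit and the counit is determined: the condition on the counit computes the 2-cell
of \<open>r\<close>, since the 2-cells of the unit and of the identity are identities.\<close>

lemma adjunction_fibration:
  assumes S: "S \<in> spans" and adj: "adjunction L (unt P S) r \<eta>' \<epsilon>'"
  shows "fib S (und r, cund \<eta>', cund \<epsilon>')"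
    "r = pull_map S (und r) (cund \<epsilon>')" "\<eta>' = unit_cell S (und r) (cund \<eta>') (cund \<epsilon>')"
    "\<epsilon>' = counit_cell S (und r) (cund \<epsilon>')"
proof -
  note A = adj[unfolded L_adjunction_iff[OF S]]
  have r: "r \<in> lax" and \<eta>: "\<eta>' \<in> cells\<^sub>L" and \<epsilon>: "\<epsilon>' \<in> cells\<^sub>L"
    and rm: "mdom r = arr B \<otimes> S" "mcod r = S"
    and c: "csrc \<eta>' = id_map S" "ctgt \<eta>' = comp_map r (unt P S)"
      "csrc \<epsilon>' = comp_map (unt P S) r" "ctgt \<epsilon>' = id_map (arr B \<otimes> S)"
    using A by auto
  note r' = laxD[OF r, unfolded rm] and e = span_cellsD[OF \<epsilon>, unfolded c] and h = span_cellsD[OF \<eta>, unfolded c]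
  note l = unt_lax[OF S] and n = unt_eq_id_name[OF S] and T = id_name[OF S] ldsD[OF S]
  show "fib S (und r, cund \<eta>', cund \<epsilon>')"
    using A r' e(8) h(8) rm l T S by (simp add: fibration_def comma_d0_eq)
  have "phi r = (rleg S \<odot> pr (arr B) S) \<triangleleft> cund \<epsilon>'"
    using e(5-7,9) r' rm l T S n by simp
  then have "phi r = rleg S \<triangleleft> (pr (arr B) S \<triangleleft> cund \<epsilon>')"
    using e(5-7) r' rm l T S n by (simp add: lwhisker_lwhisker)
  then show *: "r = pull_map S (und r) (cund \<epsilon>')"
    by (intro span_map_eqI) (simp_all add: rm)
  show "\<eta>' = unit_cell S (und r) (cund \<eta>') (cund \<epsilon>')" "\<epsilon>' = counit_cell S (und r) (cund \<epsilon>')"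
    using * c by (auto intro!: span_cell_eqI simp: unit_cell_def counit_cell_def)
qed

abbreviation "fibs \<equiv> {(S, st). S \<in> spans \<and> fib S st}"

definition algebra_of ::
  "('o, 'm) span \<times> 'm \<times> 'c \<times> 'c \<Rightarrow> ('o, 'm) span \<times> (('o, 'm) span, ('o, 'm, 'c) span_map) over \<times>
    (('o, 'm) span, ('o, 'm, 'c) span_cell) over \<times> (('o, 'm) span, ('o, 'm, 'c) span_cell) over" where
  "algebra_of = (\<lambda>(S, pull, \<eta>, \<epsilon>).
     (S, G1 (pull_map S pull \<epsilon>), G2 (unit_cell S pull \<eta> \<epsilon>), G2 (counit_cell S pull \<epsilon>)))"

lemma algebra_of_bij:
  "bij_betw algebra_of fibs
     {(a, \<alpha>, \<eta>, \<epsilon>). a \<in> Ob KlT \<and> \<alpha> \<in> hom1 KlT (fob M a) a \<and> adjunction KlT (unt M a) \<alpha> \<eta> \<epsilon> \<and> iso2 KlT \<eta>}"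
    (is "bij_betw _ _ ?Y")
  unfolding bij_betw_def
proof (intro conjI equalityI subsetI)
  interpret G: two_category_iso L KlT "\<lambda>S. S" G1 G2 by (rule kleisli_iso)
  interpret KlT: two_category KlT by (rule G.two_category_Y)
  show "inj_on algebra_of fibs"
  proof (rule inj_onI)
    fix x y assume x: "x \<in> fibs" and y: "y \<in> fibs" and xy: "algebra_of x = algebra_of y"
    obtain S p h e where X: "x = (S, p, h, e)" by (cases x)
    obtain R p' h' e' where Y: "y = (R, p', h', e')" by (cases y)
    have S: "S \<in> spans" "fib S (p, h, e)"
      and R: "R \<in> spans" "fib R (p', h', e')"
      using x y by (auto simp: X Y)
    note c = fibration_cells[OF S] and d = fibration_cells[OF R]
    have "S = R" "pull_map S p e = pull_map R p' e'" "unit_cell S p h e = unit_cell R p' h' e'"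
      "counit_cell S p e = counit_cell R p' e'"
      using xy G.G_inject(2)[of "pull_map S p e" "pull_map R p' e'"]
        G.G_inject(3)[of "unit_cell S p h e" "unit_cell R p' h' e'"]
        G.G_inject(3)[of "counit_cell S p e" "counit_cell R p' e'"] c d
      by (auto simp: algebra_of_def X Y)
    then show "x = y" by (simp add: X Y pull_map_def unit_cell_def counit_cell_def)
  qed
  show "y \<in> ?Y" if mem: "y \<in> algebra_of ` fibs" for y
  proof -
    obtain x where x: "x \<in> fibs" "y = algebra_of x" using mem by blast
    obtain S p h e where "x = (S, p, h, e)" by (cases x)
    with x have S: "S \<in> spans" and fib_S: "fib S (p, h, e)"
      and y: "y = algebra_of (S, p, h, e)" by auto
    note c = fibration_cells[OF S fib_S] and a = fibration_adjunction[OF S fib_S]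
    note l = unt_lax[OF S]
    have "G1 (pull_map S p e) \<in> hom1 KlT (fob M S) S"
      using G.G_mem(2)[of "pull_map S p e"] c by (simp add: KlT.hom1_iff M_fob)
    moreover have "adjunction KlT (unt M S) (G1 (pull_map S p e)) (G2 (unit_cell S p h e)) (G2 (counit_cell S p e))"
      unfolding M_unt[OF S] using a(1) G.G_adjunction[of "unt P S" "pull_map S p e" "unit_cell S p h e" "counit_cell S p e"] c l
      by simp
    moreover have "iso2 KlT (G2 (unit_cell S p h e))"
      using G.G_iso2[of "unit_cell S p h e"] c a(2) by simp
    ultimately show ?thesis using S by (simp add: y algebra_of_def)
  qed
  show "y \<in> algebra_of ` fibs" if "y \<in> ?Y" for y
  proof -
    obtain S \<alpha> \<eta> \<epsilon> where y: "y = (S, \<alpha>, \<eta>, \<epsilon>)" by (cases y)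
    have S: "S \<in> spans" and \<alpha>: "\<alpha> \<in> hom1 KlT (fob M S) S" and adj: "adjunction KlT (unt M S) \<alpha> \<eta> \<epsilon>"
      using that by (simp_all add: y)
    note l = unt_lax[OF S]
    have "\<alpha> \<in> Ar KlT" "\<eta> \<in> Ce KlT" "\<epsilon> \<in> Ce KlT"
      using \<alpha> adj by (auto simp: adjunction_def KlT.hom1_iff KlT.hom2_iff)
    then obtain r h e where r: "r \<in> lax" "\<alpha> = G1 r" and h: "h \<in> cells\<^sub>L" "\<eta> = G2 h"
      and e: "e \<in> cells\<^sub>L" "\<epsilon> = G2 e"
      using G.G_surj(2)[of \<alpha>] G.G_surj(3)[of \<eta>] G.G_surj(3)[of \<epsilon>] by auto
    have "adjunction L (unt P S) r h e"
      using adj G.G_adjunction[of "unt P S" r h e] r h e l by (simp add: M_unt[OF S])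
    note f = adjunction_fibration[OF S this]
    have "y = algebra_of (S, und r, cund h, cund e)"
      by (simp only: y algebra_of_def prod.case f(2-4)[symmetric] r(2) h(2) e(2))
    then show ?thesis using S f(1) by blast
  qed
qed

text \<open>The mate in the Kleisli 2-category is the image of the mate in \<open>dSpan\<^sup>\<Rightarrow>\<close>, which is computed from the underlying cells.\<close>

lemma cartesian_iff_algebra_map:
  assumes S: "S \<in> spans" "fib S (p, h, e)"
    and R: "R \<in> spans" "fib R (p', h', e')"
    and s: "s \<in> lax" "mdom s = S" "mcod s = R"
  shows "iso2 KlT (mate KlT (G1 (pull_map S p e)) (G2 (counit_cell S p e)) (G1 (pull_map R p' e'))
      (G2 (unit_cell R p' h' e')) (G1 s) (far M (G1 s))) \<longleftrightarrow>
    cart S (p, h, e) R (p', h', e') (und s)"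
proof -
  interpret G: two_category_iso L KlT "\<lambda>S. S" G1 G2 by (rule kleisli_iso)
  note l = unt_lax[OF S(1)] and l' = unt_lax[OF R(1)]
  note a = fibration_adjunction(1)[OF S] and a' = fibration_adjunction(1)[OF R]
  note c = comma_span_map_lax[OF s(1)]
  let ?m = "mate L (pull_map S p e) (counit_cell S p e) (pull_map R p' e') (unit_cell R p' h' e') s (comma_span_map s)"
  have sq: "unt P R \<odot>\<^bsub>L\<^esub> s = comma_span_map s \<odot>\<^bsub>L\<^esub> unt P S"
    using comma_span_map_natural[OF s(1)] s by simp
  have m: "?m \<in> cells\<^sub>L"
    using G.X.mate_cell(1)[OF _ _ a a' _ _ _ _ _ _ sq] l l' s c by simp
  have "mate KlT (G1 (pull_map S p e)) (G2 (counit_cell S p e)) (G1 (pull_map R p' e'))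
      (G2 (unit_cell R p' h' e')) (G1 s) (far M (G1 s)) = G2 ?m"
    unfolding M_far[OF s(1)] using G.G_mate[OF _ _ a a' _ _ _ _ _ _ sq] l l' s c by simp
  then have "iso2 KlT (mate KlT (G1 (pull_map S p e)) (G2 (counit_cell S p e)) (G1 (pull_map R p' e'))
      (G2 (unit_cell R p' h' e')) (G1 s) (far M (G1 s))) \<longleftrightarrow> iso2 K (cund ?m)"
    using G.G_iso2[of ?m] m span_iso2_iff[OF m] by simp
  also have "cund ?m = mate K p e p' h' (und s) (comma S R (und s))"
    using s by (simp add: mate_def lwhisker_def rwhisker_def counit_cell_def unit_cell_def)
  finally show ?thesis
    using laxD[OF s(1)] s S R by (simp add: cartesian_def hom1_iff)
qed

lemma cartesian_id:
  assumes S: "S \<in> spans" "fib S st"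
  shows "cart S st S st (id1 K (apex S))"
proof -
  obtain p h e where st: "st = (p, h, e)" by (cases st)
  note F = fibrationD[OF S[unfolded st]]
  show ?thesis
    using mate_identity[OF id_name(1)[OF S(1)] F(1)] F(2) iso2_id2[of p] comma_map_id[OF S(1)] ldsD[OF S(1)]
      id_name[OF S(1)]
    by (simp add: st cartesian_def hom1_iff)
qed

lemma cartesian_comp:
  assumes S: "S \<in> spans" "fib S st"
    and R: "R \<in> spans" "fib R st'"
    and Q: "Q \<in> spans" "fib Q st''"
    and k: "cart S st R st' k" and l: "cart R st' Q st'' l"
  shows "cart S st Q st'' (l \<odot> k)"
proof -
  obtain p h e p' h' e' p'' h'' e'' where st: "st = (p, h, e)" "st' = (p', h', e')" "st'' = (p'', h'', e'')"
    by (cases st; cases st'; cases st'') blast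
  have k': "k \<in> Ar K" "Dom K k = apex S" "Cod K k = apex R" "lleg R \<odot> k = lleg S"
    and km: "iso2 K (mate K p e p' h' k (comma S R k))"
    using k ldsD[OF S(1)] ldsD[OF R(1)] by (auto simp: st cartesian_def hom1_iff)
  have l': "l \<in> Ar K" "Dom K l = apex R" "Cod K l = apex Q" "lleg Q \<odot> l = lleg R"
    and lm: "iso2 K (mate K p' e' p'' h'' l (comma R Q l))"
    using l ldsD[OF R(1)] ldsD[OF Q(1)] by (auto simp: st cartesian_def hom1_iff)
  note F = fibrationD[OF S[unfolded st]] and F' = fibrationD[OF R[unfolded st]] and F'' = fibrationD[OF Q[unfolded st]]
  note c = comma_map[OF S(1) R(1) k'] and d = comma_map[OF R(1) Q(1) l']
  note n = id_name[OF S(1)] and n' = id_name[OF R(1)] and n'' = id_name[OF Q(1)]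
  note sq = comma_natural[OF S(1) R(1) k'] and sq' = comma_natural[OF R(1) Q(1) l']
  have "mate K p e p'' h'' (l \<odot> k) (comma R Q l \<odot> comma S R k) =
    (mate K p' e' p'' h'' l (comma R Q l) \<triangleright> comma S R k) \<bullet>
    (l \<triangleleft> mate K p e p' h' k (comma S R k))"
    by (rule mate_paste[OF n(1) n'(1) n''(1) F(1) F'(1) F''(1)])
      (use k' l' c d n n' n'' sq sq' in simp_all)
  moreover have "iso2 K \<dots>"
  proof (intro iso2_vcmp iso2_lwhisker iso2_rwhisker km lm)
    note m = mate_cell[OF n(1) n'(1) F(1) F'(1) k'(1) _ _ c(1) _ _ sq]
      and m' = mate_cell[OF n'(1) n''(1) F'(1) F''(1) l'(1) _ _ d(1) _ _ sq']
    show "l \<in> Ar K" "comma S R k \<in> Ar K" using l' c by auto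
    show "Cod K (Src K (mate K p e p' h' k (comma S R k))) = Dom K l"
      "Cod K (comma S R k) =
        Dom K (Src K (mate K p' e' p'' h'' l (comma R Q l)))"
      "Tgt K (l \<triangleleft> mate K p e p' h' k (comma S R k)) =
        Src K (mate K p' e' p'' h'' l (comma R Q l) \<triangleright> comma S R k)"
      using m m' k' l' c d n n' n'' F(2-4) F'(2-4) by simp_all
  qed
  ultimately have "iso2 K (mate K p e p'' h'' (l \<odot> k) (comma S Q (l \<odot> k)))"
    using comma_map_comp[OF S(1) R(1) Q(1) k' l'] by simp
  then show ?thesis
    using k' l' ldsD[OF S(1)] ldsD[OF Q(1)] cmp1_fuse[OF l'(4)] by (simp add: st cartesian_def hom1_iff)
qed

lemma fSpan_lax_two_category: "two_category (fSpan_lax K D pb ar B C)"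
proof -
  interpret L: two_category L by (rule dSpan_lax_two_category)
  show ?thesis
    unfolding fSpan_lax_def
  proof (rule L.structured_two_category)
    show "fst a \<in> Ob L" if "a \<in> fibs" for a using that by auto
    show "(\<lambda>(S, st) s (S', st'). cart S st S' st' (und s)) a (id1 L (fst a)) a"
      if "a \<in> fibs" for a
      using that cartesian_id by auto
    show "(\<lambda>(S, st) s (S', st'). cart S st S' st' (und s)) a (g \<odot>\<^bsub>L\<^esub> f) c"
      if "a \<in> fibs" "b \<in> fibs" "c \<in> fibs" "f \<in> hom1 L (fst a) (fst b)" "g \<in> hom1 L (fst b) (fst c)"
        "(\<lambda>(S, st) s (S', st'). cart S st S' st' (und s)) a f b"
        "(\<lambda>(S, st) s (S', st'). cart S st S' st' (und s)) b g c" for a b c f g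
      using that cartesian_comp by (auto split: prod.splits)
  qed
qed

lemma fSpan_lax_isomorphic_Alg:
  "isomorphic_two_categories (fSpan_lax K D pb ar B C) (Alg M KlT)"
proof -
  interpret G: two_category_iso L KlT "\<lambda>S. S" G1 G2 by (rule kleisli_iso)
  have "two_category_iso (fSpan_lax K D pb ar B C) (Alg M KlT) algebra_of
      (\<lambda>f. Over (algebra_of (odom f)) (G1 (ocell f)) (algebra_of (ocod f)))
      (\<lambda>c. Over (algebra_of (odom c)) (G2 (ocell c)) (algebra_of (ocod c)))"
    unfolding fSpan_lax_def Alg_def
  proof (rule G.structured_iso[OF fSpan_lax_two_category[unfolded fSpan_lax_def] algebra_of_bij])
    show "fst a \<in> Ob L \<and> fst (algebra_of a) = fst a" if "a \<in> fibs" for a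
      using that by (auto simp: algebra_of_def)
    show "(\<lambda>(a, \<alpha>, \<eta>, \<epsilon>) \<phi> (b, \<beta>, \<eta>', \<epsilon>'). iso2 KlT (mate KlT \<alpha> \<epsilon> \<beta> \<eta>' \<phi> (far M \<phi>)))
        (algebra_of a) (G1 f) (algebra_of b) \<longleftrightarrow>
      (\<lambda>(S, st) s (S', st'). cart S st S' st' (und s)) a f b"
      if a: "a \<in> fibs" and b: "b \<in> fibs" and f: "f \<in> hom1 L (fst a) (fst b)" for a f b
    proof -
      obtain S p h e where A: "a = (S, p, h, e)" by (cases a)
      obtain R p' h' e' where B: "b = (R, p', h', e')" by (cases b)
      have S: "S \<in> spans" "fib S (p, h, e)"
        and R: "R \<in> spans" "fib R (p', h', e')"
        and s: "f \<in> lax" "mdom f = S" "mcod f = R"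
        using a b f by (auto simp: A B G.X.hom1_iff)
      show ?thesis
        using cartesian_iff_algebra_map[OF S R s] s by (simp add: A B algebra_of_def)
    qed
  qed
  then show ?thesis by (rule two_category_iso.isomorphic)
qed

end

theorem theorem4p12:
  fixes K :: "('o, 'm, 'c) two_cat"
    and D :: "'m set"
    and pb :: "'m \<Rightarrow> 'm \<Rightarrow> 'm \<times> 'm"
    and ar :: "'o \<Rightarrow> 'm \<times> 'm \<times> 'c"
    and B C :: 'o
  assumes "paradise K D"
    and "chosen_pullbacks K D pb"
    and "chosen_arrow_objects K ar"
    and "B \<in> Ob K"
    and "C \<in> Ob K"
  shows "isomorphic_two_categories
           (fSpan_lax K D pb ar B C)
           (Alg (pre_arrow_Kl K D pb ar B C)
                (Kl (post_arrow K pb ar C) (dSpan K D B C)))"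
proof -
  have "two_category K"
    using assms(1) by (simp add: paradise_def display_map_two_category_def)
  then interpret paradise_spans K D pb ar B C
    using assms by (intro paradise_spans.intro paradise_choice.intro displayed_two_category.intro
        paradise_choice_axioms.intro paradise_spans_axioms.intro)
  show ?thesis by (rule fSpan_lax_isomorphic_Alg)
qed

end
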